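(* Let $1/2<H<1$, $n\ge2$, and let $b,\sigma,\bar X$ be as in the context, where the nonconstant $T$-periodic solution $\bar X$ of $\dot{\bar X}_t=b(\bar X_t)$, $\bar X_0=\bar X_T=x_0$, is transversally hyperbolic. Suppose that $\nabla(\nabla\cdot b)(\bar X_t)=0$ for all $t$ and that the effective potential has a positive direction: $$\mathcal V_{\mathrm{eff}}([\omega^*])>0\quad\text{for some }[\omega^*]\in\widetilde{\mathcal W}_{\mathrm{CR}} .$$ Then, for every $\epsilon>0$, there exists $N_{\mathrm{crit}}(\epsilon)\in\mathbb N^+$ such that, whenever $N>N_{\mathrm{crit}}(\epsilon)$, the periodic extension of $\bar X$ to $[0,NT]$ is not a local minimizer of $J_{\epsilon,N}$ in $x_0+\mathcal H_H^\sigma([0,NT];\mathbb R^n)$.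
   Context: Setting. $b:\mathbb R^n\to\mathbb R^n$ is autonomous and of class $C_b^3$ (bounded with bounded continuous derivatives up to order three); $\sigma_t=\operatorname{diag}(\sigma^1_t,\dots,\sigma^n_t)$, $t\ge0$, is deterministic, $C^1$ and $T$-periodic with $0<m_i\le\sigma^i_t\le M_i$. Transversally hyperbolic: for the variational equation $\dot v=\nabla b(\bar X_t)v$, the Floquet multiplier $1$ is simple and every other Floquet multiplier $\mu$ satisfies $|\mu|\ne1$. Constant-response modes. Put $(\mathcal L\omega)_s=\omega_s'-\nabla b(\bar X_s)\omega_s$. Let $y$ be a nonzero $T$-periodic solution of $y_s'+\nabla b(\bar X_s)^Ty_s=0$, $z_{\mathrm{CR}}=\int_0^T\sigma_s^Ty_s\,ds$, and $\mathcal A_{\mathrm{CR}}=\{q\in\mathbb R^n: z_{\mathrm{CR}}^Tq=0\}$. Then $$\widetilde{\mathcal W}_{\mathrm{CR}}=\left\{[\omega]\in H^1_{\mathrm{per}}([0,T];\mathbb R^n)/\operatorname{span}\{\bar X'\}:\ \mathcal L\omega=\sigma q\text{ for some constant }q\in\mathcal A_{\mathrm{CR}}\right\},$$ and $\mathcal V_{\mathrm{eff}}([\omega])=-\int_0^T\omega_s^T\nabla^2(\nabla\cdot b)(\bar X_s)\omega_s\,ds$, which is independent of the representative when $\nabla(\nabla\cdot b)(\bar X_t)\equiv0$. Functional. Kernel, for $0<s<t$: $K_H(t,s)=c_H\left[(t/s)^{H-\frac12}(t-s)^{H-\frac12}-(H-\frac12)s^{\frac12-H}\int_s^tu^{H-\frac32}(u-s)^{H-\frac12}du\right]$,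 $c_H=\sqrt{\frac{2H\Gamma(3/2-H)}{\Gamma(H+1/2)\Gamma(2-2H)}}$. For $u\in L^2([0,NT];\mathbb R^n)$: $(K_Hu)(t)=\int_0^tK_H(t,s)u(s)ds$, $(K_H^\sigma u)(t)=\int_0^t\sigma_s\,d(K_Hu)(s)$ (Young integral). $\mathcal H_H^\sigma([0,NT];\mathbb R^n):=K_H^\sigma(L^2)$, with norm $\|h\|_{\mathcal H_H^\sigma}=\|(K_H^\sigma)^{-1}h\|_{L^2(0,NT)}$; local minimality refers to this norm. With $d_H=\sqrt{2H\Gamma(H+\frac12)\Gamma(\frac32-H)/\Gamma(2-2H)}$, $$J_{\epsilon,N}(\phi)=\frac1{2\epsilon}\int_0^{NT}\left|(K_H^\sigma)^{-1}\left(\phi_\cdot-x_0-\int_0^\cdot b(\phi_s)ds\right)(t)\right|^2dt+\frac{d_H}2\int_0^{NT}\nabla\cdot b(\phi_t)\,dt .$$ *)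

theory Defs
  imports "HOL-Analysis.Analysis" "HOL-Computational_Algebra.Polynomial"
begin

section \<open>Regularity and differential operators\<close>

text \<open>
  Class \<open>C\<^sub>b\<^sup>k\<close> on the whole space: the map and all its iterated partial derivatives up to order
  \<open>k\<close> exist, are continuous and are bounded.
\<close>
primrec Cb :: "nat \<Rightarrow> ('a::euclidean_space \<Rightarrow> 'b::real_normed_vector) \<Rightarrow> bool" where
  "Cb 0 f \<longleftrightarrow> continuous_on UNIV f \<and> bounded (range f)"
| "Cb (Suc k) f \<longleftrightarrow> continuous_on UNIV f \<and> bounded (range f) \<and> (\<forall>x. f differentiable at x) \<and>
     (\<forall>e\<in>Basis. Cb k (\<lambda>x. frechet_derivative f (at x) e))"

definition C1_half_line :: "(real \<Rightarrow> real) \<Rightarrow> bool" where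
  "C1_half_line f \<longleftrightarrow> (\<exists>f'. continuous_on {0..} f' \<and>
     (\<forall>t\<ge>0. (f has_real_derivative f' t) (at t within {0..})))"

definition divergence :: "(real^'n \<Rightarrow> real^'n) \<Rightarrow> real^'n \<Rightarrow> real" where
  "divergence b x = trace (jacobian b (at x))"

definition gradient :: "(real^'n \<Rightarrow> real) \<Rightarrow> real^'n \<Rightarrow> real^'n" where
  "gradient f x = (\<chi> i. frechet_derivative f (at x) (axis i 1))"

definition hessian :: "(real^'n \<Rightarrow> real) \<Rightarrow> real^'n \<Rightarrow> real^'n^'n" where
  "hessian f x = jacobian (gradient f) (at x)"

definition diag_matrix :: "('n \<Rightarrow> real) \<Rightarrow> real^'n^'n" where
  "diag_matrix d = (\<chi> i j. if i = j then d i else 0)"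

section \<open>Periodic orbits and Floquet multipliers\<close>

text \<open>Time runs over \<open>[0,\<infinity>)\<close>. The number \<open>T\<close> is a period, not necessarily the minimal one.\<close>
definition periodic_solution ::
    "(real \<Rightarrow> real^'n \<Rightarrow> real^'n) \<Rightarrow> real \<Rightarrow> (real \<Rightarrow> real^'n) \<Rightarrow> bool" where
  "periodic_solution F T y \<longleftrightarrow>
     (\<forall>t\<ge>0. (y has_vector_derivative F t (y t)) (at t within {0..})) \<and> (\<forall>t\<ge>0. y (t + T) = y t)"

text \<open>\<open>M = \<Phi>(T)\<close> for the principal fundamental matrix \<open>\<Phi>\<close> of \<open>v' = A v\<close>.\<close>
definition monodromy_matrix :: "(real \<Rightarrow> real^'n^'n) \<Rightarrow> real \<Rightarrow> real^'n^'n \<Rightarrow> bool" where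
  "monodromy_matrix A T M \<longleftrightarrow>
     (\<exists>\<Phi>. \<Phi> 0 = mat 1 \<and>
       (\<forall>t\<in>{0..T}. (\<Phi> has_vector_derivative A t ** \<Phi> t) (at t within {0..T})) \<and> M = \<Phi> T)"

definition complexify :: "real^'n^'n \<Rightarrow> complex^'n^'n" where
  "complexify M = (\<chi> i j. complex_of_real (M $ i $ j))"

definition complex_eigenvalue :: "real^'n^'n \<Rightarrow> complex \<Rightarrow> bool" where
  "complex_eigenvalue M \<mu> \<longleftrightarrow> (\<exists>v. v \<noteq> 0 \<and> complexify M *v v = \<mu> *s v)"

definition charpoly :: "real^'n^'n \<Rightarrow> complex poly" where
  "charpoly M = det (\<chi> i j. (if i = j then [:0, 1:] else 0) - [:complexify M $ i $ j:])"

text \<open>Simplicity of the multiplier 1 is meant algebraically.\<close>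
definition transversally_hyperbolic ::
    "(real^'n \<Rightarrow> real^'n) \<Rightarrow> real \<Rightarrow> (real \<Rightarrow> real^'n) \<Rightarrow> bool" where
  "transversally_hyperbolic b T X \<longleftrightarrow>
     (\<exists>M. monodromy_matrix (\<lambda>t. jacobian b (at (X t))) T M \<and>
       complex_eigenvalue M 1 \<and> order 1 (charpoly M) = 1 \<and>
       (\<forall>\<mu>. complex_eigenvalue M \<mu> \<and> \<mu> \<noteq> 1 \<longrightarrow> cmod \<mu> \<noteq> 1))"

section \<open>Constant-response modes\<close>

text \<open>
  Square-integrable functions on \<open>[0,L]\<close>. They are honest functions; almost everywhere equal
  functions are not identified, and values outside \<open>[0,L]\<close> are irrelevant.
\<close>
definition L2 :: "real \<Rightarrow> (real \<Rightarrow> real^'n) set" where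
  "L2 L = {u. u \<in> borel_measurable (lebesgue_on {0..L}) \<and>
              integrable (lebesgue_on {0..L}) (\<lambda>t. (norm (u t))\<^sup>2)}"

definition has_L2_derivative :: "(real \<Rightarrow> real^'n) \<Rightarrow> (real \<Rightarrow> real^'n) \<Rightarrow> real \<Rightarrow> bool" where
  "has_L2_derivative \<omega> g T \<longleftrightarrow>
     g \<in> L2 T \<and> (\<forall>t\<in>{0..T}. \<omega> t = \<omega> 0 + (LINT s|lebesgue_on {0..t}. g s))"

text \<open>\<open>H\<^sup>1\<^sub>p\<^sub>e\<^sub>r([0,T])\<close>, each class being given by its continuous representative on \<open>[0,T]\<close>.\<close>
definition H1_per :: "real \<Rightarrow> (real \<Rightarrow> real^'n) set" where
  "H1_per T = {\<omega>. (\<exists>g. has_L2_derivative \<omega> g T) \<and> \<omega> T = \<omega> 0}"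

text \<open>
  Congruence modulo \<open>span {X'}\<close>; it also identifies functions that agree on \<open>[0,T]\<close>.
  The quotient space is \<open>H1_per T // mod_velocity T X\<close>.
\<close>
definition mod_velocity ::
    "real \<Rightarrow> (real \<Rightarrow> real^'n) \<Rightarrow> ((real \<Rightarrow> real^'n) \<times> (real \<Rightarrow> real^'n)) set" where
  "mod_velocity T X = {(\<omega>, \<eta>). \<omega> \<in> H1_per T \<and> \<eta> \<in> H1_per T \<and>
     (\<exists>c. \<forall>s\<in>{0..T}. \<eta> s = \<omega> s + c *\<^sub>R vector_derivative X (at s within {0..T}))}"

definition z_CR :: "real \<Rightarrow> (real \<Rightarrow> real^'n^'n) \<Rightarrow> (real \<Rightarrow> real^'n) \<Rightarrow> real^'n" where
  "z_CR T \<sigma> y = (LINT s|lebesgue_on {0..T}. transpose (\<sigma> s) *v y s)"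

definition A_CR :: "real \<Rightarrow> (real \<Rightarrow> real^'n^'n) \<Rightarrow> (real \<Rightarrow> real^'n) \<Rightarrow> (real^'n) set" where
  "A_CR T \<sigma> y = {q. z_CR T \<sigma> y \<bullet> q = 0}"

text \<open>\<open>\<L>\<omega> = f\<close> as elements of \<open>L\<^sup>2\<close>, where \<open>(\<L>\<omega>)\<^sub>s = \<omega>'\<^sub>s - \<nabla>b(X\<^sub>s) \<omega>\<^sub>s\<close>.\<close>
definition linearization_eq ::
    "(real^'n \<Rightarrow> real^'n) \<Rightarrow> real \<Rightarrow> (real \<Rightarrow> real^'n) \<Rightarrow> (real \<Rightarrow> real^'n) \<Rightarrow> (real \<Rightarrow> real^'n) \<Rightarrow> bool"
  where
  "linearization_eq b T X \<omega> f \<longleftrightarrow>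
     (\<exists>g. has_L2_derivative \<omega> g T \<and>
       (AE s in lebesgue_on {0..T}. g s - jacobian b (at (X s)) *v \<omega> s = f s))"

definition W_CR ::
    "(real^'n \<Rightarrow> real^'n) \<Rightarrow> (real \<Rightarrow> real^'n^'n) \<Rightarrow> real \<Rightarrow> (real \<Rightarrow> real^'n) \<Rightarrow> (real \<Rightarrow> real^'n)
      \<Rightarrow> (real \<Rightarrow> real^'n) set set" where
  "W_CR b \<sigma> T X y = {mod_velocity T X `` {\<omega>} | \<omega>. \<omega> \<in> H1_per T \<and>
     (\<exists>q\<in>A_CR T \<sigma> y. linearization_eq b T X \<omega> (\<lambda>s. \<sigma> s *v q))}"

definition V_form ::
    "(real^'n \<Rightarrow> real^'n) \<Rightarrow> real \<Rightarrow> (real \<Rightarrow> real^'n) \<Rightarrow> (real \<Rightarrow> real^'n) \<Rightarrow> real" where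
  "V_form b T X \<omega> =
     - (LINT s|lebesgue_on {0..T}. \<omega> s \<bullet> (hessian (divergence b) (X s) *v \<omega> s))"

text \<open>
  The common value of \<open>V_form\<close> on a class; there is one if the gradient of the divergence of \<open>b\<close>
  vanishes along the orbit.
\<close>
definition V_eff ::
    "(real^'n \<Rightarrow> real^'n) \<Rightarrow> real \<Rightarrow> (real \<Rightarrow> real^'n) \<Rightarrow> (real \<Rightarrow> real^'n) set \<Rightarrow> real" where
  "V_eff b T X C = the_elem (V_form b T X ` C)"

section \<open>The Cameron--Martin space and the Onsager--Machlup functional\<close>

definition c_H :: "real \<Rightarrow> real" where
  "c_H H = sqrt (2 * H * Gamma (3/2 - H) / (Gamma (H + 1/2) * Gamma (2 - 2 * H)))"

definition d_H :: "real \<Rightarrow> real" where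
  "d_H H = sqrt (2 * H * Gamma (H + 1/2) * Gamma (3/2 - H) / Gamma (2 - 2 * H))"

definition fbm_kernel :: "real \<Rightarrow> real \<Rightarrow> real \<Rightarrow> real" where
  "fbm_kernel H t s = (if 0 < s \<and> s < t then
     c_H H * ((t / s) powr (H - 1/2) * (t - s) powr (H - 1/2)
       - (H - 1/2) * s powr (1/2 - H) *
         (LINT u|lebesgue_on {s..t}. u powr (H - 3/2) * (u - s) powr (H - 1/2)))
     else 0)"

definition K_op :: "real \<Rightarrow> (real \<Rightarrow> real^'n) \<Rightarrow> real \<Rightarrow> real^'n" where
  "K_op H u t = (LINT s|lebesgue_on {0..t}. fbm_kernel H t s *\<^sub>R u s)"

text \<open>
  The Young integral \<open>\<integral>\<^sub>a\<^sup>c A dg\<close>, as the limit of Riemann--Stieltjes sums with arbitrary tags as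
  the mesh of the partition tends to 0.
\<close>
definition has_young_integral ::
    "(real \<Rightarrow> real^'n^'n) \<Rightarrow> (real \<Rightarrow> real^'n) \<Rightarrow> real \<Rightarrow> real \<Rightarrow> real^'n \<Rightarrow> bool" where
  "has_young_integral A g a c I \<longleftrightarrow>
     (\<forall>e>0. \<exists>d>0. \<forall>p. p tagged_division_of {a..c} \<and> (\<forall>(x, k)\<in>p. Sup k - Inf k < d) \<longrightarrow>
        norm ((\<Sum>(x, k)\<in>p. A x *v (g (Sup k) - g (Inf k))) - I) < e)"

definition young_integral ::
    "(real \<Rightarrow> real^'n^'n) \<Rightarrow> (real \<Rightarrow> real^'n) \<Rightarrow> real \<Rightarrow> real \<Rightarrow> real^'n" where
  "young_integral A g a c = (THE I. has_young_integral A g a c I)"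

definition K_sigma ::
    "real \<Rightarrow> (real \<Rightarrow> real^'n^'n) \<Rightarrow> (real \<Rightarrow> real^'n) \<Rightarrow> real \<Rightarrow> real^'n" where
  "K_sigma H \<sigma> u t = young_integral \<sigma> (K_op H u) 0 t"

text \<open>Paths on \<open>[0,L]\<close> are represented by functions on the line whose other values are irrelevant.\<close>
definition CM_space :: "real \<Rightarrow> (real \<Rightarrow> real^'n^'n) \<Rightarrow> real \<Rightarrow> (real \<Rightarrow> real^'n) set" where
  "CM_space H \<sigma> L = {h. \<exists>u\<in>L2 L. \<forall>t\<in>{0..L}. h t = K_sigma H \<sigma> u t}"

text \<open>
  The inverse of \<open>K_sigma\<close> on \<open>CM_space\<close>. The preimage is unique up to equality almost everywhere,
  so the choice does not affect the integrals below.
\<close>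
definition K_sigma_inv ::
    "real \<Rightarrow> (real \<Rightarrow> real^'n^'n) \<Rightarrow> real \<Rightarrow> (real \<Rightarrow> real^'n) \<Rightarrow> real \<Rightarrow> real^'n" where
  "K_sigma_inv H \<sigma> L h = (SOME u. u \<in> L2 L \<and> (\<forall>t\<in>{0..L}. h t = K_sigma H \<sigma> u t))"

definition CM_norm ::
    "real \<Rightarrow> (real \<Rightarrow> real^'n^'n) \<Rightarrow> real \<Rightarrow> (real \<Rightarrow> real^'n) \<Rightarrow> real" where
  "CM_norm H \<sigma> L h = sqrt (LINT t|lebesgue_on {0..L}. (norm (K_sigma_inv H \<sigma> L h t))\<^sup>2)"

definition OM_functional ::
    "real \<Rightarrow> (real^'n \<Rightarrow> real^'n) \<Rightarrow> (real \<Rightarrow> real^'n^'n) \<Rightarrow> real^'n \<Rightarrow> real \<Rightarrow> real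
      \<Rightarrow> (real \<Rightarrow> real^'n) \<Rightarrow> real" where
  "OM_functional H b \<sigma> x\<^sub>0 \<epsilon> L \<phi> =
     1 / (2 * \<epsilon>) * (LINT t|lebesgue_on {0..L}.
       (norm (K_sigma_inv H \<sigma> L (\<lambda>r. \<phi> r - x\<^sub>0 - (LINT s|lebesgue_on {0..r}. b (\<phi> s))) t))\<^sup>2)
     + d_H H / 2 * (LINT t|lebesgue_on {0..L}. divergence b (\<phi> t))"

definition affine_CM ::
    "real \<Rightarrow> (real \<Rightarrow> real^'n^'n) \<Rightarrow> real \<Rightarrow> real^'n \<Rightarrow> (real \<Rightarrow> real^'n) set" where
  "affine_CM H \<sigma> L x\<^sub>0 = {\<phi>. (\<lambda>t. \<phi> t - x\<^sub>0) \<in> CM_space H \<sigma> L}"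

text \<open>
  Local minimality of \<open>J\<close> at \<open>X\<close> within \<open>x\<^sub>0 + CM_space\<close>, for the Cameron--Martin norm. Competitors
  are required to differ from \<open>X\<close> by an element of \<open>CM_space\<close>, so that the negation of this
  predicate cannot hold merely because \<open>X\<close> is not in \<open>x\<^sub>0 + CM_space\<close>.
\<close>
definition local_minimizer ::
    "real \<Rightarrow> (real \<Rightarrow> real^'n^'n) \<Rightarrow> real \<Rightarrow> real^'n \<Rightarrow> ((real \<Rightarrow> real^'n) \<Rightarrow> real)
      \<Rightarrow> (real \<Rightarrow> real^'n) \<Rightarrow> bool" where
  "local_minimizer H \<sigma> L x\<^sub>0 J X \<longleftrightarrow>
     (\<exists>\<delta>>0. \<forall>\<phi>\<in>affine_CM H \<sigma> L x\<^sub>0.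
        (\<lambda>t. \<phi> t - X t) \<in> CM_space H \<sigma> L \<and> CM_norm H \<sigma> L (\<lambda>t. \<phi> t - X t) < \<delta> \<longrightarrow> J X \<le> J \<phi>)"

end

(* With alpha = H - 1/2, the operator K_H is integration composed with u -> c r^alpha I^alpha(s^(-alpha) u),
   where I^alpha is the Riemann-Liouville integral. Hence K_H^sigma is injective, and the path with
   derivative sigma rho, rho of class C^1, is K_H^sigma u where Abel inversion gives u explicitly:
   its energy on [0,L] is at most a constant times |rho(0)|^2 L^(2-2H) + sup |rho'|^2 L^(4-2H).

   Let omega be a constant-response mode, extended periodically, with L omega = sigma q. Perturb the orbit by
   tau h with h(t) = t omega(t). Then L h = omega + t sigma q, and after division by sigma it has a derivative
   bounded uniformly in time, so that the energy contributes O(tau^2 L^(4-2H)) with 4 - 2H < 3, whereas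
   the divergence term contributes (d_H/4) tau^2 times the integral of t^2 <omega, Hess(div b) omega>, which is
   about -(d_H/12) V_eff(omega) T^2 N^3 tau^2. For large N the second variation along h is therefore
   negative. *)
theory Submission
  imports Defs "HOL-Real_Asymp.Real_Asymp"
begin

section \<open>Fractional integrals\<close>

text \<open>Constancy of q is what makes the factor t affordable. The energy bound sees a path p
  only through the starting value and the slope of \<rho> = \<sigma>^(-1) p'. For the linearised
  defect of h(t) = t \<omega>(t) the secular part of \<rho> is t q, of slope q; a time-dependent
  response would contribute t q'(t), of size L, and the bound would grow like L^(6-2H), faster than
  the cubic gain.

  The inverse of \<open>K_sigma\<close> is an unspecified choice of preimage and
  \<open>K_sigma\<close> a limit of Riemann sums, so energies cannot be read off the definitions.
  Injectivity up to null sets lets the chosen preimage be replaced by an explicit one under the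
  integral.

  Differentiability of the functional is never shown. Minimality is tested along \<tau> = 1/(n+1):
  the energy of the perturbed path is bounded above, that of the orbit below by 0, and the
  difference divided by \<tau>^2 passes to the limit. The nonlinear remainder of b changes the slope
  only by a multiple of \<tau>^2; its constant may depend on L, which is fixed while \<tau> tends to
  0.\<close>

lemma sigma_finite_lebesgue: "sigma_finite_measure (lebesgue :: 'a::euclidean_space measure)"
proof
  obtain A where A: "countable A" "A \<subseteq> sets (lborel::'a measure)" "\<Union>A = space lborel"
      "\<And>a. a \<in> A \<Longrightarrow> emeasure lborel a \<noteq> \<infinity>"
    using lborel.sigma_finite_countable by (metis)
  show "\<exists>A. countable A \<and> A \<subseteq> sets (lebesgue :: 'a measure) \<and> \<Union>A = space (lebesgue :: 'a measure) \<and>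
      (\<forall>a\<in>A. emeasure (lebesgue :: 'a measure) a \<noteq> \<infinity>)"
  proof (intro exI[of _ A] conjI ballI A(1))
    show "A \<subseteq> sets lebesgue" using A(2) by auto
    show "\<Union>A = space lebesgue" using A(3) by (simp del: space_lborel)
    show "emeasure lebesgue a \<noteq> \<infinity>" if "a \<in> A" for a
      using A(2) A(4)[OF that] that by (simp add: emeasure_completion subset_iff)
  qed
qed

interpretation lebesgue: sigma_finite_measure "lebesgue :: 'a::euclidean_space measure"
  by (rule sigma_finite_lebesgue)

interpretation lebesgue_pair: pair_sigma_finite "lebesgue :: 'a::euclidean_space measure"
    "lebesgue :: 'b::euclidean_space measure" ..

text \<open>Elements of \<open>L2\<close> are only Lebesgue measurable, so Fubini is used on the
  product of the completed measure with itself; the kernels are Borel on the plane, and the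
  coordinate maps carry them over. The swapped version serves when the outer variable comes
  second.\<close>

lemma borel_pair_measurable_lebesgue:
  fixes f :: "real \<times> real \<Rightarrow> 'a::topological_space"
  assumes "f \<in> borel_measurable (borel \<Otimes>\<^sub>M borel)"
  shows "f \<in> borel_measurable (lebesgue \<Otimes>\<^sub>M lebesgue)"
    and "(\<lambda>p. f (snd p, fst p)) \<in> borel_measurable (lebesgue \<Otimes>\<^sub>M lebesgue)"
proof -
  have *: "(\<lambda>p. (fst p, snd p)) \<in> lebesgue \<Otimes>\<^sub>M lebesgue \<rightarrow>\<^sub>M (borel \<Otimes>\<^sub>M borel :: (real \<times> real) measure)"
    "(\<lambda>p. (snd p, fst p)) \<in> lebesgue \<Otimes>\<^sub>M lebesgue \<rightarrow>\<^sub>M (borel \<Otimes>\<^sub>M borel :: (real \<times> real) measure)"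
    by (intro measurable_Pair measurable_compose[OF measurable_snd] measurable_compose[OF measurable_fst],
        auto simp: measurable_completion)+
  show "f \<in> borel_measurable (lebesgue \<Otimes>\<^sub>M lebesgue)"
    using measurable_compose[OF *(1) assms] by simp
  show "(\<lambda>p. f (snd p, fst p)) \<in> borel_measurable (lebesgue \<Otimes>\<^sub>M lebesgue)"
    using measurable_compose[OF *(2) assms] by simp
qed

text \<open>Since \<open>k\<close> is non-negative, the norm of the integrand integrates over r to
  the kernel integral times \<open>norm (v s)\<close>, so \<open>int\<close> is the Tonelli
  condition. Assumption \<open>ki\<close> is confined to \<open>v s \<noteq> 0\<close>: where
  \<open>v\<close> vanishes the integrand is 0, and for the fractional kernel the integral is
  computed only at s > 0.\<close>

lemma kernel_Fubini:
  fixes k :: "real \<Rightarrow> real \<Rightarrow> real" and v :: "real \<Rightarrow> 'a::euclidean_space"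
  assumes km: "(\<lambda>(r, s). k r s) \<in> borel_measurable (borel \<Otimes>\<^sub>M borel)"
    and k0: "\<And>r s. 0 \<le> k r s"
    and vm: "v \<in> borel_measurable lebesgue"
    and ki: "\<And>s. v s \<noteq> 0 \<Longrightarrow> integrable lebesgue (\<lambda>r. k r s)"
    and int: "integrable lebesgue (\<lambda>s. (LINT r|lebesgue. k r s) * norm (v s))"
  shows "integrable lebesgue (\<lambda>r. LINT s|lebesgue. k r s *\<^sub>R v s)"
    and "(LINT r|lebesgue. LINT s|lebesgue. k r s *\<^sub>R v s) = (LINT s|lebesgue. (LINT r|lebesgue. k r s) *\<^sub>R v s)"
proof -
  have km': "(\<lambda>p. k (snd p) (fst p)) \<in> borel_measurable (lebesgue \<Otimes>\<^sub>M lebesgue)"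
    using borel_pair_measurable_lebesgue(2)[OF km] by simp
  define f where "f = (\<lambda>p::real\<times>real. k (snd p) (fst p) *\<^sub>R v (fst p))"
  have fm: "f \<in> borel_measurable (lebesgue \<Otimes>\<^sub>M lebesgue)"
    unfolding f_def by (intro borel_measurable_scaleR km' measurable_compose[OF measurable_fst] vm)
  have *: "integrable (lebesgue \<Otimes>\<^sub>M lebesgue) f"
  proof (rule lebesgue_pair.Fubini_integrable[OF fm])
    have "(LINT r|lebesgue. norm (f (s, r))) = (LINT r|lebesgue. k r s) * norm (v s)" for s
      by (simp add: f_def k0)
    then show "integrable lebesgue (\<lambda>s. LINT r|lebesgue. norm (f (s, r)))"
      using int by simp
    have "integrable lebesgue (\<lambda>r. f (s, r))" for s
      by (cases "v s = 0") (auto simp: f_def intro!: integrable_scaleR_left ki)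
    then show "AE s in lebesgue. integrable lebesgue (\<lambda>r. f (s, r))" by simp
  qed
  have *: "integrable (lebesgue \<Otimes>\<^sub>M lebesgue) (\<lambda>(s, r). k r s *\<^sub>R v s)"
    using * by (simp add: f_def split_beta')
  show "integrable lebesgue (\<lambda>r. LINT s|lebesgue. k r s *\<^sub>R v s)"
    using lebesgue_pair.integrable_snd[OF *] by simp
  show "(LINT r|lebesgue. LINT s|lebesgue. k r s *\<^sub>R v s) = (LINT s|lebesgue. (LINT r|lebesgue. k r s) *\<^sub>R v s)"
  proof -
    have "(LINT r|lebesgue. LINT s|lebesgue. k r s *\<^sub>R v s) = (LINT s|lebesgue. LINT r|lebesgue. k r s *\<^sub>R v s)"
      using lebesgue_pair.Fubini_integral[OF *] by simp
    also have "\<dots> = (LINT s|lebesgue. (LINT r|lebesgue. k r s) *\<^sub>R v s)"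
    proof (rule Bochner_Integration.integral_cong[OF refl])
      fix s show "(LINT r|lebesgue. k r s *\<^sub>R v s) = (LINT r|lebesgue. k r s) *\<^sub>R v s"
        by (cases "v s = 0") (auto simp: ki)
    qed
    finally show ?thesis .
  qed
qed

text \<open>The kernel \<open>x\<^sub>+\<^sup>a\<close>, which makes fractional integrals convolutions on the whole line.\<close>
definition pk :: "real \<Rightarrow> real \<Rightarrow> real" where
  "pk a x = (if 0 < x then x powr a else 0)"

lemma pk_nonneg [simp]: "0 \<le> pk a x"
  by (simp add: pk_def)

lemma pk_measurable [measurable]: "pk a \<in> borel_measurable borel"
  unfolding pk_def[abs_def] by measurable

lemma lebesgue_bochner_of_borel:
  fixes f :: "real \<Rightarrow> 'a::{banach, second_countable_topology}"
  shows "has_bochner_integral lborel f x \<Longrightarrow> has_bochner_integral lebesgue f x"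
  by (auto simp: has_bochner_integral_iff integrable_completion integral_completion
      dest: borel_measurable_integrable)

text \<open>The substitution x = (s - r)/(t - r) reduces it to the Beta integral; for r \<ge> t both
  sides vanish. This is the semigroup law of fractional integration on the level of kernels.\<close>

lemma pk_convolution:
  assumes a: "0 < a" and b: "0 < b"
  shows "has_bochner_integral lebesgue (\<lambda>s. pk (b-1) (t-s) * pk (a-1) (s-r)) (Beta a b * pk (a+b-1) (t-r))"
proof (cases "r < t")
  case False
  then have "pk (b-1) (t-s) * pk (a-1) (s-r) = 0" for s by (auto simp: pk_def)
  moreover have "pk (a+b-1) (t-r) = 0" using False by (simp add: pk_def)
  ultimately show ?thesis by (simp only: mult_zero_right has_bochner_integral_zero)
next
  case True
  define g where "g = (\<lambda>x. pk (a-1) x * pk (b-1) (1-x))"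
  have [measurable]: "g \<in> borel_measurable borel" unfolding g_def by measurable
  have "((\<lambda>x. x powr (a-1) * (1-x) powr (b-1)) has_integral Beta a b) {0<..<1}"
    using has_integral_Beta_real[OF a b] by (simp add: has_integral_Icc_iff_Ioo)
  then have "(g has_integral Beta a b) {0<..<1}"
    by (rule has_integral_eq[rotated]) (auto simp: g_def pk_def)
  then have gi: "(g has_integral Beta a b) UNIV"
    by (rule has_integral_on_superset) (auto simp: g_def pk_def)
  have B0: "0 \<le> Beta a b" using a b by (simp add: Beta_def Gamma_real_pos less_imp_le)
  have "has_bochner_integral lborel g (Beta a b)"
    by (rule has_bochner_integral_nn_integral)
       (use gi B0 in \<open>auto intro!: nn_integral_has_integral_lborel simp: g_def\<close>)
  then have "has_bochner_integral lborel (\<lambda>x. g (- r / (t-r) + (1/(t-r)) * x)) (Beta a b /\<^sub>R \<bar>1/(t-r)\<bar>)"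
    by (subst (asm) lborel_has_bochner_integral_real_affine_iff[of "1/(t-r)" _ _ "-r/(t-r)"])
       (use True in auto)
  then have "has_bochner_integral lborel (\<lambda>x. (t-r) powr (a+b-2) *\<^sub>R g (- r / (t-r) + (1/(t-r)) * x))
     ((t-r) powr (a+b-2) *\<^sub>R (Beta a b /\<^sub>R \<bar>1/(t-r)\<bar>))"
    by (rule has_bochner_integral_scaleR_right)
  moreover have "(t-r) powr (a+b-2) *\<^sub>R g (- r / (t-r) + (1/(t-r)) * s) = pk (b-1) (t-s) * pk (a-1) (s-r)" for s
  proof -
    have 1: "- r / (t-r) + (1/(t-r)) * s = (s-r)/(t-r)" "1 - (s-r)/(t-r) = (t-s)/(t-r)"
      using True by (simp_all add: divide_simps)
    have 2: "(t-r) powr (a+b-2) = (t-r) powr (a-1) * (t-r) powr (b-1)"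
      by (simp flip: powr_add add: algebra_simps)
    show ?thesis unfolding g_def 1 unfolding 2
      using True by (auto simp: pk_def powr_divide zero_less_divide_iff)
  qed
  moreover have "(t-r) powr (a+b-2) *\<^sub>R (Beta a b /\<^sub>R \<bar>1/(t-r)\<bar>) = Beta a b * pk (a+b-1) (t-r)"
  proof -
    have "(t-r) powr (a+b-1) = (t-r) powr (a+b-2) * (t-r)"
      using True powr_add[of "t-r" "a+b-2" 1] by (simp add: add.commute)
    then show ?thesis using True by (simp add: pk_def)
  qed
  ultimately show ?thesis by (intro lebesgue_bochner_of_borel) (simp only:)
qed

text \<open>Henstock's lemma takes the place of a differentiation theorem. All integrals over
  subintervals vanish, so the quantity controlled by that lemma is the Riemann sum of
  \<open>norm (f x)\<close> itself, and the gauge integral of the norm is 0.\<close>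

lemma AE_zero_if_indefinite_integral_zero:
  fixes f :: "real \<Rightarrow> 'a::euclidean_space"
  assumes f: "integrable (lebesgue_on {a..c}) f"
    and z: "\<And>t. t \<in> {a..c} \<Longrightarrow> (LINT s|lebesgue_on {a..t}. f s) = 0"
  shows "AE s in lebesgue_on {a..c}. f s = 0"
proof (cases "a \<le> c")
  case False
  then show ?thesis by (intro AE_I'[of "{}"]) (auto simp: null_sets_def space_restrict_space)
next
  case True
  have fi: "f integrable_on {a..c}" using f by (rule integrable_on_lebesgue_on) auto
  have z0: "integral {a..t} f = 0" if "t \<in> {a..c}" for t
  proof -
    have "integrable (lebesgue_on {a..t}) f"
      using integrable_subinterval[of a c f a t] f that by auto
    then show ?thesis using z[OF that] lebesgue_integral_eq_integral[of "{a..t}" f] by simp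
  qed
  have zz: "integral {u..w} f = 0" if "a \<le> u" "u \<le> w" "w \<le> c" for u w
  proof -
    have "integral {a..u} f + integral {u..w} f = integral {a..w} f"
      by (rule Henstock_Kurzweil_Integration.integral_combine)
         (use that fi in \<open>auto intro: integrable_on_subinterval\<close>)
    then show ?thesis using z0 that by auto
  qed
  have "((\<lambda>x. norm (f x)) has_integral 0) (cbox a c)"
  proof (unfold has_integral, intro allI impI)
    fix e :: real assume "e > 0"
    then obtain \<gamma> where \<gamma>: "gauge \<gamma>"
      "\<And>p. p tagged_partial_division_of cbox a c \<Longrightarrow> \<gamma> fine p \<Longrightarrow>
        (\<Sum>(x, k)\<in>p. norm (measure lborel k *\<^sub>R f x - integral k f)) < e"
      using Henstock_lemma[of f a c e] fi unfolding box_real by blast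
    show "\<exists>\<gamma>. gauge \<gamma> \<and> (\<forall>D. D tagged_division_of cbox a c \<and> \<gamma> fine D \<longrightarrow>
          norm ((\<Sum>(x, k)\<in>D. measure lborel k *\<^sub>R norm (f x)) - 0) < e)"
    proof (intro exI[of _ \<gamma>] conjI \<gamma>(1) allI impI)
      fix D assume D: "D tagged_division_of cbox a c \<and> \<gamma> fine D"
      have eq: "norm (measure lborel k *\<^sub>R f x - integral k f) = measure lborel k * norm (f x)" if xk: "(x, k) \<in> D" for x k
      proof -
        have D': "D tagged_division_of cbox a c" using D by blast
        obtain u w where "k = {u..w}" "x \<in> k" "k \<subseteq> {a..c}"
          using tagged_division_ofD(2-4)[OF D' xk] unfolding box_real by blast
        then have "integral k f = 0" by (auto intro!: zz)
        then show ?thesis by simp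
      qed
      have "(\<Sum>(x, k)\<in>D. measure lborel k *\<^sub>R norm (f x)) = (\<Sum>(x, k)\<in>D. norm (measure lborel k *\<^sub>R f x - integral k f))"
        by (intro sum.cong) (auto simp: eq)
      also have "\<dots> < e" using D by (intro \<gamma>(2)) (auto simp: tagged_division_of_def)
      finally have "(\<Sum>(x, k)\<in>D. measure lborel k *\<^sub>R norm (f x)) < e" .
      moreover have "0 \<le> (\<Sum>(x, k)\<in>D. measure lborel k *\<^sub>R norm (f x))" by (intro sum_nonneg) auto
      ultimately show "norm ((\<Sum>(x, k)\<in>D. measure lborel k *\<^sub>R norm (f x)) - 0) < e" by simp
    qed
  qed
  then have "integral {a..c} (\<lambda>x. norm (f x)) = 0" by (simp add: integral_unique cbox_interval)
  then have "(LINT s|lebesgue_on {a..c}. norm (f s)) = 0"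
    using lebesgue_integral_eq_integral[of "{a..c}" "\<lambda>s. norm (f s)"] f by simp
  then show ?thesis
    using integral_nonneg_eq_0_iff_AE[of "lebesgue_on {a..c}" "\<lambda>s. norm (f s)"] f by simp
qed

lemma lebesgue_on_nonneg_has_integral:
  fixes f :: "real \<Rightarrow> real"
  assumes "(f has_integral I) S" "S \<in> sets lebesgue" "\<And>x. x \<in> S \<Longrightarrow> 0 \<le> f x"
  shows "has_bochner_integral (lebesgue_on S) f I"
proof -
  have "f absolutely_integrable_on S"
    using assms by (intro nonnegative_absolutely_integrable_1) auto
  then have "integrable (lebesgue_on S) f"
    using assms(2) by (simp add: integrable_restrict_space set_integrable_def)
  then show ?thesis
    using lebesgue_integral_eq_integral[OF _ assms(2), of f] assms(1)
    by (simp add: has_bochner_integral_iff integral_unique)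
qed

text \<open>Riemann--Liouville integral of order \<open>a\<close>, without the factor \<open>1/\<Gamma>(a)\<close>.\<close>
definition frac_int :: "real \<Rightarrow> (real \<Rightarrow> 'a::euclidean_space) \<Rightarrow> real \<Rightarrow> 'a" where
  "frac_int a v t = (LINT s|lebesgue. pk (a - 1) (t - s) *\<^sub>R v s)"

lemma Beta_pos: "0 < a \<Longrightarrow> 0 < b \<Longrightarrow> 0 < Beta a (b::real)"
  by (simp add: Beta_def Gamma_real_pos)

text \<open>Convolving with \<open>pk 0\<close>, the indicator of the positive half-line, truncates
  at t; hence the case b = 1 of \<open>pk_convolution\<close>, with only the point s = t to be
  repaired.\<close>

lemma pk_integrable:
  assumes "-1 < a" shows "integrable (lebesgue_on {0..t}) (pk a)"
proof -
  have "integrable lebesgue (\<lambda>s. pk 0 (t - s) * pk a (s - 0))"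
    using pk_convolution[of "a+1" 1 t 0] assms by (simp add: has_bochner_integral_iff)
  then have "integrable (lebesgue_on {0..t}) (\<lambda>s. pk 0 (t - s) * pk a s)"
    using integrable_mult_indicator[of "{0..t}" lebesgue "\<lambda>s. pk 0 (t - s) * pk a s"]
    by (simp add: integrable_restrict_space)
  moreover have "AE s in lebesgue_on {0..t}. pk 0 (t - s) * pk a s = pk a s"
  proof (rule AE_I')
    show "{t} \<inter> {0..t} \<in> null_sets (lebesgue_on {0..t})"
      by (subst null_sets_restrict_space) (auto simp: negligible_iff_null_sets[symmetric])
  qed (auto simp: pk_def space_restrict_space split: if_splits)
  moreover have "pk a \<in> borel_measurable (lebesgue_on {0..t})"
    by (intro measurable_restrict_space1 measurable_completion) auto
  ultimately show ?thesis
    by (subst integrable_cong_AE[where g = "\<lambda>s. pk 0 (t - s) * pk a s"]) (auto intro: borel_measurable_integrable)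
qed

lemma pk_integral_eq:
  assumes "-1 < a" "0 \<le> t" shows "(LINT s|lebesgue_on {0..t}. pk a s) = t powr (a+1) / (a+1)"
proof -
  have "(LINT s|lebesgue_on {0..t}. pk a s) = integral {0..t} (pk a)"
    by (intro lebesgue_integral_eq_integral pk_integrable assms) auto
  also have "\<dots> = integral {0..t} (\<lambda>s. s powr a)"
    by (intro integral_spike[of "{0}"]) (auto simp: pk_def)
  also have "\<dots> = t powr (a+1) / (a+1)"
    using has_integral_powr_from_0[of a t] assms by (simp add: integral_unique)
  finally show ?thesis .
qed

text \<open>Fubini and the kernel semigroup law; the Beta factor is present because
  \<open>frac_int\<close> carries no Gamma normalisation. The condition 1 \<le> a + b makes the
  composed kernel bounded on [0,t], so that integrability of \<open>v\<close> alone suffices for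
  Fubini.\<close>

lemma frac_int_convolution:
  fixes v :: "real \<Rightarrow> 'a::euclidean_space"
  assumes a: "0 < a" and b: "0 < b" and ab: "1 \<le> a + b"
    and v: "integrable lebesgue v" and v0: "\<And>s. s < 0 \<Longrightarrow> v s = 0"
  shows "integrable lebesgue (\<lambda>s. pk (b - 1) (t - s) *\<^sub>R frac_int a v s)"
    and "frac_int b (frac_int a v) t = Beta a b *\<^sub>R frac_int (a + b) v t"
proof -
  let ?k = "\<lambda>s r. pk (b - 1) (t - s) * pk (a - 1) (s - r)"
  have km: "(\<lambda>(s, r). ?k s r) \<in> borel_measurable (borel \<Otimes>\<^sub>M borel)" by measurable
  have kI: "(LINT s|lebesgue. ?k s r) = Beta a b * pk (a + b - 1) (t - r)" for r
    using pk_convolution[OF a b] by (rule has_bochner_integral_integral_eq)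
  have int: "integrable lebesgue (\<lambda>r. (LINT s|lebesgue. ?k s r) * norm (v r))"
    unfolding kI
  proof (rule Bochner_Integration.integrable_bound)
    show "integrable lebesgue (\<lambda>r. (Beta a b * max t 0 powr (a + b - 1)) * norm (v r))"
      using v by simp
    have [measurable]: "v \<in> borel_measurable lebesgue" using v by auto
    have "(\<lambda>r. pk (a + b - 1) (t - r)) \<in> borel_measurable lebesgue"
      by (intro measurable_completion) measurable
    then show "(\<lambda>r. Beta a b * pk (a + b - 1) (t - r) * norm (v r)) \<in> borel_measurable lebesgue"
      by measurable
    have "pk (a + b - 1) (t - r) \<le> max t 0 powr (a + b - 1)" if "0 \<le> r" for r
      using ab that by (auto simp: pk_def intro!: powr_mono2)
    then have "pk (a + b - 1) (t - r) * norm (v r) \<le> max t 0 powr (a + b - 1) * norm (v r)" for r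
      by (cases "r < 0") (auto simp: v0 intro: mult_right_mono)
    then show "AE r in lebesgue. norm (Beta a b * pk (a + b - 1) (t - r) * norm (v r))
        \<le> norm (Beta a b * max t 0 powr (a + b - 1) * norm (v r))"
      using Beta_pos[OF a b] by (intro AE_I2) (simp add: abs_mult mult.assoc)
  qed
  have ki: "integrable lebesgue (\<lambda>s. ?k s r)" for r
    using pk_convolution[OF a b] by (simp add: has_bochner_integral_iff)
  note F = kernel_Fubini[OF km _ borel_measurable_integrable[OF v] ki int]
  have eq: "(LINT r|lebesgue. ?k s r *\<^sub>R v r) = pk (b - 1) (t - s) *\<^sub>R frac_int a v s" for s
    unfolding frac_int_def integral_scaleR_right[symmetric] scaleR_scaleR ..
  show "integrable lebesgue (\<lambda>s. pk (b - 1) (t - s) *\<^sub>R frac_int a v s)"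
    using F(1) unfolding eq by simp
  have "frac_int b (frac_int a v) t = (LINT r|lebesgue. (Beta a b * pk (a + b - 1) (t - r)) *\<^sub>R v r)"
    using F(2) unfolding eq kI by (simp add: frac_int_def[of b])
  also have "\<dots> = Beta a b *\<^sub>R frac_int (a + b) v t"
    unfolding frac_int_def integral_scaleR_right[symmetric] scaleR_scaleR ..
  finally show "frac_int b (frac_int a v) t = Beta a b *\<^sub>R frac_int (a + b) v t" .
qed

text \<open>For order 1 the kernel is an indicator; on s \<ge> 0 it differs from that of [0,t] only
  at s = t.\<close>

lemma frac_int_1:
  assumes v0: "\<And>s. s < 0 \<Longrightarrow> v s = 0" and v: "v \<in> borel_measurable lebesgue"
  shows "frac_int 1 v t = (LINT s|lebesgue_on {0..t}. v s)"
proof -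
  have "(\<lambda>s. pk 0 (t - s)) \<in> borel_measurable lebesgue"
    by (intro measurable_completion) measurable
  then have m: "(\<lambda>s. pk 0 (t - s) *\<^sub>R v s) \<in> borel_measurable lebesgue" using v by measurable
  have m': "(\<lambda>s. indicator {0..t} s *\<^sub>R v s) \<in> borel_measurable lebesgue"
    using v by (intro borel_measurable_scaleR borel_measurable_indicator) auto
  have "AE s in lebesgue. pk 0 (t - s) *\<^sub>R v s = indicator {0..t} s *\<^sub>R v s"
  proof (rule AE_I'[of "{t}"])
    show "{t} \<in> null_sets lebesgue" by (simp add: negligible_iff_null_sets[symmetric])
    show "{s \<in> space lebesgue. pk 0 (t - s) *\<^sub>R v s \<noteq> indicator {0..t} s *\<^sub>R v s} \<subseteq> {t}"
    proof
      fix s assume "s \<in> {s \<in> space lebesgue. pk 0 (t - s) *\<^sub>R v s \<noteq> indicator {0..t} s *\<^sub>R v s}"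
      then show "s \<in> {t}" using v0[of s] by (cases "s < 0"; cases "s < t") (auto simp: pk_def indicator_def)
    qed
  qed
  from integral_cong_AE[OF m m' this] show ?thesis
    by (simp add: frac_int_def integral_restrict_space)
qed

lemma c_H_pos: "1/2 < H \<Longrightarrow> H < 1 \<Longrightarrow> 0 < c_H H"
  by (simp add: c_H_def Gamma_real_pos)

text \<open>Integration by parts with r^\<alpha> (r - s)^\<alpha> as the product: the bracket in the
  kernel becomes \<alpha> s^(-\<alpha>) times the integral of r^\<alpha> (r - s)^(\<alpha> - 1) over
  [s,t]. Dropping the subtracted integral, which is non-negative, gives the bound; it provides the
  domination needed for Fubini.\<close>

lemma fbm_kernel_eq:
  assumes H: "1/2 < H" "H < 1" and s: "0 < s"
  defines "\<alpha> \<equiv> H - 1/2"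
  shows "has_bochner_integral lebesgue (\<lambda>r. indicator {0..t} r * pk \<alpha> r * pk (\<alpha> - 1) (r - s))
    (fbm_kernel H t s * s powr \<alpha> / (c_H H * \<alpha>))" (is "has_bochner_integral _ ?k _")
    and "fbm_kernel H t s * s powr \<alpha> / (c_H H * \<alpha>) \<le> t powr (2 * \<alpha>) / \<alpha>"
proof -
  have \<alpha>: "0 < \<alpha>" "\<alpha> < 1/2" using H by (auto simp: \<alpha>_def)
  note c = c_H_pos[OF H]
  have "has_bochner_integral lebesgue ?k (fbm_kernel H t s * s powr \<alpha> / (c_H H * \<alpha>)) \<and>
    fbm_kernel H t s * s powr \<alpha> / (c_H H * \<alpha>) \<le> t powr (2 * \<alpha>) / \<alpha>"
  proof (cases "s < t")
    case False
    then have "?k r = 0" for r by (auto simp: pk_def indicator_def)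
    moreover have "fbm_kernel H t s = 0" using False by (simp add: fbm_kernel_def)
    ultimately show ?thesis using \<alpha>
      by (simp only: mult_zero_left div_0 has_bochner_integral_zero) simp
  next
    case True
    define J where "J = (LINT u|lebesgue_on {s..t}. u powr (\<alpha> - 1) * (u - s) powr \<alpha>)"
    have cont: "continuous_on {s..t} (\<lambda>u. u powr (\<alpha> - 1) * (u - s) powr \<alpha>)"
      using s \<alpha> by (intro continuous_intros continuous_on_powr') auto
    have J: "((\<lambda>u. u powr (\<alpha> - 1) * (u - s) powr \<alpha>) has_integral J) {s..t}"
    proof -
      have "integrable (lebesgue_on {s..t}) (\<lambda>u. u powr (\<alpha> - 1) * (u - s) powr \<alpha>)"
        by (intro continuous_imp_integrable_real cont)
      then show ?thesis unfolding J_def by (rule has_integral_integral_lebesgue_on) simp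
    qed
    have J0: "0 \<le> J" unfolding J_def by (intro integral_nonneg_AE) auto
    \<comment> \<open>The factor (r - s)^(\<alpha> - 1) is unbounded at r = s, so differentiability
      is asked for in the interior only.\<close>
    have "((\<lambda>r. \<alpha> * (r powr (\<alpha> - 1) * (r - s) powr \<alpha>) + \<alpha> * (r powr \<alpha> * (r - s) powr (\<alpha> - 1)))
        has_integral (t powr \<alpha> * (t - s) powr \<alpha> - s powr \<alpha> * (s - s) powr \<alpha>)) {s..t}"
    proof (rule fundamental_theorem_of_calculus_interior)
      show "continuous_on {s..t} (\<lambda>r. r powr \<alpha> * (r - s) powr \<alpha>)"
        using s \<alpha> by (intro continuous_intros continuous_on_powr') auto
      show "((\<lambda>r. r powr \<alpha> * (r - s) powr \<alpha>) has_vector_derivative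
          \<alpha> * (r powr (\<alpha> - 1) * (r - s) powr \<alpha>) + \<alpha> * (r powr \<alpha> * (r - s) powr (\<alpha> - 1))) (at r)"
        if "r \<in> {s<..<t}" for r
        using that s unfolding has_real_derivative_iff_has_vector_derivative[symmetric]
        by (auto intro!: derivative_eq_intros simp: algebra_simps)
    qed (use True in auto)
    from has_integral_diff[OF this has_integral_mult_right[OF J, of \<alpha>]]
    have "((\<lambda>r. \<alpha> * (r powr \<alpha> * (r - s) powr (\<alpha> - 1))) has_integral
        (t powr \<alpha> * (t - s) powr \<alpha> - \<alpha> * J)) {s..t}" by simp
    from has_integral_mult_right[OF this, of "1 / \<alpha>"]
    have "((\<lambda>r. r powr \<alpha> * (r - s) powr (\<alpha> - 1)) has_integral
        (t powr \<alpha> * (t - s) powr \<alpha> - \<alpha> * J) / \<alpha>) {s..t}" using \<alpha> by simp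
    then have "has_bochner_integral (lebesgue_on {s..t}) (\<lambda>r. r powr \<alpha> * (r - s) powr (\<alpha> - 1))
       ((t powr \<alpha> * (t - s) powr \<alpha> - \<alpha> * J) / \<alpha>)"
      by (rule lebesgue_on_nonneg_has_integral) auto
    then have hb: "has_bochner_integral lebesgue (\<lambda>r. indicator {s..t} r *\<^sub>R (r powr \<alpha> * (r - s) powr (\<alpha> - 1)))
       ((t powr \<alpha> * (t - s) powr \<alpha> - \<alpha> * J) / \<alpha>)"
      by (simp add: has_bochner_integral_restrict_space)
    have "indicator {s..t} r *\<^sub>R (r powr \<alpha> * (r - s) powr (\<alpha> - 1)) = ?k r" for r
      using s by (auto simp: indicator_def pk_def)
    moreover have eq: "(t powr \<alpha> * (t - s) powr \<alpha> - \<alpha> * J) / \<alpha> = fbm_kernel H t s * s powr \<alpha> / (c_H H * \<alpha>)"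
    proof -
      have e: "H - 1/2 = \<alpha>" "1/2 - H = - \<alpha>" "H - 3/2 = \<alpha> - 1" by (auto simp: \<alpha>_def)
      have "fbm_kernel H t s = c_H H * ((t / s) powr \<alpha> * (t - s) powr \<alpha> - \<alpha> * s powr (- \<alpha>) * J)"
        using s True by (simp add: fbm_kernel_def e J_def)
      then have "fbm_kernel H t s * s powr \<alpha> = c_H H * (t powr \<alpha> * (t - s) powr \<alpha> - \<alpha> * J)"
        using s True by (simp add: powr_divide powr_minus field_simps)
      then show ?thesis using c \<alpha> by simp
    qed
    ultimately have 1: "has_bochner_integral lebesgue ?k (fbm_kernel H t s * s powr \<alpha> / (c_H H * \<alpha>))"
      using hb by simp
    have "t powr \<alpha> * (t - s) powr \<alpha> \<le> t powr \<alpha> * t powr \<alpha>"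
      using s True \<alpha> by (intro mult_left_mono powr_mono2) auto
    then have "t powr \<alpha> * (t - s) powr \<alpha> - \<alpha> * J \<le> t powr (2 * \<alpha>)"
      using J0 \<alpha> by (simp flip: powr_add) (smt (verit) mult_nonneg_nonneg)
    then have "fbm_kernel H t s * s powr \<alpha> / (c_H H * \<alpha>) \<le> t powr (2 * \<alpha>) / \<alpha>"
      unfolding eq[symmetric] using \<alpha> by (simp add: divide_right_mono)
    with 1 show ?thesis by blast
  qed
  then show "has_bochner_integral lebesgue ?k (fbm_kernel H t s * s powr \<alpha> / (c_H H * \<alpha>))"
    "fbm_kernel H t s * s powr \<alpha> / (c_H H * \<alpha>) \<le> t powr (2 * \<alpha>) / \<alpha>" by blast+
qed

text \<open>The weight \<open>s\<^sup>-\<^sup>\<alpha>\<close> is square integrable near 0 since \<open>\<alpha> < 1/2\<close>.\<close>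
definition weighted :: "real \<Rightarrow> real \<Rightarrow> (real \<Rightarrow> 'a::euclidean_space) \<Rightarrow> real \<Rightarrow> 'a" where
  "weighted \<alpha> L u s = (indicator {0..L} s * pk (- \<alpha>) s) *\<^sub>R u s"

lemma weighted_integrable:
  fixes u :: "real \<Rightarrow> real^'n"
  assumes \<alpha>: "0 < \<alpha>" "\<alpha> < 1/2" and u: "u \<in> L2 L"
  shows "integrable lebesgue (weighted \<alpha> L u)"
proof -
  have "integrable (lebesgue_on {0..L}) (\<lambda>s. pk (-\<alpha>) s *\<^sub>R u s)"
  proof (rule Bochner_Integration.integrable_bound)
    show "integrable (lebesgue_on {0..L}) (\<lambda>s. pk (-2*\<alpha>) s + (norm (u s))\<^sup>2)"
      using u \<alpha> by (intro Bochner_Integration.integrable_add pk_integrable) (auto simp: L2_def)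
    have "pk (-\<alpha>) \<in> borel_measurable (lebesgue_on {0..L})"
      by (intro measurable_restrict_space1 measurable_completion) auto
    then show "(\<lambda>s. pk (-\<alpha>) s *\<^sub>R u s) \<in> borel_measurable (lebesgue_on {0..L})"
      using u by (auto simp: L2_def)
    have "norm (pk (-\<alpha>) s *\<^sub>R u s) \<le> norm (pk (-2*\<alpha>) s + (norm (u s))\<^sup>2)" for s
    proof -
      have "pk (-2*\<alpha>) s = (pk (-\<alpha>) s)\<^sup>2"
        by (auto simp: pk_def power2_eq_square simp flip: powr_add)
      moreover have "x * y \<le> x\<^sup>2 + y\<^sup>2" if "0 \<le> x" "0 \<le> y" for x y :: real
        using sum_squares_bound[of x y] mult_nonneg_nonneg[OF that] by simp
      from this[of "pk (-\<alpha>) s" "norm (u s)"]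
      have "pk (-\<alpha>) s * norm (u s) \<le> (pk (-\<alpha>) s)\<^sup>2 + (norm (u s))\<^sup>2" by simp
      ultimately show ?thesis by simp
    qed
    then show "AE s in lebesgue_on {0..L}. norm (pk (-\<alpha>) s *\<^sub>R u s) \<le> norm (pk (-2*\<alpha>) s + (norm (u s))\<^sup>2)"
      by simp
  qed
  then show ?thesis
    by (simp add: integrable_restrict_space weighted_def[abs_def])
qed

text \<open>The factor \<open>H - 1/2\<close> is the one produced by the integration by parts in
  \<open>fbm_kernel_eq\<close>. Truncation at \<open>L\<close> makes the weighted control integrable
  on the whole line and is invisible for r \<le> L, as the kernel only sees s < r.\<close>

definition K_density :: "real \<Rightarrow> real \<Rightarrow> (real \<Rightarrow> 'a::euclidean_space) \<Rightarrow> real \<Rightarrow> 'a" where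
  "K_density H L u r = (c_H H * (H - 1/2) * pk (H - 1/2) r) *\<^sub>R frac_int (H - 1/2) (weighted (H - 1/2) L u) r"

text \<open>Inserting the integral formula for the kernel and exchanging the integrations moves all
  dependence on t into the upper limit of the outer integral. This exhibits K_H u as absolutely
  continuous, so that the Young integral against it can become a Lebesgue integral.\<close>

lemma K_op_eq_integral:
  fixes u :: "real \<Rightarrow> real^'n"
  assumes H: "1/2 < H" "H < 1" and u: "u \<in> L2 L" and t: "t \<in> {0..L}"
  shows "integrable (lebesgue_on {0..t}) (K_density H L u)"
    and "K_op H u t = (LINT r|lebesgue_on {0..t}. K_density H L u r)"
proof -
  define \<alpha> where "\<alpha> = H - 1/2"
  have \<alpha>: "0 < \<alpha>" "\<alpha> < 1/2" using H by (auto simp: \<alpha>_def)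
  note c = c_H_pos[OF H]
  note fk = fbm_kernel_eq[OF H, folded \<alpha>_def]
  let ?w = "weighted \<alpha> L u"
  let ?k = "\<lambda>r s. indicator {0..t} r * pk \<alpha> r * pk (\<alpha> - 1) (r - s)"
  have wi: "integrable lebesgue ?w" by (rule weighted_integrable[OF \<alpha> u])
  have w0: "?w s \<noteq> 0 \<Longrightarrow> 0 < s \<and> s \<le> L" for s by (auto simp: weighted_def pk_def indicator_def split: if_splits)
  have km: "(\<lambda>(r, s). ?k r s) \<in> borel_measurable (borel \<Otimes>\<^sub>M borel)" by measurable
  have ki: "integrable lebesgue (\<lambda>r. ?k r s)" if "?w s \<noteq> 0" for s
    using fk(1)[of s t] w0[OF that] by (simp add: has_bochner_integral_iff)
  have kI: "(LINT r|lebesgue. ?k r s) = fbm_kernel H t s * s powr \<alpha> / (c_H H * \<alpha>)" if "0 < s" for s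
    using fk(1)[OF that, of t] by (simp add: has_bochner_integral_iff)
  have int: "integrable lebesgue (\<lambda>s. (LINT r|lebesgue. ?k r s) * norm (?w s))"
  proof (rule Bochner_Integration.integrable_bound)
    show "integrable lebesgue (\<lambda>s. t powr (2*\<alpha>) / \<alpha> * norm (?w s))" using wi by simp
    have "(\<lambda>s. LINT r|lebesgue. ?k r s) \<in> borel_measurable lebesgue"
      using borel_pair_measurable_lebesgue(2)[OF km]
      by (intro lebesgue.borel_measurable_lebesgue_integral) (simp add: split_beta')
    then show "(\<lambda>s. (LINT r|lebesgue. ?k r s) * norm (?w s)) \<in> borel_measurable lebesgue"
      using wi by measurable
    have "norm ((LINT r|lebesgue. ?k r s) * norm (?w s)) \<le> norm (t powr (2*\<alpha>) / \<alpha> * norm (?w s))" for s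
    proof (cases "?w s = 0")
      case False
      then have s: "0 < s" using w0 by auto
      have "0 \<le> (LINT r|lebesgue. ?k r s)" by (intro integral_nonneg_AE) auto
      moreover have "(LINT r|lebesgue. ?k r s) \<le> t powr (2*\<alpha>) / \<alpha>" unfolding kI[OF s] by (rule fk(2)[OF s])
      ultimately have "\<bar>LINT r|lebesgue. ?k r s\<bar> \<le> \<bar>t powr (2*\<alpha>) / \<alpha>\<bar>" by linarith
      from mult_right_mono[OF this norm_ge_zero[of "?w s"]] show ?thesis
        by (simp only: real_norm_def abs_mult abs_norm_cancel)
    qed simp
    then show "AE s in lebesgue. norm ((LINT r|lebesgue. ?k r s) * norm (?w s)) \<le> norm (t powr (2*\<alpha>) / \<alpha> * norm (?w s))"
      by simp
  qed
  note F = kernel_Fubini[OF km _ borel_measurable_integrable[OF wi] ki int]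
  have eq: "(LINT s|lebesgue. ?k r s *\<^sub>R ?w s) = (indicator {0..t} r * pk \<alpha> r) *\<^sub>R frac_int \<alpha> ?w r" for r
    unfolding frac_int_def integral_scaleR_right[symmetric] scaleR_scaleR ..
  have i1: "integrable lebesgue (\<lambda>r. (indicator {0..t} r * pk \<alpha> r) *\<^sub>R frac_int \<alpha> ?w r)"
    using F(1) unfolding eq by simp
  have D: "(c_H H * \<alpha>) *\<^sub>R (indicator {0..t} r * pk \<alpha> r) *\<^sub>R frac_int \<alpha> ?w r = indicator {0..t} r *\<^sub>R K_density H L u r" for r
    by (simp add: K_density_def \<alpha>_def[symmetric] mult_ac)
  show "integrable (lebesgue_on {0..t}) (K_density H L u)"
    using integrable_scaleR_right[OF i1, of "c_H H * \<alpha>"] unfolding D by (simp add: integrable_restrict_space)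
  have "(LINT r|lebesgue_on {0..t}. K_density H L u r) =
      (c_H H * \<alpha>) *\<^sub>R (LINT r|lebesgue. (indicator {0..t} r * pk \<alpha> r) *\<^sub>R frac_int \<alpha> ?w r)"
    unfolding integral_scaleR_right[symmetric] D by (simp add: integral_restrict_space)
  also have "\<dots> = (c_H H * \<alpha>) *\<^sub>R (LINT s|lebesgue. (LINT r|lebesgue. ?k r s) *\<^sub>R ?w s)"
    using F(2) unfolding eq by simp
  also have "\<dots> = (LINT s|lebesgue. (c_H H * \<alpha>) *\<^sub>R (LINT r|lebesgue. ?k r s) *\<^sub>R ?w s)"
    by (rule integral_scaleR_right[symmetric])
  also have "\<dots> = (LINT s|lebesgue. indicator {0..t} s *\<^sub>R (fbm_kernel H t s *\<^sub>R u s))"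
  proof (rule Bochner_Integration.integral_cong[OF refl])
    fix s show "(c_H H * \<alpha>) *\<^sub>R (LINT r|lebesgue. ?k r s) *\<^sub>R ?w s = indicator {0..t} s *\<^sub>R (fbm_kernel H t s *\<^sub>R u s)"
    proof (cases "0 < s \<and> s \<le> L")
      case True
      have w: "?w s = s powr (-\<alpha>) *\<^sub>R u s" using True by (simp add: weighted_def pk_def)
      have s: "0 < s" using True by simp
      have "(c_H H * \<alpha>) *\<^sub>R (LINT r|lebesgue. ?k r s) *\<^sub>R ?w s =
         (c_H H * \<alpha> * (fbm_kernel H t s * s powr \<alpha> / (c_H H * \<alpha>)) * s powr (-\<alpha>)) *\<^sub>R u s"
        unfolding w kI[OF s] by (simp only: scaleR_scaleR mult.assoc)
      also have "\<dots> = fbm_kernel H t s *\<^sub>R u s"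
      proof -
        have "s powr \<alpha> * s powr (-\<alpha>) = 1" using True by (simp flip: powr_add)
        then have "c_H H * \<alpha> * (fbm_kernel H t s * s powr \<alpha> / (c_H H * \<alpha>)) * s powr (-\<alpha>) = fbm_kernel H t s"
          using c \<alpha> by simp
        then show ?thesis by (simp only:)
      qed
      also have "\<dots> = indicator {0..t} s *\<^sub>R (fbm_kernel H t s *\<^sub>R u s)"
        using True by (auto simp: indicator_def fbm_kernel_def)
      finally show ?thesis .
    next
      \<comment> \<open>Outside (0,L] the weight is 0; the right side is too, by the kernel for s
        \<le> 0 and by the indicator for s > L \<ge> t.\<close>
      case False
      then show ?thesis using w0[of s] t by (auto simp: fbm_kernel_def indicator_def)
    qed
  qed
  also have "\<dots> = K_op H u t" by (simp add: K_op_def integral_restrict_space)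
  finally show "K_op H u t = (LINT r|lebesgue_on {0..t}. K_density H L u r)" by simp
qed

section \<open>The Cameron--Martin space\<close>

lemma bilinear_matrix_vector_mult: "bilinear ((*v) :: real^'n^'m \<Rightarrow> real^'n \<Rightarrow> real^'m)"
  unfolding bilinear_def
  by (intro conjI allI linearI)
     (auto simp: matrix_vector_mult_add_rdistrib matrix_vector_right_distrib scaleR_matrix_vector_assoc
       matrix_vector_mult_scaleR)

lemma integrable_lebesgue_on_iff:
  "S \<in> sets lebesgue \<Longrightarrow> integrable (lebesgue_on S) f \<longleftrightarrow> f absolutely_integrable_on S"
  by (simp add: integrable_restrict_space set_integrable_def)

lemma integrable_matrix_vector_mult:
  fixes \<sigma> :: "real \<Rightarrow> real^'n^'n" and \<rho> :: "real \<Rightarrow> real^'n"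
  assumes \<sigma>: "continuous_on {a..c} \<sigma>" and \<rho>: "integrable (lebesgue_on {a..c}) \<rho>"
  shows "integrable (lebesgue_on {a..c}) (\<lambda>s. \<sigma> s *v \<rho> s)"
proof -
  have "(\<lambda>s. \<sigma> s *v \<rho> s) absolutely_integrable_on {a..c}"
  proof (rule absolutely_integrable_bounded_measurable_product[OF bilinear_matrix_vector_mult])
    show "\<sigma> \<in> borel_measurable (lebesgue_on {a..c})"
      by (intro continuous_imp_measurable_on_sets_lebesgue \<sigma>) auto
    show "bounded (\<sigma> ` {a..c})"
      by (intro compact_imp_bounded compact_continuous_image \<sigma>) auto
    show "\<rho> absolutely_integrable_on {a..c}" using \<rho> by (simp add: integrable_lebesgue_on_iff)
  qed auto
  then show ?thesis by (simp add: integrable_lebesgue_on_iff)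
qed

section \<open>Young integrals against absolutely continuous paths\<close>

text \<open>\<open>young_integral\<close> is a definite description, so uniqueness precedes any
  evaluation. Both limits are compared on one tagged division fine enough for each.\<close>

lemma has_young_integral_unique:
  assumes "has_young_integral \<sigma> g a c I" "has_young_integral \<sigma> g a c J"
  shows "I = J"
proof (rule ccontr)
  assume "I \<noteq> J"
  define e where "e = norm (I - J) / 2"
  have e: "e > 0" using \<open>I \<noteq> J\<close> by (simp add: e_def)
  define S where "S = (\<lambda>p. \<Sum>(x, k)\<in>p. \<sigma> x *v (g (Sup k) - g (Inf k)))"
  obtain d1 where d1: "d1 > 0" "\<forall>p. p tagged_division_of {a..c} \<and> (\<forall>(x, k)\<in>p. Sup k - Inf k < d1) \<longrightarrow> norm (S p - I) < e"
    using assms(1)[unfolded has_young_integral_def, rule_format, OF e] unfolding S_def by blast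
  obtain d2 where d2: "d2 > 0" "\<forall>p. p tagged_division_of {a..c} \<and> (\<forall>(x, k)\<in>p. Sup k - Inf k < d2) \<longrightarrow> norm (S p - J) < e"
    using assms(2)[unfolded has_young_integral_def, rule_format, OF e] unfolding S_def by blast
  define d where "d = min d1 d2"
  have d: "d > 0" using d1 d2 by (simp add: d_def)
  \<comment> \<open>An interval contained in a ball of radius d/2 has length below d, so fineness
    for this gauge enforces the mesh condition.\<close>
  obtain p where p: "p tagged_division_of {a..c}" "(\<lambda>x. ball x (d / 2)) fine p"
    using fine_division_exists_real[OF gauge_ball[of "d/2"]] d by auto
  have small: "Sup k - Inf k < d" if xk: "(x, k) \<in> p" for x k
  proof -
    obtain u w where k: "k = {u..w}" "x \<in> k"
      using tagged_division_ofD(2,4)[OF p(1) xk] unfolding box_real by blast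
    then have "u \<le> w" by auto
    have "k \<subseteq> ball x (d/2)" using p(2) xk by (auto simp: fine_def)
    moreover have "u \<in> k" "w \<in> k" using k \<open>u \<le> w\<close> by simp_all
    ultimately have "u \<in> ball x (d/2)" "w \<in> ball x (d/2)" by blast+
    then have "w - u < d" unfolding mem_ball dist_real_def by linarith
    then show ?thesis using k \<open>u \<le> w\<close> by simp
  qed
  have "\<forall>(x, k)\<in>p. Sup k - Inf k < d1" "\<forall>(x, k)\<in>p. Sup k - Inf k < d2"
    using small unfolding d_def by fastforce+
  then have "norm (S p - I) < e" "norm (S p - J) < e"
    using d1(2) d2(2) p(1) by blast+
  then have "norm (I - J) < e + e"
    using norm_triangle_ineq4[of "S p - J" "S p - I"] by simp
  then show False by (simp add: e_def)
qed

text \<open>On an interval k with tag x the Riemann term differs from the integral of \<sigma>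
  \<rho> over k by the integral of (\<sigma>(x) - \<sigma>(s)) \<rho>(s). Uniform continuity of
  \<sigma> makes this at most a small multiple of the integral of |\<rho>| over k, and these bounds
  add up over the division.\<close>

lemma has_young_integral_density:
  fixes \<sigma> :: "real \<Rightarrow> real^'n^'n" and \<rho> :: "real \<Rightarrow> real^'n"
  assumes \<sigma>: "continuous_on {0..t} \<sigma>" and \<rho>: "integrable (lebesgue_on {0..t}) \<rho>"
    and g: "\<And>s. s \<in> {0..t} \<Longrightarrow> g s = (LINT r|lebesgue_on {0..s}. \<rho> r)"
  shows "has_young_integral \<sigma> g 0 t (LINT s|lebesgue_on {0..t}. \<sigma> s *v \<rho> s)"
  unfolding has_young_integral_def
proof (intro allI impI)
  fix e :: real assume e: "e > 0"
  obtain K where K: "K > 0" "\<And>A w. norm ((A :: real^'n^'n) *v w) \<le> K * norm A * norm w"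
    using bilinear_bounded_pos[OF bilinear_matrix_vector_mult] by blast
  \<comment> \<open>Adding 1 keeps \<open>B\<close> positive when \<rho> = 0 and makes the final
    comparison strict.\<close>
  define B where "B = integral {0..t} (\<lambda>s. norm (\<rho> s)) + 1"
  have \<rho>i: "\<rho> integrable_on {0..t}" "(\<lambda>s. norm (\<rho> s)) integrable_on {0..t}"
    using integrable_on_lebesgue_on[OF \<rho>] integrable_on_lebesgue_on[OF integrable_norm[OF \<rho>]] by auto
  have B: "B > 0" using integral_nonneg[OF \<rho>i(2)] by (simp add: B_def)
  have \<sigma>\<rho>: "(\<lambda>s. \<sigma> s *v \<rho> s) integrable_on {0..t}"
    using integrable_on_lebesgue_on[OF integrable_matrix_vector_mult[OF \<sigma> \<rho>]] by auto
  define \<eta> where "\<eta> = e / (K * B)"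
  have \<eta>: "\<eta> > 0" using e K B by (simp add: \<eta>_def)
  obtain d where d: "d > 0" "\<And>x s. x \<in> {0..t} \<Longrightarrow> s \<in> {0..t} \<Longrightarrow> dist s x < d \<Longrightarrow> dist (\<sigma> s) (\<sigma> x) < \<eta>"
    using compact_uniformly_continuous[OF \<sigma>] \<eta> unfolding uniformly_continuous_on_def by (metis compact_Icc)
  have "norm ((\<Sum>(x, k)\<in>p. \<sigma> x *v (g (Sup k) - g (Inf k))) - (LINT s|lebesgue_on {0..t}. \<sigma> s *v \<rho> s)) < e"
    if p: "p tagged_division_of {0..t}" and fine: "\<forall>(x, k)\<in>p. Sup k - Inf k < d" for p
  proof -
    let ?h = "\<lambda>x s. \<sigma> x *v \<rho> s - \<sigma> s *v \<rho> s"
    have pc: "p tagged_division_of cbox 0 t" using p by simp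
    have key: "\<sigma> x *v (g (Sup k) - g (Inf k)) - integral k (\<lambda>s. \<sigma> s *v \<rho> s) = integral k (?h x)
      \<and> norm (integral k (?h x)) \<le> K * \<eta> * integral k (\<lambda>s. norm (\<rho> s))" if xk: "(x, k) \<in> p" for x k
    proof -
      obtain u w where k: "k = {u..w}" "x \<in> k" "k \<subseteq> {0..t}"
        using tagged_division_ofD(2-4)[OF p xk] unfolding box_real by blast
      then have uw: "u \<le> w" "0 \<le> u" "w \<le> t" by auto
      have ki: "f integrable_on k" if "f integrable_on {0..t}" for f :: "real \<Rightarrow> 'b::banach"
        using that k by (auto intro: integrable_on_subinterval)
      have gs: "g s = integral {0..s} \<rho>" if "s \<in> {0..t}" for s
        using g[OF that] lebesgue_integral_eq_integral[of "{0..s}" \<rho>]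
          integrable_subinterval[OF \<rho>, of 0 s] that by auto
      have "integral {0..u} \<rho> + integral {u..w} \<rho> = integral {0..w} \<rho>"
        by (rule Henstock_Kurzweil_Integration.integral_combine)
           (use uw \<rho>i in \<open>auto intro: integrable_on_subinterval\<close>)
      then have "g (Sup k) - g (Inf k) = integral k \<rho>"
        using gs[of u] gs[of w] uw k by (simp add: algebra_simps)
      then have "\<sigma> x *v (g (Sup k) - g (Inf k)) = integral k (\<lambda>s. \<sigma> x *v \<rho> s)"
        using integral_linear[OF ki[OF \<rho>i(1)] matrix_vector_mul_bounded_linear[of "\<sigma> x"]] by (simp add: o_def)
      moreover have i1: "(\<lambda>s. \<sigma> x *v \<rho> s) integrable_on k"
        using integrable_linear[OF ki[OF \<rho>i(1)] matrix_vector_mul_bounded_linear[of "\<sigma> x"]] by (simp add: o_def)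
      ultimately have 1: "\<sigma> x *v (g (Sup k) - g (Inf k)) - integral k (\<lambda>s. \<sigma> s *v \<rho> s) = integral k (?h x)"
        using ki[OF \<sigma>\<rho>] by (simp add: Henstock_Kurzweil_Integration.integral_diff)
      have "norm (integral k (?h x)) \<le> integral k (\<lambda>s. K * \<eta> * norm (\<rho> s))"
      proof (rule Henstock_Kurzweil_Integration.integral_norm_bound_integral)
        show "?h x integrable_on k" using i1 ki[OF \<sigma>\<rho>] by (rule integrable_diff)
        show "(\<lambda>s. K * \<eta> * norm (\<rho> s)) integrable_on k"
          using integrable_cmul[OF ki[OF \<rho>i(2)], of "K * \<eta>"] by simp
        fix s assume s: "s \<in> k"
        have "w - u < d" using fine xk k uw by auto
        then have "dist s x < d" using s k by (auto simp: dist_real_def)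
        then have "dist (\<sigma> s) (\<sigma> x) < \<eta>" using d(2)[of x s] s k by auto
        then have *: "norm (\<sigma> x - \<sigma> s) \<le> \<eta>" by (simp add: dist_norm norm_minus_commute)
        have "norm (?h x s) = norm ((\<sigma> x - \<sigma> s) *v \<rho> s)" by (simp add: matrix_vector_mult_diff_rdistrib)
        also have "\<dots> \<le> K * norm (\<sigma> x - \<sigma> s) * norm (\<rho> s)" by (rule K)
        also have "\<dots> \<le> K * \<eta> * norm (\<rho> s)" using * K by (intro mult_right_mono mult_left_mono) auto
        finally show "norm (?h x s) \<le> K * \<eta> * norm (\<rho> s)" .
      qed
      then show ?thesis using 1 by simp
    qed
    have tI: "integral {0..t} f = (\<Sum>(x, k)\<in>p. integral k f)" if "f integrable_on {0..t}" for f :: "real \<Rightarrow> 'b::banach"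
      using integral_combine_tagged_division_topdown[of f 0 t p] that pc by simp
    have "(\<Sum>(x, k)\<in>p. \<sigma> x *v (g (Sup k) - g (Inf k))) - (LINT s|lebesgue_on {0..t}. \<sigma> s *v \<rho> s)
      = (\<Sum>(x, k)\<in>p. \<sigma> x *v (g (Sup k) - g (Inf k)) - integral k (\<lambda>s. \<sigma> s *v \<rho> s))"
      using tI[OF \<sigma>\<rho>] lebesgue_integral_eq_integral[OF integrable_matrix_vector_mult[OF \<sigma> \<rho>]]
      by (simp add: sum_subtractf split_beta')
    also have "\<dots> = (\<Sum>(x, k)\<in>p. integral k (?h x))"
      by (intro sum.cong refl) (use key in auto)
    also have "norm \<dots> \<le> (\<Sum>(x, k)\<in>p. K * \<eta> * integral k (\<lambda>s. norm (\<rho> s)))"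
      by (rule order_trans[OF norm_sum], rule sum_mono) (use key in auto)
    also have "\<dots> = K * \<eta> * integral {0..t} (\<lambda>s. norm (\<rho> s))"
      unfolding tI[OF \<rho>i(2)] by (simp add: sum_distrib_left split_beta')
    also have "\<dots> < K * \<eta> * B" using K \<eta> by (simp add: B_def)
    also have "\<dots> = e" using K B by (simp add: \<eta>_def)
    finally show ?thesis .
  qed
  then show "\<exists>d>0. \<forall>p. p tagged_division_of {0..t} \<and> (\<forall>(x, k)\<in>p. Sup k - Inf k < d) \<longrightarrow>
        norm ((\<Sum>(x, k)\<in>p. \<sigma> x *v (g (Sup k) - g (Inf k))) - (LINT s|lebesgue_on {0..t}. \<sigma> s *v \<rho> s)) < e"
    using d(1) by blast
qed

lemma K_sigma_eq_integral:
  fixes u :: "real \<Rightarrow> real^'n"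
  assumes H: "1/2 < H" "H < 1" and \<sigma>: "continuous_on {0..L} \<sigma>" and u: "u \<in> L2 L" and t: "t \<in> {0..L}"
  shows "K_sigma H \<sigma> u t = (LINT r|lebesgue_on {0..t}. \<sigma> r *v K_density H L u r)"
proof -
  have "has_young_integral \<sigma> (K_op H u) 0 t (LINT r|lebesgue_on {0..t}. \<sigma> r *v K_density H L u r)"
  proof (rule has_young_integral_density)
    show "continuous_on {0..t} \<sigma>" using \<sigma> t by (auto intro: continuous_on_subset)
    show "integrable (lebesgue_on {0..t}) (K_density H L u)" by (rule K_op_eq_integral[OF H u t])
    show "K_op H u s = (LINT r|lebesgue_on {0..s}. K_density H L u r)" if "s \<in> {0..t}" for s
      using that t by (intro K_op_eq_integral[OF H u]) auto
  qed
  then show ?thesis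
    unfolding K_sigma_def young_integral_def by (blast intro: the_equality has_young_integral_unique)
qed

section \<open>Injectivity of \<open>K_sigma\<close> up to null sets\<close>

text \<open>Abel inversion: the integral of order 1 - \<alpha> turns I^\<alpha> into ordinary
  integration up to a Beta factor. Equal indefinite integrals give equal weighted functions almost
  everywhere, and the weight is non-zero on (0,L].\<close>

lemma frac_int_weighted_cong:
  fixes u1 u2 :: "real \<Rightarrow> real^'n"
  assumes \<alpha>: "0 < \<alpha>" "\<alpha> < 1/2" and u: "u1 \<in> L2 L" "u2 \<in> L2 L"
    and eq: "AE r in lebesgue_on {0..L}. frac_int \<alpha> (weighted \<alpha> L u1) r = frac_int \<alpha> (weighted \<alpha> L u2) r"
  shows "AE s in lebesgue_on {0..L}. u1 s = u2 s"
proof -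
  let ?w = "\<lambda>u. weighted \<alpha> L u"
  have w0: "s \<le> 0 \<Longrightarrow> ?w u s = 0" for s and u :: "real \<Rightarrow> real^'n" by (simp add: weighted_def pk_def)
  note wi = weighted_integrable[OF \<alpha>]
  have conv: "integrable lebesgue (\<lambda>s. pk (1 - \<alpha> - 1) (t - s) *\<^sub>R frac_int \<alpha> (?w u) s)"
    "frac_int (1 - \<alpha>) (frac_int \<alpha> (?w u)) t = Beta \<alpha> (1 - \<alpha>) *\<^sub>R (LINT s|lebesgue_on {0..t}. ?w u s)"
    if "u \<in> L2 L" for t and u :: "real \<Rightarrow> real^'n"
    using frac_int_convolution[OF _ _ _ wi[OF that], of \<alpha> "1 - \<alpha>" t] \<alpha> w0
      frac_int_1[of "?w u" t] borel_measurable_integrable[OF wi[OF that]] by auto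
  have f0: "frac_int \<alpha> (?w u) s = 0" if "s \<le> 0" for s and u :: "real \<Rightarrow> real^'n"
  proof -
    have "(\<lambda>r. pk (\<alpha> - 1) (s - r) *\<^sub>R ?w u r) = (\<lambda>r. 0)"
    proof
      show "pk (\<alpha> - 1) (s - r) *\<^sub>R ?w u r = 0" for r
        using that w0[of r u] by (cases "r \<le> 0") (auto simp: pk_def)
    qed
    then show ?thesis by (simp only: frac_int_def integral_zero)
  qed
  have wB: "Beta \<alpha> (1 - \<alpha>) \<noteq> 0" using Beta_pos[of \<alpha> "1 - \<alpha>"] \<alpha> by auto
  have I: "(LINT s|lebesgue_on {0..t}. ?w u1 s) = (LINT s|lebesgue_on {0..t}. ?w u2 s)" if t: "t \<in> {0..L}" for t
  proof -
    have "AE s in lebesgue. s \<in> {0..L} \<longrightarrow> frac_int \<alpha> (?w u1) s = frac_int \<alpha> (?w u2) s"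
      using eq by (subst (asm) AE_restrict_space_iff) auto
    then have "AE s in lebesgue. pk (1 - \<alpha> - 1) (t - s) *\<^sub>R frac_int \<alpha> (?w u1) s = pk (1 - \<alpha> - 1) (t - s) *\<^sub>R frac_int \<alpha> (?w u2) s"
    proof eventually_elim
      case (elim s)
      then show ?case using f0[of s] t by (cases "s \<le> 0"; cases "s < t") (auto simp: pk_def)
    qed
    then have "frac_int (1 - \<alpha>) (frac_int \<alpha> (?w u1)) t = frac_int (1 - \<alpha>) (frac_int \<alpha> (?w u2)) t"
      unfolding frac_int_def[of "1 - \<alpha>"]
      by (intro integral_cong_AE borel_measurable_integrable conv(1) u)
    then show ?thesis unfolding conv(2)[OF u(1)] conv(2)[OF u(2)] using wB by simp
  qed
  have wiL: "integrable (lebesgue_on {0..t}) (?w u)" if "u \<in> L2 L" for t and u :: "real \<Rightarrow> real^'n"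
    using integrable_mult_indicator[OF _ wi[OF that], of "{0..t}"] by (simp add: integrable_restrict_space)
  have "AE s in lebesgue_on {0..L}. ?w u1 s - ?w u2 s = 0"
  proof (rule AE_zero_if_indefinite_integral_zero)
    show "integrable (lebesgue_on {0..L}) (\<lambda>s. ?w u1 s - ?w u2 s)"
      using wiL u by simp
    show "(LINT s|lebesgue_on {0..t}. ?w u1 s - ?w u2 s) = 0" if "t \<in> {0..L}" for t
      using wiL u I[OF that] by simp
  qed
  \<comment> \<open>\<open>pk (-\<alpha>)\<close> is 0 at the origin by convention, so the weight
    cannot be cancelled there.\<close>
  moreover have "AE s in lebesgue_on {0..L}. s \<noteq> 0"
    by (rule AE_I'[of "{0} \<inter> {0..L}"])
       (auto simp: null_sets_restrict_space space_restrict_space negligible_iff_null_sets[symmetric] intro: negligible_subset[of "{0}"])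
  moreover have "AE s in lebesgue_on {0..L}. s \<in> {0..L}"
    by (rule AE_I2) (simp add: space_restrict_space)
  ultimately show ?thesis
    by eventually_elim (auto simp: weighted_def pk_def)
qed

text \<open>Equal images have densities equal almost everywhere; invertibility of \<sigma> and
  positivity of r^\<alpha> for r > 0 strip these down to the fractional integrals. Its use is to
  replace the unspecified preimage in \<open>K_sigma_inv\<close> by an explicit one.\<close>

lemma K_sigma_injective:
  fixes u1 u2 :: "real \<Rightarrow> real^'n"
  assumes H: "1/2 < H" "H < 1" and \<sigma>: "continuous_on {0..L} \<sigma>"
    and inv: "\<And>s w. s \<in> {0..L} \<Longrightarrow> \<sigma> s *v w = 0 \<Longrightarrow> w = 0"
    and u: "u1 \<in> L2 L" "u2 \<in> L2 L"
    and eq: "\<And>t. t \<in> {0..L} \<Longrightarrow> K_sigma H \<sigma> u1 t = K_sigma H \<sigma> u2 t"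
  shows "AE s in lebesgue_on {0..L}. u1 s = u2 s"
proof -
  have \<alpha>: "0 < H - 1/2" "H - 1/2 < 1/2" using H by auto
  let ?R = "\<lambda>u. \<lambda>r. \<sigma> r *v K_density H L u r"
  have i: "integrable (lebesgue_on {0..t}) (?R u)" if "u \<in> L2 L" "t \<in> {0..L}" for t and u :: "real \<Rightarrow> real^'n"
    using that \<sigma> by (intro integrable_matrix_vector_mult K_op_eq_integral[OF H]) (auto intro: continuous_on_subset)
  have "AE s in lebesgue_on {0..L}. ?R u1 s - ?R u2 s = 0"
  proof (cases "0 \<le> L")
    case True
    show ?thesis
    proof (rule AE_zero_if_indefinite_integral_zero)
      show "integrable (lebesgue_on {0..L}) (\<lambda>s. ?R u1 s - ?R u2 s)"
        using i u True by simp
      show "(LINT s|lebesgue_on {0..t}. ?R u1 s - ?R u2 s) = 0" if "t \<in> {0..L}" for t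
        using i u that eq[OF that] K_sigma_eq_integral[OF H \<sigma> _ that] by simp
    qed
  qed (auto intro!: AE_I'[of "{}"] simp: space_restrict_space)
  moreover have "AE s in lebesgue_on {0..L}. s \<noteq> 0"
    by (rule AE_I'[of "{0} \<inter> {0..L}"])
       (auto simp: null_sets_restrict_space space_restrict_space negligible_iff_null_sets[symmetric] intro: negligible_subset[of "{0}"])
  moreover have "AE s in lebesgue_on {0..L}. s \<in> {0..L}"
    by (rule AE_I2) (simp add: space_restrict_space)
  ultimately have "AE r in lebesgue_on {0..L}. frac_int (H - 1/2) (weighted (H - 1/2) L u1) r = frac_int (H - 1/2) (weighted (H - 1/2) L u2) r"
  proof eventually_elim
    case (elim r)
    then have "\<sigma> r *v (K_density H L u1 r - K_density H L u2 r) = 0"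
      by (simp add: matrix_vector_mult_diff_distrib)
    then have "K_density H L u1 r = K_density H L u2 r" using inv elim by fastforce
    moreover have "c_H H * (H - 1/2) * pk (H - 1/2) r \<noteq> 0"
      using c_H_pos[OF H] \<alpha> elim by (auto simp: pk_def)
    ultimately show ?case by (simp add: K_density_def)
  qed
  then show ?thesis by (rule frac_int_weighted_cong[OF \<alpha> u])
qed

section \<open>Explicit preimages and their energy\<close>

lemma frac_int_measurable:
  fixes v :: "real \<Rightarrow> 'a::euclidean_space"
  assumes "v \<in> borel_measurable lebesgue"
  shows "frac_int a v \<in> borel_measurable lebesgue"
proof -
  have km: "(\<lambda>(t, s). pk (a - 1) (t - s)) \<in> borel_measurable (borel \<Otimes>\<^sub>M borel)" by measurable
  then have "(\<lambda>p. pk (a - 1) (fst p - snd p)) \<in> borel_measurable (lebesgue \<Otimes>\<^sub>M lebesgue)"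
    using borel_pair_measurable_lebesgue(1)[OF km] by (simp add: split_beta')
  then have "(\<lambda>p. pk (a - 1) (fst p - snd p) *\<^sub>R v (snd p)) \<in> borel_measurable (lebesgue \<Otimes>\<^sub>M lebesgue)"
    by (intro borel_measurable_scaleR measurable_compose[OF measurable_snd] assms)
  then show ?thesis unfolding frac_int_def[abs_def]
    by (intro lebesgue.borel_measurable_lebesgue_integral) (simp add: split_beta')
qed

text \<open>No continuity of \<open>f'\<close> is assumed, so measurability comes from continuous
  left difference quotients of step 1/(n+1). The maximum with \<open>a\<close> keeps the earlier
  point in [a,c]; at t = a there is no left quotient, hence the half-open interval.\<close>

lemma derivative_measurable:
  fixes f f' :: "real \<Rightarrow> 'a::euclidean_space"
  assumes d: "\<And>t. t \<in> {a..c} \<Longrightarrow> (f has_vector_derivative f' t) (at t within {a..c})"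
  shows "f' \<in> borel_measurable (lebesgue_on {a<..c})"
proof (rule borel_measurable_LIMSEQ_metric)
  have fc: "continuous_on {a..c} f"
    using d by (meson continuous_on_eq_continuous_within has_vector_derivative_continuous)
  have step: "max a (t - 1 / real (Suc n)) < t \<and> max a (t - 1 / real (Suc n)) \<in> {a..c}" if "t \<in> {a<..c}" for t n
  proof -
    define q where "q = 1 / real (Suc n)"
    have "0 < q" by (simp add: q_def)
    then show ?thesis using that unfolding q_def[symmetric] by (auto simp: max_def)
  qed
  show "(\<lambda>t. real (Suc n) *\<^sub>R (f t - f (max a (t - 1 / real (Suc n))))) \<in> borel_measurable (lebesgue_on {a<..c})" for n
  proof (rule continuous_imp_measurable_on_sets_lebesgue)
    show "continuous_on {a<..c} (\<lambda>t. real (Suc n) *\<^sub>R (f t - f (max a (t - 1 / real (Suc n)))))"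
      by (intro continuous_intros continuous_on_subset[OF fc] continuous_on_compose2[OF fc])
         (use step[of _ n] in auto)
  qed simp
  fix t assume "t \<in> space (lebesgue_on {a<..c})"
  then have t: "a < t" "t \<le> c" by (auto simp: space_restrict_space)
  let ?y = "\<lambda>n. max a (t - 1 / real (Suc n))"
  have inv0: "(\<lambda>n. 1 / real (Suc n)) \<longlonglongrightarrow> 0" using LIMSEQ_inverse_real_of_nat by (simp add: inverse_eq_divide)
  then have ev: "eventually (\<lambda>n. 1 / real (Suc n) < t - a) sequentially" using t by (intro order_tendstoD(2)) auto
  have ey: "eventually (\<lambda>n. t - 1 / real (Suc n) = ?y n) sequentially"
    using ev by eventually_elim (simp add: max_def)
  have "(\<lambda>n. t - 1 / real (Suc n)) \<longlonglongrightarrow> t" using tendsto_diff[OF tendsto_const inv0, of t] by simp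
  then have yt: "?y \<longlonglongrightarrow> t" using ey by (rule Lim_transform_eventually)
  have "?y n \<in> {a..c} \<and> ?y n \<noteq> t" for n using step[of t n] t by (metis greaterThanAtMost_iff less_irrefl)
  then have "eventually (\<lambda>n. ?y n \<in> {a..c} \<and> ?y n \<noteq> t) sequentially" by (intro always_eventually) blast
  then have fl: "filterlim ?y (at t within {a..c}) sequentially"
    using yt unfolding filterlim_at by blast
  have "((\<lambda>y. (1 / norm (y - t)) *\<^sub>R (f y - (f t + (y - t) *\<^sub>R f' t))) \<longlongrightarrow> 0) (at t within {a..c})"
    using d[of t] t by (auto simp: has_vector_derivative_def has_derivative_within)
  from filterlim_compose[OF this fl]
  have "(\<lambda>n. (1 / norm (?y n - t)) *\<^sub>R (f (?y n) - (f t + (?y n - t) *\<^sub>R f' t))) \<longlonglongrightarrow> 0" .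
  then have "(\<lambda>n. f' t - (1 / norm (?y n - t)) *\<^sub>R (f (?y n) - (f t + (?y n - t) *\<^sub>R f' t))) \<longlonglongrightarrow> f' t - 0"
    by (intro tendsto_diff tendsto_const)
  moreover have "eventually (\<lambda>n. f' t - (1 / norm (?y n - t)) *\<^sub>R (f (?y n) - (f t + (?y n - t) *\<^sub>R f' t)) =
      real (Suc n) *\<^sub>R (f t - f (?y n))) sequentially"
    using ev
  proof eventually_elim
    case (elim n)
    then have y: "?y n - t = - (1 / real (Suc n))" by simp
    have "real (Suc n) *\<^sub>R ((1 / real (Suc n)) *\<^sub>R f' t) = f' t" by simp
    then show ?case unfolding y by (simp add: scaleR_diff_right scaleR_add_right del: of_nat_Suc)
  qed
  ultimately show "(\<lambda>n. real (Suc n) *\<^sub>R (f t - f (?y n))) \<longlonglongrightarrow> f' t"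
    using Lim_transform_eventually by fastforce
qed

text \<open>The equation c_H \<alpha> r^\<alpha> I^\<alpha> w = \<rho> is solved for w =
  s^(-\<alpha>) u. The constant \<rho>(0) calls for s^(-2\<alpha>), whose I^\<alpha> is a multiple
  of r^(-\<alpha>). The rest, r^(-\<alpha>) (\<rho> - \<rho>(0)), tends to 0 at the origin and is
  I^1 g with g its derivative, so that I^(1-\<alpha>) g inverts it. In u the two pieces have sizes
  |\<rho>(0)| s^(-\<alpha>) and \<Lambda> s^(1-\<alpha>); \<open>C\<close> collects the Beta
  factors.\<close>

lemma K_density_surjective:
  fixes \<rho> \<rho>' :: "real \<Rightarrow> real^'n"
  assumes H: "1/2 < H" "H < 1" and L: "0 < L"
    and d\<rho>: "\<And>t. t \<in> {0..L} \<Longrightarrow> (\<rho> has_vector_derivative \<rho>' t) (at t within {0..L})"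
    and bA: "norm (\<rho> 0) \<le> A" and bL: "\<And>t. t \<in> {0..L} \<Longrightarrow> norm (\<rho>' t) \<le> \<Lambda>"
  defines "\<alpha> \<equiv> H - 1/2"
  defines "C \<equiv> (1 / Beta (1 - 2*\<alpha>) \<alpha> + (1 + \<alpha>) * Beta (1 - \<alpha>) (1 - \<alpha>) / Beta (1 - \<alpha>) \<alpha>) / (c_H H * \<alpha>)"
  shows "\<exists>u\<in>L2 L. (\<forall>r\<in>{0<..L}. K_density H L u r = \<rho> r) \<and>
    (LINT t|lebesgue_on {0..L}. (norm (u t))\<^sup>2) \<le>
      2 * C\<^sup>2 * (A\<^sup>2 * L powr (1 - 2*\<alpha>) / (1 - 2*\<alpha>) + \<Lambda>\<^sup>2 * L powr (3 - 2*\<alpha>) / (3 - 2*\<alpha>))"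
proof -
  have \<alpha>: "0 < \<alpha>" "\<alpha> < 1/2" using H by (auto simp: \<alpha>_def)
  note c = c_H_pos[OF H]
  define B1 B2 B3 where "B1 = Beta (1 - 2*\<alpha>) \<alpha>" and "B2 = Beta (1 - \<alpha>) \<alpha>" and "B3 = Beta (1 - \<alpha>) (1 - \<alpha>)"
  have B: "B1 > 0" "B2 > 0" "B3 > 0" using \<alpha> by (auto simp: B1_def B2_def B3_def intro!: Beta_pos)
  have \<Lambda>0: "0 \<le> \<Lambda>" using bL[of 0] L by (smt (verit) atLeastAtMost_iff norm_ge_zero)
  have A0: "0 \<le> A" using bA norm_ge_zero order_trans by blast
  have c\<rho>0: "continuous_on {0..L} \<rho>"
    using d\<rho> by (meson continuous_on_eq_continuous_within has_vector_derivative_continuous)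
  have lip: "norm (\<rho> r - \<rho> 0) \<le> \<Lambda> * r" if "r \<in> {0..L}" for r
  proof -
    have "norm (\<rho> r - \<rho> 0) \<le> \<Lambda> * norm (r - 0)"
    proof (rule differentiable_bound)
      show "convex {0..L}" by simp
      show "(\<rho> has_derivative (\<lambda>x. x *\<^sub>R \<rho>' t)) (at t within {0..L})" if "t \<in> {0..L}" for t
        using d\<rho>[OF that] by (simp add: has_vector_derivative_def)
      show "onorm (\<lambda>x. x *\<^sub>R \<rho>' t) \<le> \<Lambda>" if "t \<in> {0..L}" for t
      proof (rule onorm_bound[OF \<Lambda>0])
        show "norm (x *\<^sub>R \<rho>' t) \<le> \<Lambda> * norm x" for x
          using mult_left_mono[OF bL[OF that], of "\<bar>x\<bar>"] by (simp add: mult.commute)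
      qed
    qed (use that L in auto)
    then show ?thesis using that by simp
  qed
  \<comment> \<open>The derivative of r^(-\<alpha>) (\<rho>(r) - \<rho>(0)), extended by 0; the
    Lipschitz bound on \<rho> keeps it below a multiple of r^(-\<alpha>), which is integrable near
    0.\<close>
  define g where "g = (\<lambda>r. if r \<in> {0<..L} then r powr (-\<alpha>) *\<^sub>R \<rho>' r - (\<alpha> * r powr (-\<alpha> - 1)) *\<^sub>R (\<rho> r - \<rho> 0) else 0)"
  have gb: "norm (g r) \<le> (1 + \<alpha>) * \<Lambda> * (indicator {0..L} r * pk (-\<alpha>) r)" for r
  proof (cases "r \<in> {0<..L}")
    case True
    have "norm (g r) \<le> r powr (-\<alpha>) * norm (\<rho>' r) + (\<alpha> * r powr (-\<alpha> - 1)) * norm (\<rho> r - \<rho> 0)"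
    proof -
      have "norm (g r) \<le> norm (r powr (-\<alpha>) *\<^sub>R \<rho>' r) + norm ((\<alpha> * r powr (-\<alpha> - 1)) *\<^sub>R (\<rho> r - \<rho> 0))"
        using True by (simp only: g_def if_True norm_triangle_ineq4)
      then show ?thesis using \<alpha> by simp
    qed
    also have "\<dots> \<le> r powr (-\<alpha>) * \<Lambda> + (\<alpha> * r powr (-\<alpha> - 1)) * (\<Lambda> * r)"
      using True \<alpha> bL[of r] lip[of r] by (auto intro!: add_mono mult_left_mono)
    also have "r powr (-\<alpha>) * \<Lambda> + (\<alpha> * r powr (-\<alpha> - 1)) * (\<Lambda> * r) = (1 + \<alpha>) * \<Lambda> * r powr (-\<alpha>)"
    proof -
      have "r powr (-\<alpha>) = r powr (-\<alpha> - 1) * r"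
        using True powr_add[of r "-\<alpha>-1" 1] by simp
      then show ?thesis by (simp add: algebra_simps)
    qed
    finally show ?thesis using True by (simp add: pk_def)
  next
    case False
    then have "norm (g r) = 0" unfolding g_def by (simp only: if_not_P if_False norm_zero)
    moreover have "0 \<le> (1 + \<alpha>) * \<Lambda> * (indicator {0..L} r * pk (-\<alpha>) r)" using \<alpha> \<Lambda>0 by simp
    ultimately show ?thesis by linarith
  qed
  have pki: "integrable lebesgue (\<lambda>r. indicator {0..L} r * pk a r)" if "-1 < a" for a
    using pk_integrable[OF that, of L] by (simp add: integrable_restrict_space)
  have gm0: "(\<lambda>r. r powr (-\<alpha>) *\<^sub>R \<rho>' r - (\<alpha> * r powr (-\<alpha> - 1)) *\<^sub>R (\<rho> r - \<rho> 0)) \<in> borel_measurable (lebesgue_on {0<..L})"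
  proof -
    have c1: "continuous_on {0<..L} (\<lambda>r. r powr (-\<alpha>))" by (intro continuous_intros) auto
    have c2: "continuous_on {0<..L} (\<lambda>r. (\<alpha> * r powr (-\<alpha> - 1)) *\<^sub>R (\<rho> r - \<rho> 0))"
      by (intro continuous_intros ballI continuous_on_subset[OF c\<rho>0]) auto
    show ?thesis
      by (intro borel_measurable_diff borel_measurable_scaleR
          continuous_imp_measurable_on_sets_lebesgue[OF c1] continuous_imp_measurable_on_sets_lebesgue[OF c2]
          derivative_measurable[of 0 L \<rho>]) (auto intro: d\<rho>)
  qed
  have gm: "g \<in> borel_measurable lebesgue"
  proof -
    have "g \<in> borel_measurable (lebesgue_on {0<..L})"
      using gm0 by (rule measurable_cong[THEN iffD1, rotated]) (simp add: g_def space_restrict_space)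
    then have "(\<lambda>r. indicator {0<..L} r *\<^sub>R g r) \<in> borel_measurable lebesgue"
      by (simp add: borel_measurable_restrict_space_iff)
    moreover have "(\<lambda>r. indicator {0<..L} r *\<^sub>R g r) = g" by (auto simp: g_def fun_eq_iff)
    ultimately show ?thesis by simp
  qed
  have gi: "integrable lebesgue g"
  proof (rule Bochner_Integration.integrable_bound[OF _ gm])
    show "integrable lebesgue (\<lambda>r. (1 + \<alpha>) * \<Lambda> * (indicator {0..L} r * pk (-\<alpha>) r))"
      using pki[of "-\<alpha>"] \<alpha> by simp
    show "AE r in lebesgue. norm (g r) \<le> norm ((1 + \<alpha>) * \<Lambda> * (indicator {0..L} r * pk (-\<alpha>) r))"
      using gb by (intro AE_I2) (simp add: order_trans[OF gb abs_ge_self])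
  qed
  have gI: "(LINT s|lebesgue_on {0..r}. g s) = r powr (-\<alpha>) *\<^sub>R (\<rho> r - \<rho> 0)" if r: "r \<in> {0<..L}" for r
  proof -
    have "(g has_integral (r powr (-\<alpha>) *\<^sub>R (\<rho> r - \<rho> 0) - 0 powr (-\<alpha>) *\<^sub>R (\<rho> 0 - \<rho> 0))) {0..r}"
    proof (rule fundamental_theorem_of_calculus_interior)
      show "0 \<le> r" using r by simp
      show "continuous_on {0..r} (\<lambda>x. x powr (-\<alpha>) *\<^sub>R (\<rho> x - \<rho> 0))"
        unfolding continuous_on_eq_continuous_within
      proof
        fix x assume x: "x \<in> {0..r}"
        show "continuous (at x within {0..r}) (\<lambda>x. x powr (-\<alpha>) *\<^sub>R (\<rho> x - \<rho> 0))"
        proof (cases "x = 0")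
          case False
          then have "continuous (at x within {0..r}) (\<lambda>x. x powr (-\<alpha>))" 
            by (intro continuous_at_within_powr continuous_intros) auto
          moreover have "continuous (at x within {0..r}) \<rho>"
          proof -
            have "continuous_on {0..r} \<rho>" by (rule continuous_on_subset[OF c\<rho>0]) (use r in auto)
            then show ?thesis using x by (simp add: continuous_on_eq_continuous_within)
          qed
          ultimately show ?thesis by (intro continuous_scaleR continuous_diff continuous_const)
        next
          \<comment> \<open>The value at 0 is 0, so continuity means that the product tends to 0,
            which the bound \<Lambda> x^(1-\<alpha>) supplies.\<close>
          case True
          have "((\<lambda>x. \<Lambda> * x powr (1 - \<alpha>)) \<longlongrightarrow> \<Lambda> * 0 powr (1 - \<alpha>)) (at 0 within {0..r})"
          proof -
            have "continuous_on {0..r} (\<lambda>x. \<Lambda> * x powr (1 - \<alpha>))"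
              using \<alpha> by (intro continuous_intros continuous_on_powr') auto
            moreover have "0 \<in> {0..r}" using r by simp
            ultimately show ?thesis unfolding continuous_on_def by blast
          qed
          then have t: "((\<lambda>x. \<Lambda> * x powr (1 - \<alpha>)) \<longlongrightarrow> 0) (at 0 within {0..r})" using \<alpha> by simp
          have "((\<lambda>x. x powr (-\<alpha>) *\<^sub>R (\<rho> x - \<rho> 0)) \<longlongrightarrow> 0) (at 0 within {0..r})"
          proof (rule Lim_null_comparison[OF _ t])
            have "norm (x powr (-\<alpha>) *\<^sub>R (\<rho> x - \<rho> 0)) \<le> \<Lambda> * x powr (1 - \<alpha>)" if "x \<in> {0..r}" for x
            proof (cases "x = 0")
              case False
              have "norm (x powr (-\<alpha>) *\<^sub>R (\<rho> x - \<rho> 0)) \<le> x powr (-\<alpha>) * (\<Lambda> * x)"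
                using lip[of x] that r by (auto intro!: mult_left_mono)
              also have "\<dots> = \<Lambda> * x powr (1 - \<alpha>)"
                using that False powr_add[of x "-\<alpha>" 1] by (simp add: mult_ac)
              finally show ?thesis .
            qed simp
            then show "\<forall>\<^sub>F x in at 0 within {0..r}. norm (x powr (-\<alpha>) *\<^sub>R (\<rho> x - \<rho> 0)) \<le> \<Lambda> * x powr (1 - \<alpha>)"
              by (auto simp: eventually_at_filter)
          qed
          then show ?thesis using True by (simp add: continuous_within)
        qed
      qed
      show "((\<lambda>x. x powr (-\<alpha>) *\<^sub>R (\<rho> x - \<rho> 0)) has_vector_derivative g x) (at x)" if x: "x \<in> {0<..<r}" for x
      proof -
        have "(\<rho> has_vector_derivative \<rho>' x) (at x within {0..L})" using d\<rho> x r by auto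
        moreover have "at x within {0..L} = at x" using x r by (intro at_within_interior) (auto simp: interior_atLeastAtMost_real)
        ultimately have "(\<rho> has_vector_derivative \<rho>' x) (at x)" by simp
        moreover have "((\<lambda>x. x powr (-\<alpha>)) has_real_derivative (-\<alpha> * x powr (-\<alpha> - 1))) (at x)"
          using x by (auto intro!: derivative_eq_intros)
        ultimately have "((\<lambda>x. x powr (-\<alpha>) *\<^sub>R (\<rho> x - \<rho> 0)) has_vector_derivative
            (x powr (-\<alpha>) *\<^sub>R (\<rho>' x - 0) + (-\<alpha> * x powr (-\<alpha> - 1)) *\<^sub>R (\<rho> x - \<rho> 0))) (at x)"
          by (intro has_vector_derivative_scaleR has_vector_derivative_diff has_vector_derivative_const)
        then show ?thesis using x r by (simp add: g_def)
      qed
    qed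
    moreover have "integrable (lebesgue_on {0..r}) g"
      using integrable_mult_indicator[OF _ gi, of "{0..r}"] by (simp add: integrable_restrict_space)
    ultimately show ?thesis
      using lebesgue_integral_eq_integral[of "{0..r}" g] by (simp add: integral_unique)
  qed
  define G where "G = frac_int (1 - \<alpha>) g"
  have g0: "g s = 0" if "s \<le> 0" for s using that by (simp add: g_def)
  have G0: "G s = 0" if "s \<le> 0" for s
  proof -
    have "(\<lambda>r. pk (1 - \<alpha> - 1) (s - r) *\<^sub>R g r) = (\<lambda>r. 0)"
    proof
      show "pk (1 - \<alpha> - 1) (s - r) *\<^sub>R g r = 0" for r
        using that g0[of r] by (cases "r \<le> 0") (auto simp: pk_def)
    qed
    then show ?thesis by (simp only: G_def frac_int_def integral_zero)
  qed
  have Gm: "G \<in> borel_measurable lebesgue" unfolding G_def by (rule frac_int_measurable[OF gm])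
  \<comment> \<open>The integral of order 1 - \<alpha> of r^(-\<alpha>) is \<open>B3\<close> times
    s^(1-2\<alpha>).\<close>
  have Gb: "norm (G s) \<le> (1 + \<alpha>) * \<Lambda> * B3 * pk (1 - 2*\<alpha>) s" for s
  proof -
    note P = pk_convolution[of "1-\<alpha>" "1-\<alpha>" s 0]
    have "norm (G s) \<le> (LINT r|lebesgue. (1 + \<alpha>) * \<Lambda> * (pk (1-\<alpha>-1) (s - r) * pk (1-\<alpha>-1) (r - 0)))"
      unfolding G_def frac_int_def
    proof (rule Bochner_Integration.integral_norm_bound_integral)
      show ii: "integrable lebesgue (\<lambda>r. (1 + \<alpha>) * \<Lambda> * (pk (1-\<alpha>-1) (s - r) * pk (1-\<alpha>-1) (r - 0)))"
        using P \<alpha> by (simp add: has_bochner_integral_iff)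
      have le: "norm (pk (1-\<alpha>-1) (s - r) *\<^sub>R g r) \<le> (1 + \<alpha>) * \<Lambda> * (pk (1-\<alpha>-1) (s - r) * pk (1-\<alpha>-1) (r - 0))" for r
      proof -
        have "norm (g r) \<le> (1 + \<alpha>) * \<Lambda> * pk (-\<alpha>) r"
          using \<alpha> \<Lambda>0 by (intro order_trans[OF gb] mult_left_mono) (auto simp: indicator_def)
        then have "pk (-\<alpha>) (s - r) * norm (g r) \<le> pk (-\<alpha>) (s - r) * ((1 + \<alpha>) * \<Lambda> * pk (-\<alpha>) r)"
          by (rule mult_left_mono) simp
        then show ?thesis by (simp add: mult_ac)
      qed
      then show "norm (pk (1-\<alpha>-1) (s - r) *\<^sub>R g r) \<le> (1 + \<alpha>) * \<Lambda> * (pk (1-\<alpha>-1) (s - r) * pk (1-\<alpha>-1) (r - 0))" for r .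
      have "(\<lambda>r. pk (1-\<alpha>-1) (s - r)) \<in> borel_measurable lebesgue"
        by (intro measurable_completion measurable_compose[OF _ pk_measurable]) auto
      then have "(\<lambda>r. pk (1-\<alpha>-1) (s - r) *\<^sub>R g r) \<in> borel_measurable lebesgue"
        using gm by measurable
      then show "integrable lebesgue (\<lambda>r. pk (1-\<alpha>-1) (s - r) *\<^sub>R g r)"
      proof (rule Bochner_Integration.integrable_bound[OF ii], intro AE_I2)
        show "norm (pk (1-\<alpha>-1) (s - r) *\<^sub>R g r) \<le> norm ((1 + \<alpha>) * \<Lambda> * (pk (1-\<alpha>-1) (s - r) * pk (1-\<alpha>-1) (r - 0)))" for r
          unfolding real_norm_def by (rule order_trans[OF le abs_ge_self])
      qed
    qed
    also have "\<dots> = (1 + \<alpha>) * \<Lambda> * B3 * pk (1 - 2*\<alpha>) s"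
    proof -
      have "(LINT r|lebesgue. pk (1-\<alpha>-1) (s - r) * pk (1-\<alpha>-1) (r - 0)) = B3 * pk (1 - 2*\<alpha>) s"
        using has_bochner_integral_integral_eq[OF P] \<alpha> by (simp add: B3_def)
      then show ?thesis unfolding integral_mult_right_zero by simp
    qed
    finally show ?thesis .
  qed
  \<comment> \<open>\<open>B1\<close> normalises the fractional integral of s^(-2\<alpha>), which is
    \<open>B1\<close> r^(-\<alpha>); \<open>B2\<close> normalises the composition of the orders 1 -
    \<alpha> and \<alpha>.\<close>
  define w where "w = (\<lambda>s. (pk (-2*\<alpha>) s / B1) *\<^sub>R \<rho> 0 + (1 / B2) *\<^sub>R G s)"
  define u where "u = (\<lambda>s. (pk \<alpha> s / (c_H H * \<alpha>)) *\<^sub>R w s)"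
  have w0: "w s = 0" if "s \<le> 0" for s using that G0 by (simp add: w_def pk_def)
  have pkm: "(\<lambda>s. pk a s) \<in> borel_measurable lebesgue" for a
    by (intro measurable_completion) auto
  have wm: "w \<in> borel_measurable lebesgue" unfolding w_def using Gm pkm by measurable
  have um: "u \<in> borel_measurable lebesgue" unfolding u_def using wm pkm by measurable
  have ub: "norm (u s) \<le> C * (A * pk (-\<alpha>) s + \<Lambda> * pk (1 - \<alpha>) s)" for s
  proof (cases "0 < s")
    case False then show ?thesis by (simp add: u_def pk_def)
  next
    case True
    have "norm (w s) \<le> pk (-2*\<alpha>) s / B1 * A + 1 / B2 * ((1 + \<alpha>) * \<Lambda> * B3 * pk (1 - 2*\<alpha>) s)"
    proof -
      have "norm (w s) \<le> norm ((pk (-2*\<alpha>) s / B1) *\<^sub>R \<rho> 0) + norm ((1 / B2) *\<^sub>R G s)"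
        unfolding w_def by (rule norm_triangle_ineq)
      also have "\<dots> = pk (-2*\<alpha>) s / B1 * norm (\<rho> 0) + 1 / B2 * norm (G s)" using B by simp
      also have "\<dots> \<le> pk (-2*\<alpha>) s / B1 * A + 1 / B2 * ((1 + \<alpha>) * \<Lambda> * B3 * pk (1 - 2*\<alpha>) s)"
        using B bA Gb[of s] by (intro add_mono mult_left_mono) auto
      finally show ?thesis .
    qed
    moreover have "0 \<le> pk \<alpha> s / (c_H H * \<alpha>)" using c \<alpha> by simp
    ultimately have "norm (u s) \<le> pk \<alpha> s / (c_H H * \<alpha>) * (pk (-2*\<alpha>) s / B1 * A + 1 / B2 * ((1 + \<alpha>) * \<Lambda> * B3 * pk (1 - 2*\<alpha>) s))"
      unfolding u_def norm_scaleR by (simp only: abs_of_nonneg mult_left_mono)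
    also have "\<dots> = (1 / B1) / (c_H H * \<alpha>) * (A * pk (-\<alpha>) s) + ((1 + \<alpha>) * B3 / B2) / (c_H H * \<alpha>) * (\<Lambda> * pk (1 - \<alpha>) s)"
    proof -
      have "s powr (-\<alpha>) = s powr \<alpha> * s powr (-2*\<alpha>)" "s powr (1-\<alpha>) = s powr \<alpha> * s powr (1-2*\<alpha>)"
        by (simp_all flip: powr_add)
      then show ?thesis using True
        by (simp add: pk_def add_divide_distrib distrib_left distrib_right mult_ac)
    qed
    also have "\<dots> \<le> C * (A * pk (-\<alpha>) s) + C * (\<Lambda> * pk (1 - \<alpha>) s)"
    proof -
      have "0 \<le> 1 / B1 / (c_H H * \<alpha>)" "0 \<le> (1 + \<alpha>) * B3 / B2 / (c_H H * \<alpha>)" using B c \<alpha> by auto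
      moreover have "C = 1 / B1 / (c_H H * \<alpha>) + (1 + \<alpha>) * B3 / B2 / (c_H H * \<alpha>)"
        by (simp add: C_def B1_def B2_def B3_def add_divide_distrib)
      ultimately show ?thesis using A0 \<Lambda>0 by (intro add_mono mult_right_mono) auto
    qed
    finally show ?thesis by (simp add: distrib_left)
  qed
  \<comment> \<open>Squaring the two-term bound costs the factor 2, by (x + y)^2 \<le> 2 (x^2 +
    y^2).\<close>
  have u2: "(norm (u s))\<^sup>2 \<le> 2 * C\<^sup>2 * (A\<^sup>2 * pk (-2*\<alpha>) s + \<Lambda>\<^sup>2 * pk (2 - 2*\<alpha>) s)" for s
  proof -
    have "(norm (u s))\<^sup>2 \<le> (C * (A * pk (-\<alpha>) s + \<Lambda> * pk (1 - \<alpha>) s))\<^sup>2"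
      by (intro power_mono ub) auto
    also have "\<dots> = C\<^sup>2 * (A * pk (-\<alpha>) s + \<Lambda> * pk (1 - \<alpha>) s)\<^sup>2" by (rule power_mult_distrib)
    also have "\<dots> \<le> C\<^sup>2 * (2 * ((A * pk (-\<alpha>) s)\<^sup>2 + (\<Lambda> * pk (1 - \<alpha>) s)\<^sup>2))"
    proof (intro mult_left_mono)
      show "(x + y)\<^sup>2 \<le> 2 * (x\<^sup>2 + y\<^sup>2)" for x y :: real
        using sum_squares_bound[of x y] by (simp add: power2_sum)
    qed auto
    also have "\<dots> = 2 * C\<^sup>2 * (A\<^sup>2 * (pk (-\<alpha>) s)\<^sup>2 + \<Lambda>\<^sup>2 * (pk (1 - \<alpha>) s)\<^sup>2)"
      by (simp add: power_mult_distrib)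
    also have "(pk (-\<alpha>) s)\<^sup>2 = pk (-2*\<alpha>) s"
      by (auto simp: pk_def power2_eq_square simp flip: powr_add)
    also have "(pk (1-\<alpha>) s)\<^sup>2 = pk (2-2*\<alpha>) s"
      by (auto simp: pk_def power2_eq_square simp flip: powr_add)
    finally show ?thesis .
  qed
  have bi: "integrable (lebesgue_on {0..L}) (\<lambda>s. 2 * C\<^sup>2 * (A\<^sup>2 * pk (-2*\<alpha>) s + \<Lambda>\<^sup>2 * pk (2 - 2*\<alpha>) s))"
    using pk_integrable[of "-2*\<alpha>" L] pk_integrable[of "2-2*\<alpha>" L] \<alpha> by simp
  have u2m: "(\<lambda>s. (norm (u s))\<^sup>2) \<in> borel_measurable (lebesgue_on {0..L})"
    by (intro measurable_restrict_space1 borel_measurable_power measurable_compose[OF um borel_measurable_norm])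
  have ui: "integrable (lebesgue_on {0..L}) (\<lambda>s. (norm (u s))\<^sup>2)"
    by (rule Bochner_Integration.integrable_bound[OF bi u2m])
       (use u2 in \<open>auto intro!: AE_I2 order_trans[OF u2 abs_ge_self]\<close>)
  have uL: "u \<in> L2 L" unfolding L2_def using ui um by (auto intro: measurable_restrict_space1)
  have "(LINT t|lebesgue_on {0..L}. (norm (u t))\<^sup>2) \<le>
      (LINT s|lebesgue_on {0..L}. 2 * C\<^sup>2 * (A\<^sup>2 * pk (-2*\<alpha>) s + \<Lambda>\<^sup>2 * pk (2 - 2*\<alpha>) s))"
    by (intro integral_mono ui bi u2)
  also have "\<dots> = 2 * C\<^sup>2 * (A\<^sup>2 * (L powr (-2*\<alpha>+1) / (-2*\<alpha>+1)) + \<Lambda>\<^sup>2 * (L powr (2 - 2*\<alpha>+1) / (2 - 2*\<alpha>+1)))"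
    using pk_integrable[of "-2*\<alpha>" L] pk_integrable[of "2-2*\<alpha>" L] \<alpha> L
      pk_integral_eq[of "-2*\<alpha>" L] pk_integral_eq[of "2-2*\<alpha>" L] by simp
  also have "\<dots> = 2 * C\<^sup>2 * (A\<^sup>2 * L powr (1 - 2*\<alpha>) / (1 - 2*\<alpha>) + \<Lambda>\<^sup>2 * L powr (3 - 2*\<alpha>) / (3 - 2*\<alpha>))"
    by (simp add: algebra_simps)
  finally have bound: "(LINT t|lebesgue_on {0..L}. (norm (u t))\<^sup>2) \<le>
      2 * C\<^sup>2 * (A\<^sup>2 * L powr (1 - 2*\<alpha>) / (1 - 2*\<alpha>) + \<Lambda>\<^sup>2 * L powr (3 - 2*\<alpha>) / (3 - 2*\<alpha>))" .
  have "K_density H L u r = \<rho> r" if r: "r \<in> {0<..L}" for r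
  proof -
    have wu: "weighted \<alpha> L u s = (1 / (c_H H * \<alpha>)) *\<^sub>R (indicator {0..L} s *\<^sub>R w s)" for s
    proof (cases "0 < s")
      case True
      have "pk (-\<alpha>) s * pk \<alpha> s = 1" using True by (simp add: pk_def flip: powr_add)
      then show ?thesis by (simp add: weighted_def u_def)
    next
      case False then show ?thesis using w0[of s] by (simp add: weighted_def pk_def)
    qed
    have P: "has_bochner_integral lebesgue (\<lambda>s. pk (\<alpha>-1) (r - s) * pk (-2*\<alpha>) s) (B1 * pk (-\<alpha>) r)"
      using pk_convolution[of "1-2*\<alpha>" \<alpha> r 0] \<alpha> by (simp add: B1_def)
    have Q: "integrable lebesgue (\<lambda>s. pk (\<alpha>-1) (r - s) *\<^sub>R G s)" "frac_int \<alpha> G r = B2 *\<^sub>R frac_int 1 g r"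
      using frac_int_convolution[of "1-\<alpha>" \<alpha> g r] \<alpha> gi g0 by (simp_all add: G_def B2_def)
    have "frac_int \<alpha> (weighted \<alpha> L u) r = (LINT s|lebesgue. (1 / (c_H H * \<alpha>)) *\<^sub>R
        ((pk (\<alpha>-1) (r - s) * pk (-2*\<alpha>) s) *\<^sub>R ((1 / B1) *\<^sub>R \<rho> 0) + (1 / B2) *\<^sub>R (pk (\<alpha>-1) (r - s) *\<^sub>R G s)))"
      unfolding frac_int_def
    proof (rule Bochner_Integration.integral_cong[OF refl])
      fix s
      have "pk (\<alpha>-1) (r - s) *\<^sub>R (indicator {0..L} s *\<^sub>R w s) = pk (\<alpha>-1) (r - s) *\<^sub>R w s"
        using w0[of s] r by (cases "s < r"; cases "s \<le> 0") (auto simp: pk_def)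
      then have "pk (\<alpha>-1) (r - s) *\<^sub>R weighted \<alpha> L u s = (1 / (c_H H * \<alpha>)) *\<^sub>R pk (\<alpha>-1) (r - s) *\<^sub>R w s"
        unfolding wu by (metis scaleR_left_commute)
      then show "pk (\<alpha>-1) (r - s) *\<^sub>R weighted \<alpha> L u s = (1 / (c_H H * \<alpha>)) *\<^sub>R
        ((pk (\<alpha>-1) (r - s) * pk (-2*\<alpha>) s) *\<^sub>R ((1 / B1) *\<^sub>R \<rho> 0) + (1 / B2) *\<^sub>R (pk (\<alpha>-1) (r - s) *\<^sub>R G s))"
        by (simp add: w_def scaleR_add_right mult_ac)
    qed
    also have "\<dots> = (1 / (c_H H * \<alpha>)) *\<^sub>R ((B1 * pk (-\<alpha>) r) *\<^sub>R ((1 / B1) *\<^sub>R \<rho> 0) + (1 / B2) *\<^sub>R frac_int \<alpha> G r)"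
    proof -
      have "has_bochner_integral lebesgue (\<lambda>s. (pk (\<alpha>-1) (r - s) * pk (-2*\<alpha>) s) *\<^sub>R ((1 / B1) *\<^sub>R \<rho> 0))
          ((B1 * pk (-\<alpha>) r) *\<^sub>R ((1 / B1) *\<^sub>R \<rho> 0))"
        using P by (rule has_bochner_integral_scaleR_left)
      moreover have "has_bochner_integral lebesgue (\<lambda>s. (1 / B2) *\<^sub>R (pk (\<alpha>-1) (r - s) *\<^sub>R G s)) ((1 / B2) *\<^sub>R frac_int \<alpha> G r)"
        using Q(1) by (intro has_bochner_integral_scaleR_right) (simp add: has_bochner_integral_iff frac_int_def)
      ultimately show ?thesis
        unfolding integral_scaleR_right
        by (subst has_bochner_integral_integral_eq[OF has_bochner_integral_add]) auto
    qed
    also have "frac_int 1 g r = r powr (-\<alpha>) *\<^sub>R (\<rho> r - \<rho> 0)"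
      using gI[OF r] frac_int_1[of g r] g0 gm by simp
    then have "frac_int \<alpha> G r = (B2 * r powr (-\<alpha>)) *\<^sub>R (\<rho> r - \<rho> 0)" using Q(2) by simp
    finally have "frac_int \<alpha> (weighted \<alpha> L u) r = (r powr (-\<alpha>) / (c_H H * \<alpha>)) *\<^sub>R \<rho> r"
      using B r by (simp add: pk_def scaleR_right_diff_distrib)
    moreover have "r powr \<alpha> * r powr (-\<alpha>) = 1" using r by (simp flip: powr_add)
    ultimately show ?thesis
      using c \<alpha> r by (simp add: K_density_def \<alpha>_def[symmetric] pk_def)
  qed
  with uL bound show ?thesis by blast
qed

text \<open>The constant of \<open>K_density_surjective\<close> after both denominators 1 -
  2\<alpha> and 3 - 2\<alpha> are replaced by the smaller one. It depends on H alone, not on the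
  length of the interval.\<close>

definition energy_const :: "real \<Rightarrow> real" where
  "energy_const H = (let \<alpha> = H - 1/2 in
     2 * ((1 / Beta (1 - 2*\<alpha>) \<alpha> + (1 + \<alpha>) * Beta (1 - \<alpha>) (1 - \<alpha>) / Beta (1 - \<alpha>) \<alpha>) / (c_H H * \<alpha>))\<^sup>2 / (1 - 2*\<alpha>))"

text \<open>The explicit control is one preimage, and injectivity identifies it almost everywhere
  with the one selected by \<open>K_sigma_inv\<close>. In terms of H the exponents 1 - 2\<alpha> and
  3 - 2\<alpha> read 2 - 2H and 4 - 2H.\<close>

lemma energy_bound:
  fixes \<sigma> :: "real \<Rightarrow> real^'n^'n" and \<rho> \<rho>' :: "real \<Rightarrow> real^'n"
  assumes H: "1/2 < H" "H < 1" and L: "0 < L" and \<sigma>: "continuous_on {0..L} \<sigma>"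
    and inv: "\<And>s w. s \<in> {0..L} \<Longrightarrow> \<sigma> s *v w = 0 \<Longrightarrow> w = 0"
    and d\<rho>: "\<And>t. t \<in> {0..L} \<Longrightarrow> (\<rho> has_vector_derivative \<rho>' t) (at t within {0..L})"
    and bA: "norm (\<rho> 0) \<le> A" and bL: "\<And>t. t \<in> {0..L} \<Longrightarrow> norm (\<rho>' t) \<le> \<Lambda>"
    and p: "\<And>t. t \<in> {0..L} \<Longrightarrow> p t = (LINT s|lebesgue_on {0..t}. \<sigma> s *v \<rho> s)"
  shows "p \<in> CM_space H \<sigma> L"
    and "(LINT t|lebesgue_on {0..L}. (norm (K_sigma_inv H \<sigma> L p t))\<^sup>2) \<le>
      energy_const H * (A\<^sup>2 * L powr (2 - 2*H) + \<Lambda>\<^sup>2 * L powr (4 - 2*H))"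
proof -
  define \<alpha> where "\<alpha> = H - 1/2"
  define C where "C = (1 / Beta (1 - 2*\<alpha>) \<alpha> + (1 + \<alpha>) * Beta (1 - \<alpha>) (1 - \<alpha>) / Beta (1 - \<alpha>) \<alpha>) / (c_H H * \<alpha>)"
  have \<alpha>: "0 < \<alpha>" "\<alpha> < 1/2" using H by (auto simp: \<alpha>_def)
  obtain u where u: "u \<in> L2 L" "\<And>r. r \<in> {0<..L} \<Longrightarrow> K_density H L u r = \<rho> r"
    "(LINT t|lebesgue_on {0..L}. (norm (u t))\<^sup>2) \<le>
      2 * C\<^sup>2 * (A\<^sup>2 * L powr (1 - 2*\<alpha>) / (1 - 2*\<alpha>) + \<Lambda>\<^sup>2 * L powr (3 - 2*\<alpha>) / (3 - 2*\<alpha>))"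
    using K_density_surjective[OF H L d\<rho> bA bL] unfolding C_def \<alpha>_def by blast
  have pu: "p t = K_sigma H \<sigma> u t" if t: "t \<in> {0..L}" for t
  proof -
    have ct: "continuous_on {0..t} \<sigma>" using \<sigma> t by (auto intro: continuous_on_subset)
    have "continuous_on {0..L} \<rho>"
      using d\<rho> by (meson continuous_on_eq_continuous_within has_vector_derivative_continuous)
    then have "continuous_on {0..t} \<rho>" using t by (auto intro: continuous_on_subset)
    then have \<rho>i: "integrable (lebesgue_on {0..t}) \<rho>" by (rule continuous_imp_integrable_real)
    have "(LINT s|lebesgue_on {0..t}. \<sigma> s *v \<rho> s) = (LINT s|lebesgue_on {0..t}. \<sigma> s *v K_density H L u s)"
    proof (rule integral_cong_AE)
      show "(\<lambda>s. \<sigma> s *v \<rho> s) \<in> borel_measurable (lebesgue_on {0..t})"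
        by (intro borel_measurable_integrable integrable_matrix_vector_mult ct \<rho>i)
      show "(\<lambda>s. \<sigma> s *v K_density H L u s) \<in> borel_measurable (lebesgue_on {0..t})"
        by (intro borel_measurable_integrable integrable_matrix_vector_mult ct K_op_eq_integral[OF H u(1) t])
      show "AE s in lebesgue_on {0..t}. \<sigma> s *v \<rho> s = \<sigma> s *v K_density H L u s"
      \<comment> \<open>\<open>K_density\<close> is 0 at the origin, where \<rho> need not be; one
        point does not affect the integral.\<close>
      proof (rule AE_I'[of "{0} \<inter> {0..t}"])
        show "{0} \<inter> {0..t} \<in> null_sets (lebesgue_on {0..t})"
          by (auto simp: null_sets_restrict_space negligible_iff_null_sets[symmetric] intro: negligible_subset[of "{0}"])
        show "{s \<in> space (lebesgue_on {0..t}). \<sigma> s *v \<rho> s \<noteq> \<sigma> s *v K_density H L u s} \<subseteq> {0} \<inter> {0..t}"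
        proof
          fix s assume "s \<in> {s \<in> space (lebesgue_on {0..t}). \<sigma> s *v \<rho> s \<noteq> \<sigma> s *v K_density H L u s}"
          then have "s \<in> {0..t}" "K_density H L u s \<noteq> \<rho> s" by (auto simp: space_restrict_space)
          then show "s \<in> {0} \<inter> {0..t}" using u(2)[of s] t by force
        qed
      qed
    qed
    then show ?thesis using p[OF t] K_sigma_eq_integral[OF H \<sigma> u(1) t] by simp
  qed
  then show "p \<in> CM_space H \<sigma> L" using u(1) by (auto simp: CM_space_def)
  define U where "U = K_sigma_inv H \<sigma> L p"
  have "U \<in> L2 L \<and> (\<forall>t\<in>{0..L}. p t = K_sigma H \<sigma> U t)"
    unfolding U_def K_sigma_inv_def by (rule someI[of _ u]) (use pu u in auto)
  then have U: "U \<in> L2 L" "\<And>t. t \<in> {0..L} \<Longrightarrow> K_sigma H \<sigma> U t = K_sigma H \<sigma> u t" using pu by auto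
  have "AE s in lebesgue_on {0..L}. U s = u s" by (rule K_sigma_injective[OF H \<sigma> inv U(1) u(1) U(2)])
  then have "AE s in lebesgue_on {0..L}. (norm (U s))\<^sup>2 = (norm (u s))\<^sup>2" by eventually_elim simp
  then have "(LINT t|lebesgue_on {0..L}. (norm (U t))\<^sup>2) = (LINT t|lebesgue_on {0..L}. (norm (u t))\<^sup>2)"
    using U(1) u(1) by (intro integral_cong_AE) (auto simp: L2_def)
  also note u(3)
  also have "2 * C\<^sup>2 * (A\<^sup>2 * L powr (1 - 2*\<alpha>) / (1 - 2*\<alpha>) + \<Lambda>\<^sup>2 * L powr (3 - 2*\<alpha>) / (3 - 2*\<alpha>)) \<le>
     2 * C\<^sup>2 * (A\<^sup>2 * L powr (1 - 2*\<alpha>) / (1 - 2*\<alpha>) + \<Lambda>\<^sup>2 * L powr (3 - 2*\<alpha>) / (1 - 2*\<alpha>))"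
    using \<alpha> by (intro mult_left_mono add_left_mono divide_left_mono) auto
  also have "\<dots> = energy_const H * (A\<^sup>2 * L powr (2 - 2*H) + \<Lambda>\<^sup>2 * L powr (4 - 2*H))"
  proof -
    have "energy_const H = 2 * C\<^sup>2 / (1 - 2*\<alpha>)" by (simp add: energy_const_def \<alpha>_def[symmetric] C_def Let_def)
    moreover have "1 - 2*\<alpha> = 2 - 2*H" "3 - 2*\<alpha> = 4 - 2*H" by (auto simp: \<alpha>_def)
    ultimately show ?thesis
      by (simp only: add_divide_distrib distrib_left times_divide_eq_left times_divide_eq_right)
  qed
  finally show "(LINT t|lebesgue_on {0..L}. (norm (K_sigma_inv H \<sigma> L p t))\<^sup>2) \<le>
      energy_const H * (A\<^sup>2 * L powr (2 - 2*H) + \<Lambda>\<^sup>2 * L powr (4 - 2*H))" unfolding U_def .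
qed

section \<open>Calculus for functions of class \<open>C\<^sub>b\<^sup>k\<close>\<close>

lemma Cb_Suc_imp: "Cb (Suc k) f \<Longrightarrow> Cb k f"
proof (induction k arbitrary: f)
  case (Suc k)
  then show ?case by (simp only: Cb.simps) blast
qed simp

lemma Cb_has_derivative: "Cb (Suc k) f \<Longrightarrow> (f has_derivative frechet_derivative f (at x)) (at x)"
  by (simp add: frechet_derivative_works[symmetric])

lemma Cb_bounded_linear:
  fixes f :: "'a::euclidean_space \<Rightarrow> 'b::real_normed_vector"
  assumes h: "bounded_linear h"
  shows "Cb k f \<Longrightarrow> Cb k (\<lambda>x. h (f x))"
proof (induction k arbitrary: f)
  case 0
  have "bounded (h ` range f)" using 0 by (simp add: bounded_linear_image[OF _ h])
  moreover have "continuous_on UNIV (\<lambda>x. h (f x))" using 0 by (intro bounded_linear.continuous_on[OF h]) simp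
  ultimately show ?case by (simp add: image_image)
next
  case (Suc k)
  have "bounded (h ` range f)" using Suc.prems by (simp add: bounded_linear_image[OF _ h])
  moreover have "((\<lambda>x. h (f x)) has_derivative (\<lambda>v. h (frechet_derivative f (at x) v))) (at x)" for x
    by (rule bounded_linear.has_derivative[OF h Cb_has_derivative[OF Suc.prems]])
  then have "frechet_derivative (\<lambda>x. h (f x)) (at x) = (\<lambda>v. h (frechet_derivative f (at x) v))"
    "(\<lambda>x. h (f x)) differentiable at x" for x
    by (auto simp: frechet_derivative_at[symmetric] differentiable_def)
  moreover have "continuous_on UNIV (\<lambda>x. h (f x))" using Suc.prems by (intro bounded_linear.continuous_on[OF h]) simp
  ultimately show ?case using Suc by (simp add: image_image)
qed

lemma Cb_add:
  fixes f g :: "'a::euclidean_space \<Rightarrow> 'b::real_normed_vector"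
  shows "Cb k f \<Longrightarrow> Cb k g \<Longrightarrow> Cb k (\<lambda>x. f x + g x)"
proof (induction k arbitrary: f g)
  case 0
  then show ?case by (auto intro!: continuous_on_add bounded_plus_comp)
next
  case (Suc k)
  have "((\<lambda>x. f x + g x) has_derivative (\<lambda>v. frechet_derivative f (at x) v + frechet_derivative g (at x) v)) (at x)" for x
    using Suc.prems by (intro has_derivative_add Cb_has_derivative)
  then have "frechet_derivative (\<lambda>x. f x + g x) (at x) = (\<lambda>v. frechet_derivative f (at x) v + frechet_derivative g (at x) v)"
    "(\<lambda>x. f x + g x) differentiable at x" for x
    by (auto simp: frechet_derivative_at[symmetric] differentiable_def)
  then show ?case using Suc by (auto intro!: continuous_on_add bounded_plus_comp)
qed

lemma Cb_zero: "Cb k (\<lambda>x::'a::euclidean_space. 0::'b::real_normed_vector)"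
  by (induction k) (auto simp: frechet_derivative_const)

lemma Cb_sum:
  fixes f :: "'i \<Rightarrow> 'a::euclidean_space \<Rightarrow> 'b::real_normed_vector"
  assumes "finite I" "\<And>i. i \<in> I \<Longrightarrow> Cb k (f i)"
  shows "Cb k (\<lambda>x. \<Sum>i\<in>I. f i x)"
  using assms by (induction I rule: finite_induct) (auto intro: Cb_zero Cb_add)

text \<open>\<open>Cb\<close> speaks of derivatives along basis vectors only. This expansion carries
  continuity and bounds over to every direction, with bounds linear in the length of the
  direction.\<close>

lemma frechet_derivative_Basis_expansion:
  fixes f :: "'a::euclidean_space \<Rightarrow> 'b::real_normed_vector"
  assumes "f differentiable at x"
  shows "frechet_derivative f (at x) w = (\<Sum>e\<in>Basis. (w \<bullet> e) *\<^sub>R frechet_derivative f (at x) e)"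
proof -
  have "linear (frechet_derivative f (at x))" using assms by (rule linear_frechet_derivative)
  then show ?thesis
    by (subst euclidean_representation[of w, symmetric]) (simp only: linear_sum linear_cmul)
qed

lemma Cb_directional:
  fixes f :: "'a::euclidean_space \<Rightarrow> 'b::real_normed_vector"
  assumes "Cb (Suc k) f"
  shows "Cb k (\<lambda>x. frechet_derivative f (at x) w)"
proof -
  have "Cb k (\<lambda>x. \<Sum>e\<in>Basis. (w \<bullet> e) *\<^sub>R frechet_derivative f (at x) e)"
    using assms by (intro Cb_sum Cb_bounded_linear[OF bounded_linear_scaleR_right]) auto
  moreover have "frechet_derivative f (at x) w = (\<Sum>e\<in>Basis. (w \<bullet> e) *\<^sub>R frechet_derivative f (at x) e)" for x
    using assms by (intro frechet_derivative_Basis_expansion) simp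
  ultimately show ?thesis by simp
qed

lemma Cb_derivative_bound:
  fixes f :: "'a::euclidean_space \<Rightarrow> 'b::real_normed_vector"
  assumes f: "Cb (Suc k) f"
  obtains B where "0 \<le> B" "\<And>x w. norm (frechet_derivative f (at x) w) \<le> B * norm w"
proof -
  have "\<exists>b. \<forall>x. norm (frechet_derivative f (at x) e) \<le> b" if "e \<in> Basis" for e
  proof -
    have "Cb k (\<lambda>x. frechet_derivative f (at x) e)" using f that by simp
    then have "bounded (range (\<lambda>x. frechet_derivative f (at x) e))" by (cases k) auto
    then show ?thesis by (auto simp: bounded_iff)
  qed
  then obtain b where b: "\<And>e x. e \<in> Basis \<Longrightarrow> norm (frechet_derivative f (at x) e) \<le> b e" by metis
  have b0: "0 \<le> b e" if "e \<in> Basis" for e using order_trans[OF norm_ge_zero b[OF that]] .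
  show thesis
  proof
    show "0 \<le> (\<Sum>e\<in>Basis. b e)" using b0 by (rule sum_nonneg)
    fix x w
    have "norm (frechet_derivative f (at x) w) \<le> (\<Sum>e\<in>Basis. norm ((w \<bullet> e) *\<^sub>R frechet_derivative f (at x) e))"
      unfolding frechet_derivative_Basis_expansion[of f x w, OF Cb_has_derivative[OF f, THEN differentiableI]] by (rule norm_sum)
    also have "\<dots> \<le> (\<Sum>e\<in>Basis. norm w * b e)"
      by (intro sum_mono) (auto intro!: mult_mono Basis_le_norm b)
    finally show "norm (frechet_derivative f (at x) w) \<le> (\<Sum>e\<in>Basis. b e) * norm w"
      by (simp add: sum_distrib_left mult.commute)
  qed
qed

lemma Cb_Lipschitz:
  fixes f :: "'a::euclidean_space \<Rightarrow> 'b::real_normed_vector"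
  assumes f: "Cb (Suc k) f"
  obtains B where "0 \<le> B" "\<And>x v. norm (f (x + v) - f x) \<le> B * norm v"
proof -
  obtain B where B: "0 \<le> B" "\<And>x w. norm (frechet_derivative f (at x) w) \<le> B * norm w"
    using Cb_derivative_bound[OF f] by blast
  have "norm (f (x + v) - f x) \<le> B * norm ((x + v) - x)" for x v
    by (rule differentiable_bound[of UNIV f "\<lambda>x. frechet_derivative f (at x)"])
       (use Cb_has_derivative[OF f] B in \<open>auto intro: onorm_bound\<close>)
  then show thesis using B(1) that by simp
qed

text \<open>The mean value inequality is applied to f(x + y) - Df(x) y as a function of y on the
  segment from 0 to v, where its derivative is at most C |v|. The constant is uniform in x, which
  later gives estimates along the whole orbit.\<close>

lemma Cb_Taylor:
  fixes f :: "'a::euclidean_space \<Rightarrow> 'b::real_normed_vector"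
  assumes f: "Cb (Suc (Suc k)) f"
  obtains C where "0 \<le> C" "\<And>x w v. norm (frechet_derivative f (at (x + v)) w - frechet_derivative f (at x) w) \<le> C * norm v * norm w"
    "\<And>x v. norm (f (x + v) - f x - frechet_derivative f (at x) v) \<le> C * (norm v)\<^sup>2"
proof -
  let ?D = "\<lambda>x. frechet_derivative f (at x)"
  have "\<exists>b\<ge>0. \<forall>x v. norm (?D (x + v) e - ?D x e) \<le> b * norm v" for e
    using Cb_Lipschitz[OF Cb_directional[OF f, of e]] by metis
  then obtain b where b: "\<And>e. 0 \<le> b e" "\<And>e x v. norm (?D (x + v) e - ?D x e) \<le> b e * norm v" by metis
  define C where "C = (\<Sum>e\<in>Basis. b e)"
  have C: "0 \<le> C" unfolding C_def using b(1) by (rule sum_nonneg)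
  have D: "norm (?D (x + v) w - ?D x w) \<le> C * norm v * norm w" for x v w
  proof -
    have "?D (x + v) w - ?D x w = (\<Sum>e\<in>Basis. (w \<bullet> e) *\<^sub>R (?D (x + v) e - ?D x e))"
      using f frechet_derivative_Basis_expansion[of f "x + v" w] frechet_derivative_Basis_expansion[of f x w]
      by (simp add: scaleR_diff_right sum_subtractf)
    also have "norm \<dots> \<le> (\<Sum>e\<in>Basis. norm w * (b e * norm v))"
      by (intro order_trans[OF norm_sum] sum_mono) (auto intro!: mult_mono Basis_le_norm b)
    also have "\<dots> = C * norm v * norm w" by (simp add: C_def sum_distrib_left sum_distrib_right mult_ac)
    finally show ?thesis .
  qed
  have T: "norm (f (x + v) - f x - ?D x v) \<le> C * (norm v)\<^sup>2" for x v
  proof -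
    have lin: "bounded_linear (?D x)" for x using Cb_has_derivative[OF f] by (rule has_derivative_bounded_linear)
    have "norm ((f (x + v) - ?D x v) - (f (x + 0) - ?D x 0)) \<le> (C * norm v) * norm (v - 0)"
    proof (rule differentiable_bound[of "closed_segment 0 v" "\<lambda>y. f (x + y) - ?D x y" "\<lambda>y w. ?D (x + y) w - ?D x w"])
      show "((\<lambda>y. f (x + y) - ?D x y) has_derivative (\<lambda>w. ?D (x + y) w - ?D x w)) (at y within closed_segment 0 v)" for y
      proof -
        have "((\<lambda>y. f (x + y)) has_derivative (\<lambda>w. ?D (x + y) (0 + w))) (at y within closed_segment 0 v)"
          by (rule has_derivative_compose[OF has_derivative_add[OF has_derivative_const has_derivative_ident] Cb_has_derivative[OF f]])
        then show ?thesis
          by (intro has_derivative_diff bounded_linear.has_derivative[OF lin has_derivative_ident]) simp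
      qed
      show "onorm (\<lambda>w. ?D (x + y) w - ?D x w) \<le> C * norm v" if "y \<in> closed_segment 0 v" for y
      proof (rule onorm_bound)
        show "norm (?D (x + y) w - ?D x w) \<le> C * norm v * norm w" for w
        proof -
          have "norm y \<le> norm v" using segment_bound1[OF that] by simp
          then have "C * norm y * norm w \<le> C * norm v * norm w" using C by (intro mult_right_mono mult_left_mono) auto
          then show ?thesis using D[of x y w] by simp
        qed
      qed (use C in auto)
    qed auto
    moreover have "?D x 0 = 0" using linear_0[OF bounded_linear.linear[OF lin]] .
    ultimately show ?thesis by (simp add: power2_eq_square algebra_simps)
  qed
  show thesis using that C D T by blast
qed

lemma Cb_directional_continuous:
  assumes "Cb (Suc k) f" shows "continuous_on UNIV (\<lambda>x. frechet_derivative f (at x) w)"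
  using Cb_directional[OF assms, of w] by (cases k) auto

text \<open>Two mean value inequalities: in direction a for the derivative of f along c, then in
  direction c for the increment of f. Continuity of the iterated derivative at x makes the error at
  most \<eta> s t.\<close>

lemma Cb_iterated_derivative_increment:
  fixes f :: "'a::euclidean_space \<Rightarrow> 'b::real_normed_vector" and a c x :: 'a
  assumes f: "Cb (Suc (Suc k)) f" and \<eta>: "0 < \<eta>"
  defines "A \<equiv> frechet_derivative (\<lambda>z. frechet_derivative f (at z) c) (at x) a"
  obtains d where "0 < d" "\<And>s t. 0 \<le> s \<Longrightarrow> s < d \<Longrightarrow> 0 \<le> t \<Longrightarrow> t < d \<Longrightarrow>
    norm (f (x + s *\<^sub>R a + t *\<^sub>R c) - f (x + s *\<^sub>R a) - f (x + t *\<^sub>R c) + f x - (s * t) *\<^sub>R A) \<le> \<eta> * s * t"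
proof -
  let ?F = "\<lambda>z. frechet_derivative f (at z) c"
  let ?G = "\<lambda>z. frechet_derivative ?F (at z) a"
  have F: "Cb (Suc k) ?F" by (rule Cb_directional[OF f])
  have "isCont ?G x"
    using Cb_directional_continuous[OF F, of a] by (simp add: continuous_on_eq_continuous_at)
  then obtain r where r: "r > 0" "\<And>z. dist z x < r \<Longrightarrow> dist (?G z) A < \<eta>"
    using \<eta> unfolding continuous_at_eps_delta A_def by blast
  \<comment> \<open>Small enough to keep x + s a + t c within r of x for s, t < d; adding 1 covers a
    = c = 0.\<close>
  define d where "d = r / (norm a + norm c + 1)"
  have d: "d > 0" using r by (simp add: d_def add_nonneg_pos)
  have near: "dist (x + s *\<^sub>R a + t *\<^sub>R c) x < r" if st: "0 \<le> s" "s < d" "0 \<le> t" "t < d" for s t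
  proof -
    have "dist (x + s *\<^sub>R a + t *\<^sub>R c) x \<le> s * norm a + t * norm c"
      using st norm_triangle_ineq[of "s *\<^sub>R a" "t *\<^sub>R c"] by (simp add: dist_norm algebra_simps)
    also have "\<dots> \<le> d * norm a + d * norm c" using st by (intro add_mono mult_right_mono) auto
    also have "\<dots> < d * (norm a + norm c + 1)" using d by (simp add: algebra_simps)
    also have "\<dots> = r" by (simp add: d_def) (smt (verit) norm_ge_zero)
    finally show ?thesis .
  qed
  show thesis
  proof
    show "d > 0" by fact
    fix s t assume st: "0 \<le> s" "s < d" "0 \<le> t" "t < d"
    have inner: "norm (?F (x + s *\<^sub>R a + \<tau> *\<^sub>R c) - ?F (x + \<tau> *\<^sub>R c) - s *\<^sub>R A) \<le> \<eta> * s" if \<tau>: "\<tau> \<in> {0..t}" for \<tau>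
    proof -
      have "norm ((?F (x + s *\<^sub>R a + \<tau> *\<^sub>R c) - s *\<^sub>R A) - (?F (x + 0 *\<^sub>R a + \<tau> *\<^sub>R c) - 0 *\<^sub>R A)) \<le> \<eta> * norm (s - 0)"
      proof (rule differentiable_bound[of "{0..s}" "\<lambda>\<xi>. ?F (x + \<xi> *\<^sub>R a + \<tau> *\<^sub>R c) - \<xi> *\<^sub>R A"
            "\<lambda>\<xi> h. frechet_derivative ?F (at (x + \<xi> *\<^sub>R a + \<tau> *\<^sub>R c)) (h *\<^sub>R a) - h *\<^sub>R A"])
        fix \<xi> assume \<xi>: "\<xi> \<in> {0..s}"
        have "((\<lambda>\<xi>. ?F (x + \<xi> *\<^sub>R a + \<tau> *\<^sub>R c)) has_derivative (\<lambda>h. frechet_derivative ?F (at (x + \<xi> *\<^sub>R a + \<tau> *\<^sub>R c)) (h *\<^sub>R a))) (at \<xi> within {0..s})"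
          by (rule has_derivative_compose[of "\<lambda>\<xi>. x + \<xi> *\<^sub>R a + \<tau> *\<^sub>R c" "\<lambda>h. h *\<^sub>R a"])
             (auto intro!: derivative_eq_intros Cb_has_derivative[OF F])
        then show "((\<lambda>\<xi>. ?F (x + \<xi> *\<^sub>R a + \<tau> *\<^sub>R c) - \<xi> *\<^sub>R A) has_derivative
            (\<lambda>h. frechet_derivative ?F (at (x + \<xi> *\<^sub>R a + \<tau> *\<^sub>R c)) (h *\<^sub>R a) - h *\<^sub>R A)) (at \<xi> within {0..s})"
          by (intro has_derivative_diff has_derivative_scaleR_left has_derivative_ident)
        show "onorm (\<lambda>h. frechet_derivative ?F (at (x + \<xi> *\<^sub>R a + \<tau> *\<^sub>R c)) (h *\<^sub>R a) - h *\<^sub>R A) \<le> \<eta>"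
        proof (rule onorm_bound)
          fix h
          have "linear (frechet_derivative ?F (at (x + \<xi> *\<^sub>R a + \<tau> *\<^sub>R c)))"
            using Cb_has_derivative[OF F] has_derivative_bounded_linear bounded_linear.linear by blast
          then have "frechet_derivative ?F (at (x + \<xi> *\<^sub>R a + \<tau> *\<^sub>R c)) (h *\<^sub>R a) - h *\<^sub>R A =
              h *\<^sub>R (?G (x + \<xi> *\<^sub>R a + \<tau> *\<^sub>R c) - A)"
            by (simp add: linear_cmul scaleR_diff_right)
          moreover have "norm (?G (x + \<xi> *\<^sub>R a + \<tau> *\<^sub>R c) - A) \<le> \<eta>"
            using r(2)[OF near[of \<xi> \<tau>]] \<xi> \<tau> st by (auto simp: dist_norm)
          ultimately show "norm (frechet_derivative ?F (at (x + \<xi> *\<^sub>R a + \<tau> *\<^sub>R c)) (h *\<^sub>R a) - h *\<^sub>R A) \<le> \<eta> * norm h"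
            using mult_left_mono[of "norm (?G (x + \<xi> *\<^sub>R a + \<tau> *\<^sub>R c) - A)" \<eta> "norm h"] by (simp add: mult.commute)
        qed (use \<eta> in auto)
      qed (use st in auto)
      then show ?thesis using st by (simp add: algebra_simps)
    qed
    have "norm ((f (x + s *\<^sub>R a + t *\<^sub>R c) - f (x + t *\<^sub>R c) - (s * t) *\<^sub>R A) -
        (f (x + s *\<^sub>R a + 0 *\<^sub>R c) - f (x + 0 *\<^sub>R c) - (s * 0) *\<^sub>R A)) \<le> (\<eta> * s) * norm (t - 0)"
    proof (rule differentiable_bound[of "{0..t}" "\<lambda>\<tau>. f (x + s *\<^sub>R a + \<tau> *\<^sub>R c) - f (x + \<tau> *\<^sub>R c) - (s * \<tau>) *\<^sub>R A"
         "\<lambda>\<tau> h. frechet_derivative f (at (x + s *\<^sub>R a + \<tau> *\<^sub>R c)) (h *\<^sub>R c) - frechet_derivative f (at (x + \<tau> *\<^sub>R c)) (h *\<^sub>R c) - (s * h) *\<^sub>R A"])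
      fix \<tau> assume \<tau>: "\<tau> \<in> {0..t}"
      have d1: "((\<lambda>\<tau>. f (w + \<tau> *\<^sub>R c)) has_derivative (\<lambda>h. frechet_derivative f (at (w + \<tau> *\<^sub>R c)) (h *\<^sub>R c))) (at \<tau> within {0..t})" for w
        by (rule has_derivative_compose[of "\<lambda>\<tau>. w + \<tau> *\<^sub>R c" "\<lambda>h. h *\<^sub>R c"])
           (auto intro!: derivative_eq_intros Cb_has_derivative[OF f])
      show "((\<lambda>\<tau>. f (x + s *\<^sub>R a + \<tau> *\<^sub>R c) - f (x + \<tau> *\<^sub>R c) - (s * \<tau>) *\<^sub>R A) has_derivative
         (\<lambda>h. frechet_derivative f (at (x + s *\<^sub>R a + \<tau> *\<^sub>R c)) (h *\<^sub>R c) - frechet_derivative f (at (x + \<tau> *\<^sub>R c)) (h *\<^sub>R c) - (s * h) *\<^sub>R A)) (at \<tau> within {0..t})"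
        by (intro has_derivative_diff d1 has_derivative_scaleR_left has_derivative_mult_right has_derivative_ident)
      show "onorm (\<lambda>h. frechet_derivative f (at (x + s *\<^sub>R a + \<tau> *\<^sub>R c)) (h *\<^sub>R c) - frechet_derivative f (at (x + \<tau> *\<^sub>R c)) (h *\<^sub>R c) - (s * h) *\<^sub>R A) \<le> \<eta> * s"
      proof (rule onorm_bound)
        fix h
        have "linear (frechet_derivative f (at z))" for z
          using Cb_has_derivative[OF f] has_derivative_bounded_linear bounded_linear.linear by blast
        then have "frechet_derivative f (at (x + s *\<^sub>R a + \<tau> *\<^sub>R c)) (h *\<^sub>R c) - frechet_derivative f (at (x + \<tau> *\<^sub>R c)) (h *\<^sub>R c) - (s * h) *\<^sub>R A =
           h *\<^sub>R (?F (x + s *\<^sub>R a + \<tau> *\<^sub>R c) - ?F (x + \<tau> *\<^sub>R c) - s *\<^sub>R A)"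
          by (simp add: linear_cmul scaleR_diff_right mult.commute)
        then show "norm (frechet_derivative f (at (x + s *\<^sub>R a + \<tau> *\<^sub>R c)) (h *\<^sub>R c) - frechet_derivative f (at (x + \<tau> *\<^sub>R c)) (h *\<^sub>R c) - (s * h) *\<^sub>R A) \<le> \<eta> * s * norm h"
          using mult_left_mono[OF inner[OF \<tau>], of "norm h"] by (simp add: mult.commute)
      qed (use \<eta> st in auto)
    qed (use st in auto)
    then show "norm (f (x + s *\<^sub>R a + t *\<^sub>R c) - f (x + s *\<^sub>R a) - f (x + t *\<^sub>R c) + f x - (s * t) *\<^sub>R A) \<le> \<eta> * s * t"
      using st by (simp add: algebra_simps)
  qed
qed

text \<open>Schwarz's theorem: for s = t the second difference does not change when a and c are
  exchanged, so both iterated derivatives lie within e/2 of its quotient by s^2.\<close>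

lemma Cb_second_derivative_symmetric:
  fixes f :: "'a::euclidean_space \<Rightarrow> 'b::real_normed_vector"
  assumes f: "Cb (Suc (Suc k)) f"
  shows "frechet_derivative (\<lambda>z. frechet_derivative f (at z) c) (at x) a =
         frechet_derivative (\<lambda>z. frechet_derivative f (at z) a) (at x) c" (is "?A = ?B")
proof -
  have "norm (?A - ?B) \<le> e" if e: "e > 0" for e
  proof -
    have e2: "0 < e / 2" using e by simp
    obtain d1 where d1: "0 < d1" "\<And>s t. 0 \<le> s \<Longrightarrow> s < d1 \<Longrightarrow> 0 \<le> t \<Longrightarrow> t < d1 \<Longrightarrow>
      norm (f (x + s *\<^sub>R a + t *\<^sub>R c) - f (x + s *\<^sub>R a) - f (x + t *\<^sub>R c) + f x - (s * t) *\<^sub>R ?A) \<le> e/2 * s * t"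
      by (rule Cb_iterated_derivative_increment[OF f e2, where c = c and x = x and a = a]) (rule that)
    obtain d2 where d2: "0 < d2" "\<And>s t. 0 \<le> s \<Longrightarrow> s < d2 \<Longrightarrow> 0 \<le> t \<Longrightarrow> t < d2 \<Longrightarrow>
      norm (f (x + s *\<^sub>R c + t *\<^sub>R a) - f (x + s *\<^sub>R c) - f (x + t *\<^sub>R a) + f x - (s * t) *\<^sub>R ?B) \<le> e/2 * s * t"
      by (rule Cb_iterated_derivative_increment[OF f e2, where c = a and x = x and a = c]) (rule that)
    define s where "s = min d1 d2 / 2"
    have s: "0 < s" "s < d1" "s < d2" using d1(1) d2(1) by (auto simp: s_def)
    let ?P = "f (x + s *\<^sub>R a + s *\<^sub>R c) - f (x + s *\<^sub>R a) - f (x + s *\<^sub>R c) + f x"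
    have "norm (?P - (s * s) *\<^sub>R ?A) \<le> e/2 * s * s" using d1(2)[of s s] s by simp
    moreover have "norm (?P - (s * s) *\<^sub>R ?B) \<le> e/2 * s * s"
      using d2(2)[of s s] s by (simp add: algebra_simps)
    ultimately have "norm ((?P - (s * s) *\<^sub>R ?B) - (?P - (s * s) *\<^sub>R ?A)) \<le> e/2 * s * s + e/2 * s * s"
      by (intro order_trans[OF norm_triangle_ineq4 add_mono])
    also have "(?P - (s * s) *\<^sub>R ?B) - (?P - (s * s) *\<^sub>R ?A) = (s * s) *\<^sub>R (?A - ?B)"
      by (simp add: scaleR_diff_right)
    finally have "(s * s) * norm (?A - ?B) \<le> (s * s) * e" using s by simp
    then show ?thesis using s by simp
  qed
  then have "norm (?A - ?B) \<le> 0" by (rule field_le_epsilon) simp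
  then show ?thesis by simp
qed

text \<open>Second-order Taylor expansion in Peano form. The derivative along h vanishes at x, hence
  equals s \<open>?A\<close> + o(s) at x + s h, and the mean value inequality integrates this to s^2
  \<open>?A\<close> / 2 + o(s^2). It is meant for the divergence, which is only known to be of class
  C^2 when the field is C^3, so that no cubic remainder bound is at hand.\<close>

lemma Cb_second_order_limit:
  fixes g :: "'a::euclidean_space \<Rightarrow> real"
  assumes g: "Cb (Suc (Suc k)) g" and crit: "\<And>w. frechet_derivative g (at x) w = 0"
  shows "(\<lambda>n. (real (Suc n))\<^sup>2 * (g (x + (1 / real (Suc n)) *\<^sub>R h) - g x)) \<longlonglongrightarrow>
    frechet_derivative (\<lambda>z. frechet_derivative g (at z) h) (at x) h / 2" (is "_ \<longlonglongrightarrow> ?A / 2")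
proof (rule LIMSEQ_I)
  fix r :: real assume r: "r > 0"
  let ?F = "\<lambda>z. frechet_derivative g (at z) h"
  have F: "Cb (Suc k) ?F" by (rule Cb_directional[OF g])
  have "((\<lambda>s. ?F (x + s *\<^sub>R h)) has_derivative (\<lambda>s. frechet_derivative ?F (at (x + 0 *\<^sub>R h)) (s *\<^sub>R h))) (at (0::real))"
    by (rule has_derivative_compose[of "\<lambda>s. x + s *\<^sub>R h" "\<lambda>s. s *\<^sub>R h"])
       (auto intro!: derivative_eq_intros Cb_has_derivative[OF F])
  moreover have "frechet_derivative ?F (at x) (s *\<^sub>R h) = ?A * s" for s
  proof -
    have "linear (frechet_derivative ?F (at x))"
      using Cb_has_derivative[OF F] has_derivative_bounded_linear bounded_linear.linear by blast
    then show ?thesis by (simp add: linear_cmul)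
  qed
  ultimately have "((\<lambda>s. ?F (x + s *\<^sub>R h)) has_field_derivative ?A) (at 0)"
    by (simp add: has_field_derivative_def)
  then have lim: "(\<lambda>s. (?F (x + s *\<^sub>R h) - ?F (x + 0 *\<^sub>R h)) / s) \<midarrow>0\<rightarrow> ?A" by (simp add: DERIV_def)
  have r2: "0 < r / 2" using r by simp
  obtain d where d0: "d > 0 \<and> (\<forall>s. s \<noteq> 0 \<and> norm (s - 0) < d \<longrightarrow> norm ((?F (x + s *\<^sub>R h) - ?F (x + 0 *\<^sub>R h)) / s - ?A) < r / 2)"
    using LIM_D[OF lim r2] by blast
  have d: "d > 0" "\<And>s. s \<noteq> 0 \<Longrightarrow> norm s < d \<Longrightarrow> norm ((?F (x + s *\<^sub>R h) - ?F (x + 0 *\<^sub>R h)) / s - ?A) < r / 2"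
    using d0 unfolding diff_zero by blast+
  have der: "\<bar>?F (x + s *\<^sub>R h) - s * ?A\<bar> \<le> r / 2 * s" if "0 \<le> s" "s < d" for s
  proof (cases "s = 0")
    case False
    then have "\<bar>?F (x + s *\<^sub>R h) / s - ?A\<bar> \<le> r / 2" using d(2)[of s] that crit by simp
    then have "s * \<bar>?F (x + s *\<^sub>R h) / s - ?A\<bar> \<le> s * (r / 2)" using that by (intro mult_left_mono) auto
    moreover have "s * \<bar>?F (x + s *\<^sub>R h) / s - ?A\<bar> = \<bar>?F (x + s *\<^sub>R h) - s * ?A\<bar>"
    proof -
      have "s * \<bar>?F (x + s *\<^sub>R h) / s - ?A\<bar> = \<bar>s * (?F (x + s *\<^sub>R h) / s - ?A)\<bar>"
        using that by (simp add: abs_mult)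
      then show ?thesis using False by (simp add: right_diff_distrib)
    qed
    ultimately show ?thesis by (simp add: mult.commute)
  qed (simp add: crit)
  have bound: "\<bar>g (x + s *\<^sub>R h) - g x - s\<^sup>2 * ?A / 2\<bar> \<le> r / 2 * s\<^sup>2" if s: "0 \<le> s" "s < d" for s
  proof -
    have "norm ((g (x + s *\<^sub>R h) - s\<^sup>2 * ?A / 2) - (g (x + 0 *\<^sub>R h) - 0\<^sup>2 * ?A / 2)) \<le> (r / 2 * s) * norm (s - 0)"
    proof (rule differentiable_bound[of "{0..s}" "\<lambda>s. g (x + s *\<^sub>R h) - s\<^sup>2 * ?A / 2" "\<lambda>s t. (?F (x + s *\<^sub>R h) - s * ?A) * t"])
      fix \<xi> assume \<xi>: "\<xi> \<in> {0..s}"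
      have "((\<lambda>s. g (x + s *\<^sub>R h)) has_derivative (\<lambda>t. frechet_derivative g (at (x + \<xi> *\<^sub>R h)) (t *\<^sub>R h))) (at \<xi> within {0..s})"
        by (rule has_derivative_compose[of "\<lambda>s. x + s *\<^sub>R h" "\<lambda>s. s *\<^sub>R h"])
           (auto intro!: derivative_eq_intros Cb_has_derivative[OF g])
      moreover have "linear (frechet_derivative g (at (x + \<xi> *\<^sub>R h)))"
        using Cb_has_derivative[OF g] has_derivative_bounded_linear bounded_linear.linear by blast
      ultimately have "((\<lambda>s. g (x + s *\<^sub>R h)) has_derivative (\<lambda>t. ?F (x + \<xi> *\<^sub>R h) * t)) (at \<xi> within {0..s})"
        by (simp add: linear_cmul mult.commute)
      moreover have "((\<lambda>s. s\<^sup>2 * ?A / 2) has_derivative (\<lambda>t. \<xi> * ?A * t)) (at \<xi> within {0..s})"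
        by (auto intro!: derivative_eq_intros)
      ultimately show "((\<lambda>s. g (x + s *\<^sub>R h) - s\<^sup>2 * ?A / 2) has_derivative (\<lambda>t. (?F (x + \<xi> *\<^sub>R h) - \<xi> * ?A) * t)) (at \<xi> within {0..s})"
        by (auto dest: has_derivative_diff simp: left_diff_distrib)
      show "onorm (\<lambda>t. (?F (x + \<xi> *\<^sub>R h) - \<xi> * ?A) * t) \<le> r / 2 * s"
      proof (rule onorm_bound)
        fix t
        have "\<bar>?F (x + \<xi> *\<^sub>R h) - \<xi> * ?A\<bar> \<le> r / 2 * s"
        proof -
          have "r / 2 * \<xi> \<le> r / 2 * s" using \<xi> r by (intro mult_left_mono) auto
          then show ?thesis using der[of \<xi>] \<xi> s by auto
        qed
        then show "norm ((?F (x + \<xi> *\<^sub>R h) - \<xi> * ?A) * t) \<le> r / 2 * s * norm t"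
          by (simp only: norm_mult real_norm_def abs_mult mult_right_mono abs_ge_zero)
      qed (use r s in auto)
    qed (use s in auto)
    then show ?thesis using s by (simp add: power2_eq_square algebra_simps)
  qed
  obtain n0 where n0: "1 / real (Suc n0) < d" using d(1) reals_Archimedean[of d] by (auto simp: inverse_eq_divide)
  have "norm ((real (Suc n))\<^sup>2 * (g (x + (1 / real (Suc n)) *\<^sub>R h) - g x) - ?A / 2) < r" if n: "n \<ge> n0" for n
  proof -
    let ?s = "1 / real (Suc n)"
    have "?s \<le> 1 / real (Suc n0)" using n by (simp add: frac_le)
    then have b: "\<bar>g (x + ?s *\<^sub>R h) - g x - ?s\<^sup>2 * ?A / 2\<bar> \<le> r / 2 * ?s\<^sup>2" using n0 by (intro bound) auto
    have e: "(real (Suc n))\<^sup>2 * ?s\<^sup>2 = 1" by (simp add: power_divide del: of_nat_Suc)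
    have "(real (Suc n))\<^sup>2 * \<bar>g (x + ?s *\<^sub>R h) - g x - ?s\<^sup>2 * ?A / 2\<bar> \<le> (real (Suc n))\<^sup>2 * (r / 2 * ?s\<^sup>2)"
      using b by (rule mult_left_mono) simp
    also have "\<dots> = r / 2" using e by (metis mult.left_commute mult.right_neutral)
    also have "(real (Suc n))\<^sup>2 * \<bar>g (x + ?s *\<^sub>R h) - g x - ?s\<^sup>2 * ?A / 2\<bar> =
       \<bar>(real (Suc n))\<^sup>2 * (g (x + ?s *\<^sub>R h) - g x - ?s\<^sup>2 * ?A / 2)\<bar>" by (simp add: abs_mult)
    also have "(real (Suc n))\<^sup>2 * (g (x + ?s *\<^sub>R h) - g x - ?s\<^sup>2 * ?A / 2) =
       (real (Suc n))\<^sup>2 * (g (x + ?s *\<^sub>R h) - g x) - ((real (Suc n))\<^sup>2 * ?s\<^sup>2) * (?A / 2)"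
      by (simp only: right_diff_distrib mult.assoc times_divide_eq_right)
    finally show ?thesis unfolding e using r by simp
  qed
  then show "\<exists>n0. \<forall>n\<ge>n0. norm ((real (Suc n))\<^sup>2 * (g (x + (1 / real (Suc n)) *\<^sub>R h) - g x) - ?A / 2) < r" by blast
qed

section \<open>Divergence, gradient and Hessian along the orbit\<close>

lemma Cb_jacobian_mult:
  fixes f :: "real^'n \<Rightarrow> real^'m"
  assumes "Cb (Suc k) f"
  shows "jacobian f (at x) *v w = frechet_derivative f (at x) w"
proof -
  have "f differentiable at x" using assms by simp
  then have "(f has_derivative (\<lambda>h. jacobian f (at x) *v h)) (at x)" by (simp add: jacobian_works)
  then have "(\<lambda>h. jacobian f (at x) *v h) = frechet_derivative f (at x)" by (rule frechet_derivative_at)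
  then show ?thesis by (rule fun_cong)
qed

lemma Cb_divergence:
  fixes b :: "real^'n \<Rightarrow> real^'n"
  assumes b: "Cb (Suc k) b"
  shows "Cb k (divergence b)"
proof -
  have "jacobian b (at x) $ i $ i = frechet_derivative b (at x) (axis i 1) $ i" for x i
    using arg_cong[where f = "\<lambda>v. v $ i", OF Cb_jacobian_mult[OF b, of x "axis i 1"]]
    by (simp add: matrix_vector_mult_basis column_def)
  then have "divergence b = (\<lambda>x. \<Sum>i\<in>UNIV. frechet_derivative b (at x) (axis i 1) $ i)"
    by (simp add: divergence_def[abs_def] trace_def)
  moreover have "Cb k (\<lambda>x. \<Sum>i\<in>UNIV. frechet_derivative b (at x) (axis i 1) $ i)"
    by (intro Cb_sum Cb_bounded_linear[OF bounded_linear_vec_nth] Cb_directional[OF b]) simp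
  ultimately show ?thesis by simp
qed

lemma inner_gradient:
  fixes g :: "real^'n \<Rightarrow> real"
  assumes g: "Cb (Suc k) g"
  shows "w \<bullet> gradient g x = frechet_derivative g (at x) w"
proof -
  have l: "linear (frechet_derivative g (at x))"
    using Cb_has_derivative[OF g] has_derivative_bounded_linear bounded_linear.linear by blast
  have "frechet_derivative g (at x) w = frechet_derivative g (at x) (\<Sum>i\<in>UNIV. (w $ i) *\<^sub>R axis i 1)"
    using basis_expansion[of w] by (simp add: scalar_mult_eq_scaleR)
  also have "\<dots> = (\<Sum>i\<in>UNIV. w $ i * frechet_derivative g (at x) (axis i 1))"
    using l by (simp add: linear_sum linear_cmul)
  finally show ?thesis by (simp add: inner_vec_def gradient_def)
qed

lemma gradient_has_derivative:
  fixes g :: "real^'n \<Rightarrow> real"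
  assumes g: "Cb (Suc (Suc k)) g"
  shows "(gradient g has_derivative (\<lambda>v. hessian g x *v v)) (at x)"
proof -
  have e: "gradient g = (\<lambda>x. \<Sum>i\<in>UNIV. frechet_derivative g (at x) (axis i 1) *\<^sub>R axis i 1)"
    using basis_expansion[of "gradient g _"] by (auto simp: gradient_def[abs_def] scalar_mult_eq_scaleR fun_eq_iff)
  have "(\<lambda>x. frechet_derivative g (at x) (axis i 1)) differentiable at x" for i
    using Cb_directional[OF g, of "axis i 1"] by simp
  then have "gradient g differentiable at x"
    unfolding e by (intro differentiable_sum differentiable_scaleR differentiable_const ballI) auto
  then show ?thesis unfolding hessian_def by (simp add: jacobian_works)
qed

text \<open>Identifies the bilinear form of the Hessian with an iterated directional derivative, the
  shape in which symmetry and the second-order limit are proved.\<close>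

lemma inner_hessian:
  fixes g :: "real^'n \<Rightarrow> real"
  assumes g: "Cb (Suc (Suc k)) g"
  shows "w \<bullet> (hessian g x *v v) = frechet_derivative (\<lambda>z. frechet_derivative g (at z) w) (at x) v"
proof -
  have "((\<lambda>z. w \<bullet> gradient g z) has_derivative (\<lambda>v. w \<bullet> (hessian g x *v v))) (at x)"
    by (intro has_derivative_inner_right gradient_has_derivative[OF g])
  then have "((\<lambda>z. frechet_derivative g (at z) w) has_derivative (\<lambda>v. w \<bullet> (hessian g x *v v))) (at x)"
    unfolding inner_gradient[OF g] .
  from frechet_derivative_at[OF this] show ?thesis by (rule fun_cong)
qed

lemma hessian_symmetric:
  fixes g :: "real^'n \<Rightarrow> real"
  assumes g: "Cb (Suc (Suc k)) g"
  shows "w \<bullet> (hessian g x *v v) = v \<bullet> (hessian g x *v w)"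
  unfolding inner_hessian[OF g] by (rule Cb_second_derivative_symmetric[OF g])

text \<open>Differentiation of the identity \<open>gradient g (X t) = 0\<close> along the
  path.\<close>

lemma hessian_mult_velocity:
  fixes g :: "real^'n \<Rightarrow> real"
  assumes g: "Cb (Suc (Suc k)) g" and z: "\<And>t. 0 \<le> t \<Longrightarrow> gradient g (X t) = 0"
    and X: "(X has_vector_derivative X') (at t within {0..})" and t: "0 \<le> t"
  shows "hessian g (X t) *v X' = 0"
proof -
  have "((\<lambda>t. gradient g (X t)) has_vector_derivative hessian g (X t) *v X') (at t within {0..})"
  proof -
    have "((\<lambda>t. gradient g (X t)) has_derivative (\<lambda>s. hessian g (X t) *v (s *\<^sub>R X'))) (at t within {0..})"
      using X unfolding has_vector_derivative_def
      by (rule has_derivative_compose[OF _ gradient_has_derivative[OF g]])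
    then show ?thesis by (simp add: has_vector_derivative_def matrix_vector_mult_scaleR)
  qed
  then have "((\<lambda>t. 0) has_vector_derivative hessian g (X t) *v X') (at t within {0..})"
    by (rule has_vector_derivative_transform[rotated 2]) (use z t in auto)
  moreover have "((\<lambda>t. 0) has_vector_derivative 0) (at t within {0..})" by simp
  \<comment> \<open>Derivatives within the half-line are unique because t is a limit point from the
    right, also at t = 0.\<close>
  moreover have "at t within {0..} \<noteq> bot"
  proof -
    have "at_right t \<le> at t within {0..}" by (rule at_le) (use t in auto)
    then show ?thesis using trivial_limit_at_right_real[of t] by (metis le_bot)
  qed
  ultimately show ?thesis by (metis vector_derivative_unique_within)
qed

text \<open>Representatives differ by multiples of X' = b(X), which the Hessian annihilates; its
  symmetry removes the cross terms as well. Hence the image of the class under \<open>V_form\<close>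
  is a singleton and \<open>the_elem\<close> is meaningful.\<close>

lemma V_eff_eq_V_form:
  fixes b :: "real^'n \<Rightarrow> real^'n"
  assumes b: "Cb 3 b" and T: "0 < T"
    and X: "\<And>t. 0 \<le> t \<Longrightarrow> (X has_vector_derivative b (X t)) (at t within {0..})"
    and z: "\<And>t. t \<ge> 0 \<Longrightarrow> gradient (divergence b) (X t) = 0"
    and \<omega>: "\<omega> \<in> H1_per T"
  shows "V_eff b T X (mod_velocity T X `` {\<omega>}) = V_form b T X \<omega>"
proof -
  have g: "Cb (Suc (Suc 0)) (divergence b)"
    using b by (intro Cb_divergence) (simp add: numeral_3_eq_3)
  let ?H = "\<lambda>s. hessian (divergence b) (X s)"
  have XT: "vector_derivative X (at s within {0..T}) = b (X s)" if s: "s \<in> {0..T}" for s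
  proof -
    have "(X has_vector_derivative b (X s)) (at s within {0..T})"
      by (rule has_vector_derivative_within_subset[OF X]) (use s in auto)
    then show ?thesis using vector_derivative_within_cbox[of 0 T s X "b (X s)"] T s unfolding box_real by blast
  qed
  have eq: "V_form b T X \<eta> = V_form b T X \<omega>" if \<eta>: "\<eta> \<in> mod_velocity T X `` {\<omega>}" for \<eta>
  proof -
    obtain c where "\<forall>s\<in>{0..T}. \<eta> s = \<omega> s + c *\<^sub>R vector_derivative X (at s within {0..T})"
      using \<eta> unfolding mod_velocity_def by blast
    then have c: "\<eta> s = \<omega> s + c *\<^sub>R b (X s)" if "s \<in> {0..T}" for s using XT that by simp
    have "\<eta> s \<bullet> (?H s *v \<eta> s) = \<omega> s \<bullet> (?H s *v \<omega> s)" if s: "s \<in> {0..T}" for s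
    proof -
      have 0: "?H s *v b (X s) = 0"
        using s by (intro hessian_mult_velocity[OF g z X]) auto
      have "b (X s) \<bullet> (?H s *v \<omega> s) = 0"
        using hessian_symmetric[OF g, of "b (X s)" "X s" "\<omega> s"] 0 by simp
      then show ?thesis using 0
        by (simp add: c[OF s] matrix_vector_right_distrib matrix_vector_mult_scaleR inner_add_left)
    qed
    then show ?thesis unfolding V_form_def
      by (intro arg_cong[where f = uminus] Bochner_Integration.integral_cong) (auto simp: space_restrict_space)
  qed
  have "(\<omega>, \<omega>) \<in> mod_velocity T X"
    unfolding mod_velocity_def mem_Collect_eq prod.case by (intro conjI \<omega> exI[of _ 0] ballI) simp
  then have "\<omega> \<in> mod_velocity T X `` {\<omega>}" by (simp only: Image_singleton_iff)
  then have "{V_form b T X \<omega>} \<subseteq> V_form b T X ` (mod_velocity T X `` {\<omega>})" by (simp only: insert_subset imageI empty_subsetI simp_thms)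
  moreover have "V_form b T X ` (mod_velocity T X `` {\<omega>}) \<subseteq> {V_form b T X \<omega>}" using eq by (simp only: image_subset_iff singleton_iff ball_simps) blast
  ultimately have "V_form b T X ` (mod_velocity T X `` {\<omega>}) = {V_form b T X \<omega>}" by (rule equalityI[rotated])
  then show ?thesis by (simp add: V_eff_def)
qed

lemma continuous_on_frechet_derivative:
  fixes f :: "'a::euclidean_space \<Rightarrow> 'b::real_normed_vector"
  assumes f: "Cb (Suc k) f" and X: "continuous_on S X" and w: "continuous_on S w"
  shows "continuous_on S (\<lambda>t. frechet_derivative f (at (X t)) (w t))"
proof -
  have "continuous_on S (\<lambda>t. \<Sum>e\<in>Basis. (w t \<bullet> e) *\<^sub>R frechet_derivative f (at (X t)) e)"
    by (intro continuous_intros w continuous_on_compose2[OF Cb_directional_continuous[OF f] X]) auto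
  moreover have "frechet_derivative f (at (X t)) (w t) = (\<Sum>e\<in>Basis. (w t \<bullet> e) *\<^sub>R frechet_derivative f (at (X t)) e)" for t
    using f by (intro frechet_derivative_Basis_expansion) simp
  ultimately show ?thesis by simp
qed

lemma continuous_on_matrix_vector_mult:
  fixes \<sigma> :: "'t::topological_space \<Rightarrow> real^'n^'m"
  assumes "continuous_on S \<sigma>" "continuous_on S w"
  shows "continuous_on S (\<lambda>t. \<sigma> t *v w t)"
  using bounded_bilinear.continuous_on[OF _ assms] bilinear_matrix_vector_mult
  unfolding bilinear_conv_bounded_bilinear by blast

text \<open>Regularity bootstrap: as an indefinite integral \<omega> is continuous, so the
  right-hand side is continuous, and the integral of a continuous function is C^1. The weak equation
  thus holds pointwise, at the endpoints with one-sided derivatives.\<close>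

lemma linearization_eq_imp_ode:
  fixes b :: "real^'n \<Rightarrow> real^'n"
  assumes b: "Cb (Suc k) b" and T: "0 < T"
    and X: "continuous_on {0..T} X" and \<sigma>: "continuous_on {0..T} \<sigma>"
    and eq: "linearization_eq b T X \<omega> (\<lambda>s. \<sigma> s *v q)" and t: "t \<in> {0..T}"
  shows "(\<omega> has_vector_derivative frechet_derivative b (at (X t)) (\<omega> t) + \<sigma> t *v q) (at t within {0..T})"
proof -
  obtain g where g: "has_L2_derivative \<omega> g T"
    "AE s in lebesgue_on {0..T}. g s - jacobian b (at (X s)) *v \<omega> s = \<sigma> s *v q"
    using eq by (auto simp: linearization_eq_def)
  let ?F = "\<lambda>s. frechet_derivative b (at (X s)) (\<omega> s) + \<sigma> s *v q"
  have gm: "g \<in> borel_measurable (lebesgue_on {0..T})" and g2: "integrable (lebesgue_on {0..T}) (\<lambda>t. (norm (g t))\<^sup>2)"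
    and \<omega>g: "\<And>t. t \<in> {0..T} \<Longrightarrow> \<omega> t = \<omega> 0 + (LINT s|lebesgue_on {0..t}. g s)"
    using g(1) unfolding has_L2_derivative_def L2_def by blast+
  have gi: "integrable (lebesgue_on {0..T}) g"
  proof (rule Bochner_Integration.integrable_bound[OF _ gm])
    have "integrable (lebesgue_on {0..T}) (\<lambda>t. 1::real)" by (intro continuous_imp_integrable_real continuous_intros)
    then show "integrable (lebesgue_on {0..T}) (\<lambda>t. 1 + (norm (g t))\<^sup>2)" using g2 by (rule Bochner_Integration.integrable_add)
    have sq: "x \<le> 1 + x\<^sup>2" for x :: real
    proof -
      have "0 \<le> x\<^sup>2 - 2 * x + 1" using zero_le_power2[of "x - 1"] by (simp add: power2_diff)
      moreover have "0 \<le> x\<^sup>2" by simp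
      ultimately show ?thesis by linarith
    qed
    show "AE t in lebesgue_on {0..T}. norm (g t) \<le> norm (1 + (norm (g t))\<^sup>2)"
      unfolding real_norm_def by (intro AE_I2 order_trans[OF sq abs_ge_self])
  qed
  have "continuous_on {0..T} (\<lambda>t. \<omega> 0 + (LINT s|lebesgue_on {0..t}. g s))"
    by (intro continuous_intros indefinite_integral_continuous_real gi)
  from continuous_on_eq[OF this \<omega>g[symmetric]] have \<omega>c: "continuous_on {0..T} \<omega>" .
  have Fc: "continuous_on {0..T} ?F"
    by (intro continuous_on_add continuous_on_frechet_derivative[OF b X \<omega>c] continuous_on_matrix_vector_mult \<sigma> continuous_on_const)
  have gF: "AE s in lebesgue_on {0..T}. g s = ?F s"
    using g(2) by eventually_elim (simp add: Cb_jacobian_mult[OF b] algebra_simps)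
  have \<omega>F: "\<omega> s = \<omega> 0 + integral {0..s} ?F" if s: "s \<in> {0..T}" for s
  proof -
    have Fs: "integrable (lebesgue_on {0..s}) ?F"
      by (rule continuous_imp_integrable_real[OF continuous_on_subset[OF Fc]]) (use s in auto)
    have "integrable (lebesgue_on {0..s}) g" by (rule integrable_subinterval[OF gi]) (use s in auto)
    moreover have "AE r in lebesgue_on {0..s}. g r = ?F r"
    proof -
      have "AE r in lebesgue. r \<in> {0..T} \<longrightarrow> g r = ?F r" using gF by (subst (asm) AE_restrict_space_iff) auto
      then have "AE r in lebesgue. r \<in> {0..s} \<longrightarrow> g r = ?F r" by eventually_elim (use s in auto)
      then show ?thesis by (subst AE_restrict_space_iff) auto
    qed
    ultimately have "(LINT r|lebesgue_on {0..s}. g r) = (LINT r|lebesgue_on {0..s}. ?F r)"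
      using Fs by (intro integral_cong_AE borel_measurable_integrable)
    then show ?thesis using \<omega>g[OF s] lebesgue_integral_eq_integral[OF Fs] by simp
  qed
  have "((\<lambda>s. \<omega> 0 + integral {0..s} ?F) has_vector_derivative (0 + ?F t)) (at t within {0..T})"
    by (intro has_vector_derivative_add has_vector_derivative_const integral_has_vector_derivative Fc t)
  then show ?thesis
    unfolding add_0_left by (rule has_vector_derivative_transform[OF t \<omega>F, rotated])
qed

section \<open>Periodic extension\<close>

definition per_ext :: "real \<Rightarrow> (real \<Rightarrow> 'a) \<Rightarrow> real \<Rightarrow> 'a" where
  "per_ext T f t = f (t - T * of_int \<lfloor>t / T\<rfloor>)"

lemma per_ext_eq:
  assumes T: "0 < T" and t: "0 \<le> t - T * real k" "t - T * real k < T"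
  shows "per_ext T f t = f (t - T * real k)"
proof -
  have "\<lfloor>t / T\<rfloor> = int k"
    using T t by (intro floor_unique) (auto simp: field_simps)
  then show ?thesis by (simp add: per_ext_def)
qed

lemma per_ext_plus:
  assumes T: "0 < T" shows "per_ext T f (t + T) = per_ext T f t"
proof -
  have "(t + T) / T = t / T + 1" using T by (simp add: field_simps)
  then have "\<lfloor>(t + T) / T\<rfloor> = \<lfloor>t / T\<rfloor> + 1" by simp
  then show ?thesis by (simp add: per_ext_def algebra_simps)
qed

lemma has_vector_derivative_within_Un:
  assumes "(f has_vector_derivative d) (at x within S)" "(f has_vector_derivative d) (at x within U)"
  shows "(f has_vector_derivative d) (at x within S \<union> U)"
  using assms unfolding has_vector_derivative_def has_derivative_within
  by (simp add: at_within_union filterlim_sup)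

text \<open>Only multiples of T need care: there the adjacent pieces have the one-sided derivatives
  \<open>f' T\<close> and \<open>f' 0\<close>, which assumption \<open>p\<close> equates.\<close>

lemma per_ext_has_vector_derivative:
  fixes f :: "real \<Rightarrow> 'a::real_normed_vector"
  assumes T: "0 < T"
    and d: "\<And>t. t \<in> {0..T} \<Longrightarrow> (f has_vector_derivative f' t) (at t within {0..T})"
    and p: "f T = f 0" "f' T = f' 0" and t: "0 \<le> t"
  shows "(per_ext T f has_vector_derivative per_ext T f' t) (at t within {0..})"
proof -
  have piece: "(per_ext T f has_vector_derivative f' (s - T * real k)) (at s within {T * real k..T * real k + T})"
    if s: "s \<in> {T * real k..T * real k + T}" for s k
  proof -
    have e: "per_ext T f r = f (r - T * real k)" if r: "r \<in> {T * real k..T * real k + T}" for r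
    proof (cases "r = T * real k + T")
      case True
      have "per_ext T f r = f (r - T * real (Suc k))" using T True by (intro per_ext_eq) (auto simp: algebra_simps)
      then show ?thesis using True p by (simp add: algebra_simps)
    next
      case False then show ?thesis using T r by (intro per_ext_eq) auto
    qed
    have im: "(\<lambda>r. r - T * real k) ` {T * real k..T * real k + T} = {0..T}"
      by (auto simp: image_iff intro!: bexI[of _ "_ + T * real k"])
    have "((\<lambda>r. r - T * real k) has_vector_derivative 1) (at s within {T * real k..T * real k + T})"
      by (rule has_vector_derivative_eq_rhs[OF has_vector_derivative_diff[OF has_vector_derivative_id has_vector_derivative_const]]) simp
    then have "((\<lambda>r. f (r - T * real k)) has_vector_derivative (1 *\<^sub>R f' (s - T * real k))) (at s within {T * real k..T * real k + T})"
      using vector_diff_chain_within[of "\<lambda>r. r - T * real k" 1 s "{T * real k..T * real k + T}" f "f' (s - T * real k)"]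
        d[of "s - T * real k"] s unfolding im
      by (auto simp: o_def)
    then show ?thesis
      using e s by (intro has_vector_derivative_transform[of s _ "per_ext T f" "\<lambda>r. f (r - T * real k)"]) auto
  qed
  define k where "k = nat \<lfloor>t / T\<rfloor>"
  have k: "0 \<le> t - T * real k" "t - T * real k < T"
  proof -
    have "0 \<le> t / T" using t T by simp
    then have "real k = of_int \<lfloor>t / T\<rfloor>" by (simp add: k_def)
    then have "real k \<le> t / T" "t / T < real k + 1" by linarith+
    then show "0 \<le> t - T * real k" "t - T * real k < T" using T by (auto simp: field_simps)
  qed
  have pk: "per_ext T f' t = f' (t - T * real k)" by (rule per_ext_eq[OF T k])
  have right: "(per_ext T f has_vector_derivative per_ext T f' t) (at t within {T * real k..T * real k + T})"
    unfolding pk using k by (intro piece) auto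
  \<comment> \<open>Either t has a neighbourhood in the half-line lying within a single period,
    which includes t = 0, or it is a junction and two periods are glued.\<close>
  show ?thesis
  proof (cases "k = 0 \<or> t \<noteq> T * real k")
    case True
    have "at t within {0..} = at t within {T * real k..T * real k + T}"
    proof (rule at_within_nhd[of t "if k = 0 then {..<T} else {T * real k<..<T * real k + T}"])
      define c where "c = T * real k"
      have "0 \<le> c" "k = 0 \<Longrightarrow> c = 0" using T by (simp_all add: c_def)
      then show "{0..} \<inter> (if k = 0 then {..<T} else {T * real k<..<T * real k + T}) - {t} =
        {T * real k..T * real k + T} \<inter> (if k = 0 then {..<T} else {T * real k<..<T * real k + T}) - {t}"
        unfolding c_def[symmetric] by auto
    qed (use k True t in auto)
    then show ?thesis using right by simp
  next
    case False
    then obtain j where j: "k = Suc j" and tk: "t = T * real k" by (cases k) auto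
    have "(per_ext T f has_vector_derivative f' (t - T * real j)) (at t within {T * real j..T * real j + T})"
      using tk j T by (intro piece) (auto simp: algebra_simps)
    moreover have "f' (t - T * real j) = per_ext T f' t" unfolding pk using tk j p by (simp add: algebra_simps)
    ultimately have "(per_ext T f has_vector_derivative per_ext T f' t) (at t within {T * real j..T * real j + T} \<union> {T * real k..T * real k + T})"
      using right by (intro has_vector_derivative_within_Un) auto
    moreover have "at t within {0..} = at t within ({T * real j..T * real j + T} \<union> {T * real k..T * real k + T})"
    proof (rule at_within_nhd[of t "{T * real j<..<T * real k + T}"])
      define c where "c = T * real j"
      have "0 \<le> c" "T * real k = c + T" using T j by (auto simp: algebra_simps c_def)
      then show "{0..} \<inter> {T * real j<..<T * real k + T} - {t} =
        ({T * real j..T * real j + T} \<union> {T * real k..T * real k + T}) \<inter> {T * real j<..<T * real k + T} - {t}"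
        unfolding c_def[symmetric] by auto
    qed (use tk j T in \<open>auto simp: algebra_simps\<close>)
    ultimately show ?thesis by simp
  qed
qed

lemma periodic_eq_per_ext:
  assumes T: "0 < T" and p: "\<And>t. 0 \<le> t \<Longrightarrow> f (t + T) = f t" and t: "0 \<le> t"
  shows "per_ext T f t = f t"
proof -
  define k where "k = nat \<lfloor>t / T\<rfloor>"
  have "0 \<le> t / T" using t T by simp
  then have rk: "real k = of_int \<lfloor>t / T\<rfloor>" by (simp add: k_def)
  have "f (s + T * real j) = f s" if "0 \<le> s" for s j
  proof (induction j)
    case (Suc j)
    have "f (s + T * real (Suc j)) = f ((s + T * real j) + T)" by (simp add: algebra_simps)
    also have "\<dots> = f (s + T * real j)" using that T by (intro p) simp
    finally show ?case using Suc by simp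
  qed simp
  moreover have "0 \<le> t - T * real k" unfolding rk using T by (metis diff_ge_0_iff_ge mult.commute of_int_floor_le pos_le_divide_eq)
  ultimately have "f ((t - T * real k) + T * real k) = f (t - T * real k)" by blast
  then show ?thesis by (simp add: per_ext_def rk)
qed

lemma per_ext_bounded:
  fixes f :: "real \<Rightarrow> 'a::real_normed_vector"
  assumes T: "0 < T" and f: "continuous_on {0..T} f"
  obtains B where "0 \<le> B" "\<And>t. norm (per_ext T f t) \<le> B"
proof -
  obtain B where B: "\<And>t. t \<in> {0..T} \<Longrightarrow> norm (f t) \<le> B"
    using compact_imp_bounded[OF compact_continuous_image[OF f compact_Icc]] unfolding bounded_iff by blast
  have "0 \<le> t - T * of_int \<lfloor>t / T\<rfloor>" "t - T * of_int \<lfloor>t / T\<rfloor> \<le> T" for t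
  proof -
    have "of_int \<lfloor>t / T\<rfloor> \<le> t / T" "t / T \<le> of_int \<lfloor>t / T\<rfloor> + 1" by linarith+
    then have "of_int \<lfloor>t / T\<rfloor> * T \<le> t" "t \<le> (of_int \<lfloor>t / T\<rfloor> + 1) * T"
      using T by (simp_all only: pos_le_divide_eq pos_divide_le_eq)
    then show "0 \<le> t - T * of_int \<lfloor>t / T\<rfloor>" "t - T * of_int \<lfloor>t / T\<rfloor> \<le> T" by (simp_all add: algebra_simps)
  qed
  then have "norm (per_ext T f t) \<le> B" for t unfolding per_ext_def by (intro B) auto
  moreover have "0 \<le> B" using B[of 0] T by (smt (verit) atLeastAtMost_iff norm_ge_zero)
  ultimately show thesis by (rule that[rotated])
qed

section \<open>The energy of a secularly growing perturbation\<close>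

lemma Cb_comp_has_vector_derivative:
  fixes f :: "'a::euclidean_space \<Rightarrow> 'b::real_normed_vector"
  assumes f: "Cb (Suc k) f" and X: "(X has_vector_derivative X') (at t within S)"
  shows "((\<lambda>t. f (X t)) has_vector_derivative frechet_derivative f (at (X t)) X') (at t within S)"
proof -
  have l: "linear (frechet_derivative f (at (X t)))"
    using Cb_has_derivative[OF f] has_derivative_bounded_linear bounded_linear.linear by blast
  have "((\<lambda>t. f (X t)) has_derivative (\<lambda>s. frechet_derivative f (at (X t)) (s *\<^sub>R X'))) (at t within S)"
    using X unfolding has_vector_derivative_def by (rule has_derivative_compose[OF _ Cb_has_derivative[OF f]])
  then show ?thesis by (simp add: has_vector_derivative_def linear_cmul[OF l])
qed

text \<open>Product rule, with the second derivative rearranged by symmetry so that the velocity of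
  the base point becomes the fixed inner direction and \<open>h t\<close> the outer one. That is the
  shape of the Taylor term in \<open>Cb3_bounds\<close>.\<close>

lemma Cb_derivative_apply_has_vector_derivative:
  fixes f :: "'a::euclidean_space \<Rightarrow> 'b::real_normed_vector"
  assumes f: "Cb (Suc (Suc k)) f" and X: "(X has_vector_derivative X') (at t within S)"
    and h: "(h has_vector_derivative h') (at t within S)"
  shows "((\<lambda>t. frechet_derivative f (at (X t)) (h t)) has_vector_derivative
    (frechet_derivative f (at (X t)) h' + frechet_derivative (\<lambda>z. frechet_derivative f (at z) X') (at (X t)) (h t))) (at t within S)"
proof -
  let ?D = "\<lambda>x. frechet_derivative f (at x)"
  have e: "?D x v = (\<Sum>e\<in>Basis. (v \<bullet> e) *\<^sub>R ?D x e)" for x v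
    using f by (intro frechet_derivative_Basis_expansion) simp
  have F: "Cb (Suc k) (\<lambda>z. ?D z v)" for v by (rule Cb_directional[OF f])
  have "((\<lambda>t. h t \<bullet> e) has_real_derivative (h' \<bullet> e)) (at t within S)" for e
    using h unfolding has_real_derivative_iff_has_vector_derivative
    by (rule bounded_linear.has_vector_derivative[OF bounded_linear_inner_left])
  then have "((\<lambda>t. \<Sum>e\<in>Basis. (h t \<bullet> e) *\<^sub>R ?D (X t) e) has_vector_derivative
     (\<Sum>e\<in>Basis. (h t \<bullet> e) *\<^sub>R frechet_derivative (\<lambda>z. ?D z e) (at (X t)) X' + (h' \<bullet> e) *\<^sub>R ?D (X t) e)) (at t within S)"
    by (intro has_vector_derivative_sum has_vector_derivative_scaleR Cb_comp_has_vector_derivative[OF F X])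
  moreover have "(\<Sum>e\<in>Basis. (h t \<bullet> e) *\<^sub>R frechet_derivative (\<lambda>z. ?D z e) (at (X t)) X' + (h' \<bullet> e) *\<^sub>R ?D (X t) e) =
     ?D (X t) h' + frechet_derivative (\<lambda>z. ?D z X') (at (X t)) (h t)"
  proof -
    have "frechet_derivative (\<lambda>z. ?D z X') (at (X t)) (h t) =
        (\<Sum>e\<in>Basis. (h t \<bullet> e) *\<^sub>R frechet_derivative (\<lambda>z. ?D z X') (at (X t)) e)"
      using F by (intro frechet_derivative_Basis_expansion) simp
    also have "\<dots> = (\<Sum>e\<in>Basis. (h t \<bullet> e) *\<^sub>R frechet_derivative (\<lambda>z. ?D z e) (at (X t)) X')"
      by (simp only: Cb_second_derivative_symmetric[OF f, where c = X'])
    finally show ?thesis by (simp add: sum.distrib e[symmetric] add.commute)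
  qed
  ultimately show ?thesis by (simp only: e[symmetric])
qed

text \<open>The last estimate is the one that consumes three derivatives. It must be linear in w:
  symmetry moves w to the outer slot, where it is expanded in the basis, and Taylor's estimate is
  then applied to each partial derivative.\<close>

lemma Cb3_bounds:
  fixes f :: "'a::euclidean_space \<Rightarrow> 'b::real_normed_vector"
  assumes f: "Cb (Suc (Suc (Suc k))) f"
  obtains C where "0 \<le> C"
    "\<And>x v. norm (f (x + v) - f x) \<le> C * norm v"
    "\<And>x v. norm (f (x + v) - f x - frechet_derivative f (at x) v) \<le> C * (norm v)\<^sup>2"
    "\<And>x w. norm (frechet_derivative f (at x) w) \<le> C * norm w"
    "\<And>x v w. norm (frechet_derivative f (at (x + v)) w - frechet_derivative f (at x) w) \<le> C * norm v * norm w"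
    "\<And>x v w. norm (frechet_derivative f (at (x + v)) w - frechet_derivative f (at x) w -
        frechet_derivative (\<lambda>z. frechet_derivative f (at z) w) (at x) v) \<le> C * norm w * (norm v)\<^sup>2"
proof -
  let ?D = "\<lambda>x. frechet_derivative f (at x)"
  let ?R = "\<lambda>x v w. ?D (x + v) w - ?D x w - frechet_derivative (\<lambda>z. ?D z w) (at x) v"
  note f2 = Cb_Suc_imp[OF f] and f1 = Cb_Suc_imp[OF Cb_Suc_imp[OF f]]
  obtain C1 where C1: "0 \<le> C1" "\<And>x v. norm (f (x + v) - f x) \<le> C1 * norm v"
    using Cb_Lipschitz[OF f1] by blast
  obtain C2 where C2: "0 \<le> C2" "\<And>x w v. norm (?D (x + v) w - ?D x w) \<le> C2 * norm v * norm w"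
    "\<And>x v. norm (f (x + v) - f x - ?D x v) \<le> C2 * (norm v)\<^sup>2"
    using Cb_Taylor[OF f2] by blast
  obtain C3 where C3: "0 \<le> C3" "\<And>x w. norm (?D x w) \<le> C3 * norm w"
    using Cb_derivative_bound[OF f1] by blast
  have F: "Cb (Suc (Suc k)) (\<lambda>z. ?D z v)" for v by (rule Cb_directional[OF f])
  have "\<exists>c\<ge>0. \<forall>x v. norm (?R x v e) \<le> c * (norm v)\<^sup>2" for e
    using Cb_Taylor[OF F[of e]] by metis
  then obtain c where c: "\<And>e. 0 \<le> c e" "\<And>e x v. norm (?R x v e) \<le> c e * (norm v)\<^sup>2" by metis
  define C4 where "C4 = (\<Sum>e\<in>Basis. c e)"
  have C40: "0 \<le> C4" unfolding C4_def using c(1) by (rule sum_nonneg)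
  have C4: "norm (?R x v w) \<le> C4 * norm w * (norm v)\<^sup>2" for x v w
  proof -
    have e: "?D y w = (\<Sum>e\<in>Basis. (w \<bullet> e) *\<^sub>R ?D y e)" for y
      using f by (intro frechet_derivative_Basis_expansion) simp
    have "frechet_derivative (\<lambda>z. ?D z w) (at x) v = frechet_derivative (\<lambda>z. ?D z v) (at x) w"
      by (rule Cb_second_derivative_symmetric[OF f2])
    also have "\<dots> = (\<Sum>e\<in>Basis. (w \<bullet> e) *\<^sub>R frechet_derivative (\<lambda>z. ?D z v) (at x) e)"
      using F by (intro frechet_derivative_Basis_expansion) simp
    also have "\<dots> = (\<Sum>e\<in>Basis. (w \<bullet> e) *\<^sub>R frechet_derivative (\<lambda>z. ?D z e) (at x) v)"
      by (simp only: Cb_second_derivative_symmetric[OF f2, where c = v])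
    finally have "?R x v w = (\<Sum>e\<in>Basis. (w \<bullet> e) *\<^sub>R ?R x v e)"
      by (simp add: e[of x] e[of "x + v"] scaleR_diff_right sum_subtractf)
    also have "norm \<dots> \<le> (\<Sum>e\<in>Basis. norm w * (c e * (norm v)\<^sup>2))"
      by (rule order_trans[OF norm_sum], rule sum_mono, unfold norm_scaleR, intro mult_mono) (auto intro: Basis_le_norm c)
    also have "\<dots> = C4 * norm w * (norm v)\<^sup>2" by (simp add: C4_def sum_distrib_left sum_distrib_right mult_ac)
    finally show ?thesis .
  qed
  define C where "C = C1 + C2 + C3 + C4"
  have le: "C1 \<le> C" "C2 \<le> C" "C3 \<le> C" "C4 \<le> C" using C1 C2 C3 C40 by (auto simp: C_def)
  show thesis
  proof (rule that[of C])
    show "0 \<le> C" using C1 le by simp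
    show "norm (f (x + v) - f x) \<le> C * norm v" for x v
      by (rule order_trans[OF C1(2) mult_right_mono[OF le(1)]]) simp
    show "norm (f (x + v) - f x - ?D x v) \<le> C * (norm v)\<^sup>2" for x v
      by (rule order_trans[OF C2(3) mult_right_mono[OF le(2)]]) simp
    show "norm (?D x w) \<le> C * norm w" for x w
      by (rule order_trans[OF C3(2) mult_right_mono[OF le(3)]]) simp
    show "norm (?D (x + v) w - ?D x w) \<le> C * norm v * norm w" for x v w
      by (rule order_trans[OF C2(2) mult_right_mono[OF mult_right_mono[OF le(2)]]]) simp_all
    show "norm (?R x v w) \<le> C * norm w * (norm v)\<^sup>2" for x v w
      by (rule order_trans[OF C4 mult_right_mono[OF mult_right_mono[OF le(4)]]]) simp_all
  qed
qed

section \<open>Division by the noise coefficient\<close>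

lemma diag_matrix_mult_component: "(diag_matrix d *v v) $ i = d i * v $ i"
proof -
  have "(diag_matrix d *v v) $ i = (\<Sum>j\<in>UNIV. (if i = j then d i else 0) * v $ j)"
    by (simp add: matrix_vector_mult_def diag_matrix_def)
  also have "\<dots> = (\<Sum>j\<in>UNIV. if i = j then d i * v $ j else 0)" by (rule sum.cong) auto
  finally show ?thesis by simp
qed

lemma has_vector_derivative_vec:
  fixes f :: "real \<Rightarrow> real^'n"
  assumes "\<And>i. ((\<lambda>t. f t $ i) has_real_derivative f' $ i) (at t within S)"
  shows "(f has_vector_derivative f') (at t within S)"
  unfolding has_vector_derivative_def
proof (subst has_derivative_componentwise_within, intro ballI)
  fix e :: "real^'n" assume "e \<in> Basis"
  then obtain i where "e = axis i 1" by (auto simp: Basis_vec_def)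
  then show "((\<lambda>x. f x \<bullet> e) has_derivative (\<lambda>x. (x *\<^sub>R f') \<bullet> e)) (at t within S)"
    using assms[of i] by (simp add: inner_axis has_field_derivative_def mult_commute_abs)
qed

lemma has_vector_derivative_vec_nth:
  fixes f :: "real \<Rightarrow> real^'n"
  assumes "(f has_vector_derivative f') (at t within S)"
  shows "((\<lambda>t. f t $ i) has_real_derivative f' $ i) (at t within S)"
  using bounded_linear.has_vector_derivative[OF bounded_linear_vec_nth assms]
  by (simp add: has_real_derivative_iff_has_vector_derivative)

lemma norm_vec_le_sum:
  fixes v w :: "real^'n"
  assumes "\<And>i. \<bar>v $ i\<bar> \<le> a i * \<bar>w $ i\<bar>" "\<And>i. 0 \<le> a i"
  shows "norm v \<le> (\<Sum>i\<in>UNIV. a i) * norm w"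
proof -
  have "norm v \<le> (\<Sum>i\<in>UNIV. \<bar>v $ i\<bar>)" by (rule norm_le_l1_cart)
  also have "\<dots> \<le> (\<Sum>i\<in>UNIV. a i * norm w)"
    by (intro sum_mono order_trans[OF assms(1)] mult_left_mono component_le_norm_cart assms(2))
  finally show ?thesis by (simp add: sum_distrib_right)
qed

locale diagonal_noise =
  fixes H :: real and \<sigma> :: "real \<Rightarrow> real^'n^'n" and \<sigma>d \<sigma>d' :: "'n \<Rightarrow> real \<Rightarrow> real" and m :: "'n \<Rightarrow> real" and S :: real
  assumes H: "1/2 < H" "H < 1"
    and \<sigma>_diag: "\<And>t. 0 \<le> t \<Longrightarrow> \<sigma> t = diag_matrix (\<lambda>i. \<sigma>d i t)"
    and \<sigma>d_deriv: "\<And>i t. 0 \<le> t \<Longrightarrow> (\<sigma>d i has_real_derivative \<sigma>d' i t) (at t within {0..})"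
    and m_pos: "\<And>i. 0 < m i" and \<sigma>d_lower: "\<And>i t. 0 \<le> t \<Longrightarrow> m i \<le> \<sigma>d i t"
    and \<sigma>d'_bound: "\<And>i t. 0 \<le> t \<Longrightarrow> \<bar>\<sigma>d' i t\<bar> \<le> S"
begin

definition \<sigma>inv :: "real \<Rightarrow> real^'n \<Rightarrow> real^'n" where "\<sigma>inv t v = (\<chi> i. v $ i / \<sigma>d i t)"
text \<open>\<open>K0\<close> bounds \<sigma>^(-1) and \<open>K1\<close> its time derivative, since
  |(1/\<sigma>)'| = |\<sigma>'| / \<sigma>^2 \<le> S / m^2 componentwise. Both are independent of
  the time horizon.\<close>

definition K0 :: real where "K0 = (\<Sum>i\<in>UNIV. 1 / m i)"
definition K1 :: real where "K1 = (\<Sum>i\<in>UNIV. S / (m i)\<^sup>2)"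

lemma \<sigma>d_pos: "0 \<le> t \<Longrightarrow> 0 < \<sigma>d i t"
  using m_pos[of i] \<sigma>d_lower[of t i] by simp

lemma S_nonneg: "0 \<le> S"
  using order_trans[OF abs_ge_zero \<sigma>d'_bound[of 0]] by simp

lemma K0_nonneg: "0 \<le> K0" and K1_nonneg: "0 \<le> K1"
  unfolding K0_def K1_def using m_pos S_nonneg by (auto intro!: sum_nonneg simp: less_imp_le)

lemma \<sigma>_mult_\<sigma>inv: "0 \<le> t \<Longrightarrow> \<sigma> t *v \<sigma>inv t v = v"
  using \<sigma>d_pos[of t] by (simp add: vec_eq_iff \<sigma>_diag diag_matrix_mult_component \<sigma>inv_def less_imp_neq[symmetric])

lemma \<sigma>_mult_eq_0: "0 \<le> t \<Longrightarrow> \<sigma> t *v v = 0 \<Longrightarrow> v = 0"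
  using \<sigma>d_pos[of t] by (auto simp: vec_eq_iff \<sigma>_diag diag_matrix_mult_component less_imp_neq[symmetric])

lemma \<sigma>_continuous: "continuous_on {0..} \<sigma>"
proof -
  have "continuous_on {0..} (\<sigma>d i)" for i
    using \<sigma>d_deriv[of _ i] DERIV_continuous unfolding continuous_on_eq_continuous_within by fastforce
  then have "continuous_on {0..} (\<lambda>t. if i = j then \<sigma>d i t else 0)" for i j by (cases "i = j") auto
  then have "continuous_on {0..} (\<lambda>t. diag_matrix (\<lambda>i. \<sigma>d i t))"
    unfolding diag_matrix_def by (intro continuous_on_vec_lambda)
  then show ?thesis by (rule continuous_on_eq) (simp add: \<sigma>_diag)
qed

lemma \<sigma>inv_norm: "0 \<le> t \<Longrightarrow> norm (\<sigma>inv t v) \<le> K0 * norm v"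
  unfolding K0_def
proof (rule norm_vec_le_sum)
  fix i assume t: "0 \<le> t"
  show "\<bar>\<sigma>inv t v $ i\<bar> \<le> 1 / m i * \<bar>v $ i\<bar>"
    using \<sigma>d_pos[OF t, of i] m_pos[of i] \<sigma>d_lower[OF t, of i] by (simp add: \<sigma>inv_def abs_divide divide_left_mono)
qed (use m_pos in \<open>simp add: less_imp_le\<close>)

lemma \<sigma>inv_has_vector_derivative:
  assumes F: "(F has_vector_derivative F') (at t within {0..})" and t: "0 \<le> t"
  obtains D where "((\<lambda>t. \<sigma>inv t (F t)) has_vector_derivative D) (at t within {0..})"
    "norm D \<le> K0 * norm F' + K1 * norm (F t)"
proof
  let ?E = "\<chi> i. F t $ i * \<sigma>d' i t / (\<sigma>d i t)\<^sup>2"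
  show "((\<lambda>t. \<sigma>inv t (F t)) has_vector_derivative (\<sigma>inv t F' - ?E)) (at t within {0..})"
  proof (rule has_vector_derivative_vec)
    fix i
    have "((\<lambda>t. F t $ i / \<sigma>d i t) has_real_derivative (F' $ i * \<sigma>d i t - F t $ i * \<sigma>d' i t) / (\<sigma>d i t * \<sigma>d i t)) (at t within {0..})"
      using \<sigma>d_pos[OF t, of i] by (intro DERIV_divide has_vector_derivative_vec_nth[OF F] \<sigma>d_deriv[OF t]) simp
    moreover have "(F' $ i * \<sigma>d i t - F t $ i * \<sigma>d' i t) / (\<sigma>d i t * \<sigma>d i t) = (\<sigma>inv t F' - ?E) $ i"
      using \<sigma>d_pos[OF t, of i] by (simp add: \<sigma>inv_def diff_divide_distrib power2_eq_square)
    ultimately show "((\<lambda>t. \<sigma>inv t (F t) $ i) has_real_derivative (\<sigma>inv t F' - ?E) $ i) (at t within {0..})"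
      by (simp add: \<sigma>inv_def)
  qed
  have "norm ?E \<le> K1 * norm (F t)"
    unfolding K1_def
  proof (rule norm_vec_le_sum)
    fix i
    have "(m i)\<^sup>2 \<le> (\<sigma>d i t)\<^sup>2" using m_pos[of i] \<sigma>d_lower[OF t, of i] by (intro power_mono) auto
    then have "\<bar>\<sigma>d' i t\<bar> / (\<sigma>d i t)\<^sup>2 \<le> S / (m i)\<^sup>2"
      using m_pos[of i] \<sigma>d'_bound[OF t, of i] by (intro frac_le) auto
    then have "\<bar>\<sigma>d' i t\<bar> / (\<sigma>d i t)\<^sup>2 * \<bar>F t $ i\<bar> \<le> S / (m i)\<^sup>2 * \<bar>F t $ i\<bar>" by (rule mult_right_mono) simp
    then show "\<bar>?E $ i\<bar> \<le> S / (m i)\<^sup>2 * \<bar>F t $ i\<bar>" by (simp add: abs_mult abs_divide mult.commute)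
  qed (use S_nonneg in simp)
  then show "norm (\<sigma>inv t F' - ?E) \<le> K0 * norm F' + K1 * norm (F t)"
    using norm_triangle_ineq4[of "\<sigma>inv t F'" ?E] \<sigma>inv_norm[OF t, of F'] by linarith
qed

text \<open>The term \<open>t \<sigma> c\<close> costs only the constant slope \<open>c\<close> after division by \<open>\<sigma>\<close>; this is what constant
  response buys.\<close>
lemma path_energy:
  assumes L: "0 < L" and P0: "P 0 = 0"
    and P: "\<And>t. t \<in> {0..L} \<Longrightarrow> (P has_vector_derivative (F t + t *\<^sub>R (\<sigma> t *v c))) (at t within {0..L})"
    and F: "\<And>t. t \<in> {0..L} \<Longrightarrow> (F has_vector_derivative F' t) (at t within {0..})"
    and A: "norm (F 0) \<le> A" and Bf: "\<And>t. t \<in> {0..L} \<Longrightarrow> norm (F t) \<le> Bf"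
    and Bd: "\<And>t. t \<in> {0..L} \<Longrightarrow> norm (F' t) \<le> Bd"
  shows "P \<in> CM_space H \<sigma> L"
    "(LINT t|lebesgue_on {0..L}. (norm (K_sigma_inv H \<sigma> L P t))\<^sup>2) \<le>
      energy_const H * ((K0 * A)\<^sup>2 * L powr (2 - 2*H) + (K0 * Bd + K1 * Bf + norm c)\<^sup>2 * L powr (4 - 2*H))"
proof -
  \<comment> \<open>This is \<sigma>^(-1) P' with the secular term already divided out; its starting
    value is \<sigma>^(-1) F(0).\<close>
  define \<rho> where "\<rho> = (\<lambda>t. \<sigma>inv t (F t) + t *\<^sub>R c)"
  have "\<exists>D. ((\<lambda>t. \<sigma>inv t (F t)) has_vector_derivative D) (at t within {0..}) \<and> norm D \<le> K0 * norm (F' t) + K1 * norm (F t)"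
    if "t \<in> {0..L}" for t
    using \<sigma>inv_has_vector_derivative[OF F[OF that]] that by (metis atLeastAtMost_iff)
  then obtain D where D: "\<And>t. t \<in> {0..L} \<Longrightarrow> ((\<lambda>t. \<sigma>inv t (F t)) has_vector_derivative D t) (at t within {0..})"
    "\<And>t. t \<in> {0..L} \<Longrightarrow> norm (D t) \<le> K0 * norm (F' t) + K1 * norm (F t)" by metis
  have d\<rho>: "(\<rho> has_vector_derivative (D t + c)) (at t within {0..L})" if t: "t \<in> {0..L}" for t
  proof -
    have "((\<lambda>t. t *\<^sub>R c) has_vector_derivative (1 *\<^sub>R c)) (at t within {0..})"
      by (rule has_vector_derivative_eq_rhs[OF has_vector_derivative_scaleR[OF DERIV_ident has_vector_derivative_const]]) simp
    then have "(\<rho> has_vector_derivative (D t + 1 *\<^sub>R c)) (at t within {0..})"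
      unfolding \<rho>_def by (intro has_vector_derivative_add D t)
    then show ?thesis by (simp add: has_vector_derivative_within_subset)
  qed
  have bL: "norm (D t + c) \<le> K0 * Bd + K1 * Bf + norm c" if t: "t \<in> {0..L}" for t
  proof -
    have "norm (D t + c) \<le> norm (D t) + norm c" by (rule norm_triangle_ineq)
    moreover have "K0 * norm (F' t) \<le> K0 * Bd" "K1 * norm (F t) \<le> K1 * Bf"
      using K0_nonneg K1_nonneg Bf[OF t] Bd[OF t] by (auto intro: mult_left_mono)
    ultimately show ?thesis using D(2)[OF t] by linarith
  qed
  have bA: "norm (\<rho> 0) \<le> K0 * A"
    using \<sigma>inv_norm[of 0 "F 0"] A K0_nonneg by (auto simp: \<rho>_def intro: order_trans mult_left_mono)
  have \<sigma>c: "continuous_on {0..L} \<sigma>" by (rule continuous_on_subset[OF \<sigma>_continuous]) auto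
  have e: "F t + t *\<^sub>R (\<sigma> t *v c) = \<sigma> t *v \<rho> t" if "0 \<le> t" for t
    using that by (simp add: \<rho>_def matrix_vector_right_distrib \<sigma>_mult_\<sigma>inv matrix_vector_mult_scaleR)
  have \<rho>c: "continuous_on {0..L} \<rho>"
    using d\<rho> by (meson continuous_on_eq_continuous_within has_vector_derivative_continuous)
  have pP: "P t = (LINT s|lebesgue_on {0..t}. \<sigma> s *v \<rho> s)" if t: "t \<in> {0..L}" for t
  proof -
    have "((\<lambda>s. \<sigma> s *v \<rho> s) has_integral (P t - P 0)) {0..t}"
    proof (rule fundamental_theorem_of_calculus)
      show "(P has_vector_derivative \<sigma> s *v \<rho> s) (at s within {0..t})" if s: "s \<in> {0..t}" for s
        by (rule has_vector_derivative_within_subset[of P _ s "{0..L}"]) (use P[of s] e[of s] s t in auto)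
    qed (use t in auto)
    moreover have "integrable (lebesgue_on {0..t}) (\<lambda>s. \<sigma> s *v \<rho> s)"
      by (intro integrable_matrix_vector_mult continuous_imp_integrable_real continuous_on_subset[OF \<sigma>c] continuous_on_subset[OF \<rho>c])
         (use t in auto)
    ultimately show ?thesis using lebesgue_integral_eq_integral[of "{0..t}" "\<lambda>s. \<sigma> s *v \<rho> s"] P0
      by (simp add: integral_unique)
  qed
  have inv: "\<And>s w. s \<in> {0..L} \<Longrightarrow> \<sigma> s *v w = 0 \<Longrightarrow> w = 0" using \<sigma>_mult_eq_0 by auto
  note E = energy_bound[OF H L \<sigma>c inv d\<rho> bA bL pP]
  show "P \<in> CM_space H \<sigma> L" by (rule E(1))
  show "(LINT t|lebesgue_on {0..L}. (norm (K_sigma_inv H \<sigma> L P t))\<^sup>2) \<le>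
      energy_const H * ((K0 * A)\<^sup>2 * L powr (2 - 2*H) + (K0 * Bd + K1 * Bf + norm c)\<^sup>2 * L powr (4 - 2*H))"
    by (rule E(2))
qed

end

lemma indefinite_lebesgue_integral_has_vector_derivative:
  fixes f :: "real \<Rightarrow> 'a::euclidean_space"
  assumes f: "continuous_on {0..L} f" and t: "t \<in> {0..L}"
  shows "((\<lambda>t. LINT s|lebesgue_on {0..t}. f s) has_vector_derivative f t) (at t within {0..L})"
proof (rule has_vector_derivative_transform[OF t])
  show "((\<lambda>t. integral {0..t} f) has_vector_derivative f t) (at t within {0..L})"
    by (rule integral_has_vector_derivative[OF f t])
  show "(LINT s|lebesgue_on {0..r}. f s) = integral {0..r} f" if "r \<in> {0..L}" for r
    by (intro lebesgue_integral_eq_integral continuous_imp_integrable_real continuous_on_subset[OF f]) (use that in auto)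
qed

locale forced_mode = diagonal_noise H \<sigma> \<sigma>d \<sigma>d' m S
  for H :: real and \<sigma> :: "real \<Rightarrow> real^'n^'n" and \<sigma>d \<sigma>d' m S +
  fixes b :: "real^'n \<Rightarrow> real^'n" and X w w' :: "real \<Rightarrow> real^'n" and q :: "real^'n" and W W' :: real
  assumes b: "Cb 3 b"
    and X: "\<And>t. 0 \<le> t \<Longrightarrow> (X has_vector_derivative b (X t)) (at t within {0..})"
    and w: "\<And>t. 0 \<le> t \<Longrightarrow> (w has_vector_derivative w' t) (at t within {0..})"
    and w'_eq: "\<And>t. 0 \<le> t \<Longrightarrow> w' t = frechet_derivative b (at (X t)) (w t) + \<sigma> t *v q"
    and w_bound: "\<And>t. 0 \<le> t \<Longrightarrow> norm (w t) \<le> W" and w'_bound: "\<And>t. 0 \<le> t \<Longrightarrow> norm (w' t) \<le> W'"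
begin

definition h :: "real \<Rightarrow> real^'n" where "h t = t *\<^sub>R w t"
definition h' :: "real \<Rightarrow> real^'n" where "h' t = w t + t *\<^sub>R w' t"
text \<open>Slope bound for \<sigma>^(-1) w + t q, the density of the defect to first order in
  \<tau>. Its independence of L keeps the energy at order L^(4-2H).\<close>

definition \<Lambda> :: real where "\<Lambda> = K0 * W' + K1 * W + norm q"
definition remainder :: "real \<Rightarrow> real \<Rightarrow> real^'n" where
  "remainder \<tau> t = b (X t + \<tau> *\<^sub>R h t) - b (X t) - frechet_derivative b (at (X t)) (\<tau> *\<^sub>R h t)"

lemma b_Suc: "Cb (Suc (Suc (Suc 0))) b"
  using b by (simp add: numeral_3_eq_3)

lemma W_nonneg: "0 \<le> W" and W'_nonneg: "0 \<le> W'"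
  using order_trans[OF norm_ge_zero w_bound[of 0]] order_trans[OF norm_ge_zero w'_bound[of 0]] by simp_all

lemma h_has_vector_derivative: "0 \<le> t \<Longrightarrow> (h has_vector_derivative h' t) (at t within {0..})"
  unfolding h_def h'_def
  by (rule has_vector_derivative_eq_rhs[OF has_vector_derivative_scaleR[OF DERIV_ident w]]) (simp_all add: add.commute)

lemma scaled_h_has_vector_derivative:
  assumes "0 \<le> t" shows "((\<lambda>t. \<tau> *\<^sub>R h t) has_vector_derivative \<tau> *\<^sub>R h' t) (at t within {0..})"
  by (rule has_vector_derivative_eq_rhs[OF has_vector_derivative_scaleR[OF DERIV_const h_has_vector_derivative[OF assms]]]) simp

lemma perturbed_has_vector_derivative:
  "0 \<le> t \<Longrightarrow> ((\<lambda>t. X t + \<tau> *\<^sub>R h t) has_vector_derivative (b (X t) + \<tau> *\<^sub>R h' t)) (at t within {0..})"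
  by (intro has_vector_derivative_add X scaled_h_has_vector_derivative)

lemma h_bound: "t \<in> {0..L} \<Longrightarrow> norm (h t) \<le> L * W"
  using w_bound[of t] W_nonneg by (auto simp: h_def intro!: mult_mono)

lemma h'_bound: assumes "t \<in> {0..L}" shows "norm (h' t) \<le> W + L * W'"
proof -
  have "norm (t *\<^sub>R w' t) \<le> L * W'" using assms w'_bound[of t] W'_nonneg by (auto intro!: mult_mono)
  then show ?thesis using norm_triangle_ineq[of "w t" "t *\<^sub>R w' t"] w_bound[of t] assms by (simp add: h'_def)
qed

lemma continuous_X: "continuous_on {0..} X"
  using X by (meson atLeast_iff continuous_on_eq_continuous_within has_vector_derivative_continuous)

lemma continuous_perturbed: "continuous_on {0..} (\<lambda>t. X t + \<tau> *\<^sub>R h t)"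
  using perturbed_has_vector_derivative
  by (meson atLeast_iff continuous_on_eq_continuous_within has_vector_derivative_continuous)

lemma continuous_b: "continuous_on UNIV b"
  using b_Suc by simp

lemma h'_eq: "0 \<le> t \<Longrightarrow> h' t = w t + frechet_derivative b (at (X t)) (h t) + t *\<^sub>R (\<sigma> t *v q)"
proof -
  assume t: "0 \<le> t"
  have "linear (frechet_derivative b (at (X t)))"
    using Cb_has_derivative[OF b_Suc] has_derivative_bounded_linear bounded_linear.linear by blast
  then have "frechet_derivative b (at (X t)) (h t) = t *\<^sub>R frechet_derivative b (at (X t)) (w t)"
    by (simp add: h_def linear_cmul)
  then show ?thesis using w'_eq[OF t] by (simp add: h'_def scaleR_add_right)
qed

text \<open>\<open>\<tau> w - R\<close> is the defect \<open>\<phi>' - b(\<phi>)\<close> of the perturbed path \<open>\<phi> = X + \<tau> h\<close>, up to \<open>\<tau> t \<sigma> q\<close>.\<close>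
lemma defect_identity:
  assumes t: "0 \<le> t"
  shows "b (X t) + \<tau> *\<^sub>R h' t - b (X t + \<tau> *\<^sub>R h t) = (\<tau> *\<^sub>R w t - remainder \<tau> t) + t *\<^sub>R (\<sigma> t *v (\<tau> *\<^sub>R q))"
proof -
  have "linear (frechet_derivative b (at (X t)))"
    using Cb_has_derivative[OF b_Suc] has_derivative_bounded_linear bounded_linear.linear by blast
  then have "frechet_derivative b (at (X t)) (\<tau> *\<^sub>R h t) = \<tau> *\<^sub>R frechet_derivative b (at (X t)) (h t)"
    by (simp add: linear_cmul)
  then show ?thesis unfolding remainder_def h'_eq[OF t]
    by (simp add: scaleR_add_right matrix_vector_mult_scaleR scaleR_left_commute)
qed

text \<open>Three paths go through \<open>path_energy\<close>: the integrated defect of X + \<tau>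
  h, the displacement \<tau> h, and the competitor minus its starting point. For the defect the
  slope must have leading part \<tau> \<Lambda>, so the quadratic remainder appears only as \<tau>
  \<open>D1\<close> next to \<Lambda>; \<open>D1\<close> and \<open>D2\<close> may depend on L, but
  not on \<tau>.\<close>

lemma variation_energy:
  assumes L: "0 < L"
  obtains D1 D2 where "0 \<le> D1"
    "\<And>\<tau>. 0 \<le> \<tau> \<Longrightarrow> \<tau> \<le> 1 \<Longrightarrow> (LINT t|lebesgue_on {0..L}. (norm (K_sigma_inv H \<sigma> L
        (\<lambda>r. X r + \<tau> *\<^sub>R h r - X 0 - (LINT s|lebesgue_on {0..r}. b (X s + \<tau> *\<^sub>R h s))) t))\<^sup>2) \<le>
        \<tau>\<^sup>2 * (energy_const H * ((K0 * W)\<^sup>2 * L powr (2 - 2*H) + (\<Lambda> + \<tau> * D1)\<^sup>2 * L powr (4 - 2*H)))"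
    "\<And>\<tau>. 0 \<le> \<tau> \<Longrightarrow> \<tau> \<le> 1 \<Longrightarrow> (LINT t|lebesgue_on {0..L}. (norm (K_sigma_inv H \<sigma> L (\<lambda>r. \<tau> *\<^sub>R h r) t))\<^sup>2) \<le> \<tau>\<^sup>2 * D2"
    "\<And>\<tau>. 0 \<le> \<tau> \<Longrightarrow> \<tau> \<le> 1 \<Longrightarrow> (\<lambda>r. \<tau> *\<^sub>R h r) \<in> CM_space H \<sigma> L"
    "\<And>\<tau>. 0 \<le> \<tau> \<Longrightarrow> \<tau> \<le> 1 \<Longrightarrow> (\<lambda>r. X r + \<tau> *\<^sub>R h r - X 0) \<in> CM_space H \<sigma> L"
proof -
  let ?D = "\<lambda>x. frechet_derivative b (at x)"
  obtain C where C: "0 \<le> C" "\<And>x v. norm (b (x + v) - b x) \<le> C * norm v"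
    "\<And>x v. norm (b (x + v) - b x - ?D x v) \<le> C * (norm v)\<^sup>2"
    "\<And>x w. norm (?D x w) \<le> C * norm w"
    "\<And>x v w. norm (?D (x + v) w - ?D x w) \<le> C * norm v * norm w"
    "\<And>x v w. norm (?D (x + v) w - ?D x w - frechet_derivative (\<lambda>z. ?D z w) (at x) v) \<le> C * norm w * (norm v)\<^sup>2"
    by (rule Cb3_bounds[OF b_Suc]) (rule that)
  obtain XB where XB: "\<And>x. norm (b x) \<le> XB"
    using b_Suc by (auto simp: bounded_iff)
  have XB0: "0 \<le> XB" by (rule order_trans[OF norm_ge_zero XB])
  define h0 h1 where "h0 = L * W" and "h1 = W + L * W'"
  have h01: "0 \<le> h0" "0 \<le> h1" using L W_nonneg W'_nonneg by (auto simp: h0_def h1_def)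
  define d0 d1 where "d0 = C * h0\<^sup>2" and "d1 = C * XB * h0\<^sup>2 + C * h0 * h1"
  have d01: "0 \<le> d0" "0 \<le> d1" using C(1) XB0 h01 by (auto simp: d0_def d1_def)
  let ?F = "\<lambda>\<tau> t. \<tau> *\<^sub>R w t - remainder \<tau> t"
  define \<phi>d where "\<phi>d = (\<lambda>\<tau> t. ?D (X t + \<tau> *\<^sub>R h t) (b (X t) + \<tau> *\<^sub>R h' t))"
  \<comment> \<open>Derivative of \<tau> w - R for the Taylor remainder R: the three terms in the
    bracket differentiate b(X + \<tau> h), b(X) and Db(X)(\<tau> h).\<close>
  define F' where "F' = (\<lambda>\<tau> t. \<tau> *\<^sub>R w' t - (\<phi>d \<tau> t - ?D (X t) (b (X t))
      - (?D (X t) (\<tau> *\<^sub>R h' t) + frechet_derivative (\<lambda>z. ?D z (b (X t))) (at (X t)) (\<tau> *\<^sub>R h t))))"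
  have lin: "linear (?D x)" for x
    using Cb_has_derivative[OF b_Suc] has_derivative_bounded_linear bounded_linear.linear by blast
  have dbX: "((\<lambda>t. b (X t)) has_vector_derivative ?D (X t) (b (X t))) (at t within {0..})" if "0 \<le> t" for t
    by (rule Cb_comp_has_vector_derivative[OF b_Suc X[OF that]])
  have db\<phi>: "((\<lambda>t. b (X t + \<tau> *\<^sub>R h t)) has_vector_derivative \<phi>d \<tau> t) (at t within {0..})" if "0 \<le> t" for t \<tau>
    unfolding \<phi>d_def by (rule Cb_comp_has_vector_derivative[OF b_Suc perturbed_has_vector_derivative[OF that]])
  have dF: "(?F \<tau> has_vector_derivative F' \<tau> t) (at t within {0..})" if "0 \<le> t" for t \<tau>
  proof -
    have "((\<lambda>t. \<tau> *\<^sub>R w t) has_vector_derivative \<tau> *\<^sub>R w' t) (at t within {0..})"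
      by (rule has_vector_derivative_eq_rhs[OF has_vector_derivative_scaleR[OF DERIV_const w[OF that]]]) simp
    then show ?thesis unfolding remainder_def[abs_def] F'_def
      by (intro has_vector_derivative_diff dbX db\<phi> that
          Cb_derivative_apply_has_vector_derivative[OF b_Suc X[OF that] scaled_h_has_vector_derivative[OF that]])
  qed
  have nh: "norm (\<tau> *\<^sub>R h t) \<le> \<tau> * h0" "norm (\<tau> *\<^sub>R h' t) \<le> \<tau> * h1" if "0 \<le> \<tau>" "t \<in> {0..L}" for \<tau> t
    using h_bound[OF that(2)] h'_bound[OF that(2)] that(1) by (auto simp: h0_def h1_def intro: mult_left_mono)
  have R: "norm (remainder \<tau> t) \<le> \<tau>\<^sup>2 * d0" if "0 \<le> \<tau>" "t \<in> {0..L}" for \<tau> t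
  proof -
    have "norm (remainder \<tau> t) \<le> C * (norm (\<tau> *\<^sub>R h t))\<^sup>2" unfolding remainder_def by (rule C(3))
    also have "\<dots> \<le> C * (\<tau> * h0)\<^sup>2" using C(1) nh(1)[OF that] by (intro mult_left_mono power_mono) auto
    finally show ?thesis by (simp add: d0_def power_mult_distrib mult_ac)
  qed
  have Fb: "norm (?F \<tau> t) \<le> \<tau> * W + \<tau>\<^sup>2 * d0" if "0 \<le> \<tau>" "t \<in> {0..L}" for \<tau> t
  proof -
    have "norm (\<tau> *\<^sub>R w t) \<le> \<tau> * W" using w_bound[of t] that by (auto intro: mult_left_mono)
    then show ?thesis using norm_triangle_ineq4[of "\<tau> *\<^sub>R w t" "remainder \<tau> t"] R[OF that] by linarith
  qed
  \<comment> \<open>By linearity b(X) is fed into a quadratically small Taylor remainder of Db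
    (\<open>?r1\<close>) and \<tau> h' into an increment of Db (\<open>?r2\<close>), so both are
    O(\<tau>^2).\<close>
  have F'b: "norm (F' \<tau> t) \<le> \<tau> * W' + \<tau>\<^sup>2 * d1" if \<tau>t: "0 \<le> \<tau>" "t \<in> {0..L}" for \<tau> t
  proof -
    let ?v = "\<tau> *\<^sub>R h t" and ?x = "X t"
    let ?r1 = "?D (?x + ?v) (b ?x) - ?D ?x (b ?x) - frechet_derivative (\<lambda>z. ?D z (b ?x)) (at ?x) ?v"
    let ?r2 = "?D (?x + ?v) (\<tau> *\<^sub>R h' t) - ?D ?x (\<tau> *\<^sub>R h' t)"
    have e: "F' \<tau> t = \<tau> *\<^sub>R w' t - (?r1 + ?r2)"
      unfolding F'_def \<phi>d_def linear_add[OF lin] by (simp add: algebra_simps)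
    have "norm (F' \<tau> t) \<le> norm (\<tau> *\<^sub>R w' t) + (norm ?r1 + norm ?r2)"
      unfolding e using norm_triangle_ineq4[of "\<tau> *\<^sub>R w' t" "?r1 + ?r2"] norm_triangle_ineq[of ?r1 ?r2] by linarith
    moreover have "norm (\<tau> *\<^sub>R w' t) \<le> \<tau> * W'" using w'_bound[of t] \<tau>t by (auto intro: mult_left_mono)
    moreover have "norm ?r1 \<le> \<tau>\<^sup>2 * (C * XB * h0\<^sup>2)"
    proof -
      have "norm ?r1 \<le> C * norm (b ?x) * (norm ?v)\<^sup>2" by (rule C(6))
      also have "\<dots> \<le> C * XB * (\<tau> * h0)\<^sup>2"
        using C(1) XB XB0 nh(1)[OF \<tau>t] by (intro mult_mono power_mono mult_left_mono) auto
      finally show ?thesis by (simp add: power_mult_distrib mult_ac)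
    qed
    moreover have "norm ?r2 \<le> \<tau>\<^sup>2 * (C * h0 * h1)"
    proof -
      have "norm ?r2 \<le> C * norm ?v * norm (\<tau> *\<^sub>R h' t)" by (rule C(5))
      also have "\<dots> \<le> C * (\<tau> * h0) * (\<tau> * h1)"
        using C(1) h01 \<tau>t nh[OF \<tau>t] by (intro mult_mono mult_left_mono) auto
      finally show ?thesis by (simp add: power2_eq_square mult_ac)
    qed
    ultimately show ?thesis by (simp add: d1_def distrib_left)
  qed
  \<comment> \<open>The remainder vanishes at t = 0 because h does, so no \<tau>^2 enters the
    initial value.\<close>
  have F0: "?F \<tau> 0 = \<tau> *\<^sub>R w 0" for \<tau>
    using linear_0[OF lin] by (simp add: remainder_def h_def)
  have F0b: "norm (?F \<tau> 0) \<le> \<tau> * W" if "0 \<le> \<tau>" for \<tau>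
    unfolding F0 using w_bound[of 0] that by (auto intro: mult_left_mono)
  have sub: "(f has_vector_derivative f') (at t within {0..L})" if "(f has_vector_derivative f') (at t within {0..})" for f :: "real \<Rightarrow> real^'n" and f' t
    by (rule has_vector_derivative_within_subset[OF that]) auto
  define D1 where "D1 = K0 * d1 + K1 * d0"
  have D1: "0 \<le> D1" using K0_nonneg K1_nonneg d01 by (simp add: D1_def)
  \<comment> \<open>For the displacement a bound linear in \<tau> is enough: \<tau>^2 \<le> \<tau>
    absorbs the remainders, and b(X + \<tau> h) - b(X) is added to the defect to recover \<tau>
    h'.\<close>
  define e0 e1 where "e0 = W + d0 + C * h0" and "e1 = W' + d1 + C * h0 * XB + C * h1"
  define D2 where "D2 = energy_const H * ((K0 * W)\<^sup>2 * L powr (2 - 2*H) + (K0 * e1 + K1 * e0 + norm q)\<^sup>2 * L powr (4 - 2*H))"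
  have first: "(LINT t|lebesgue_on {0..L}. (norm (K_sigma_inv H \<sigma> L
        (\<lambda>r. X r + \<tau> *\<^sub>R h r - X 0 - (LINT s|lebesgue_on {0..r}. b (X s + \<tau> *\<^sub>R h s))) t))\<^sup>2) \<le>
        \<tau>\<^sup>2 * (energy_const H * ((K0 * W)\<^sup>2 * L powr (2 - 2*H) + (\<Lambda> + \<tau> * D1)\<^sup>2 * L powr (4 - 2*H)))"
    if \<tau>: "0 \<le> \<tau>" "\<tau> \<le> 1" for \<tau>
  proof -
    let ?P = "\<lambda>r. X r + \<tau> *\<^sub>R h r - X 0 - (LINT s|lebesgue_on {0..r}. b (X s + \<tau> *\<^sub>R h s))"
    have "continuous_on {0..L} (\<lambda>s. b (X s + \<tau> *\<^sub>R h s))"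
      by (rule continuous_on_compose2[OF continuous_b continuous_on_subset[OF continuous_perturbed]]) auto
    note ib = indefinite_lebesgue_integral_has_vector_derivative[OF this]
    have dP: "(?P has_vector_derivative (?F \<tau> t + t *\<^sub>R (\<sigma> t *v (\<tau> *\<^sub>R q)))) (at t within {0..L})" if t: "t \<in> {0..L}" for t
    proof -
      have t0: "0 \<le> t" using t by simp
      have "(?P has_vector_derivative (b (X t) + \<tau> *\<^sub>R h' t - 0 - b (X t + \<tau> *\<^sub>R h t))) (at t within {0..L})"
        by (intro has_vector_derivative_diff sub[OF perturbed_has_vector_derivative[OF t0]] has_vector_derivative_const ib t)
      then show ?thesis unfolding diff_zero defect_identity[OF t0] .
    qed
    have P0: "?P 0 = 0"
      using lebesgue_integral_eq_integral[of "{0..0}" "\<lambda>s. b (X s + \<tau> *\<^sub>R h s)"] continuous_imp_integrable_real[of 0 0 "\<lambda>s. b (X s + \<tau> *\<^sub>R h s)"]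
      by (simp add: h_def)
    have "(LINT t|lebesgue_on {0..L}. (norm (K_sigma_inv H \<sigma> L ?P t))\<^sup>2) \<le>
        energy_const H * ((K0 * (\<tau> * W))\<^sup>2 * L powr (2 - 2*H) +
        (K0 * (\<tau> * W' + \<tau>\<^sup>2 * d1) + K1 * (\<tau> * W + \<tau>\<^sup>2 * d0) + norm (\<tau> *\<^sub>R q))\<^sup>2 * L powr (4 - 2*H))"
      by (rule path_energy(2)[where P = ?P and F = "?F \<tau>" and F' = "F' \<tau>" and c = "\<tau> *\<^sub>R q" and A = "\<tau> * W"
        and Bf = "\<tau> * W + \<tau>\<^sup>2 * d0" and Bd = "\<tau> * W' + \<tau>\<^sup>2 * d1" and L = L,
        OF L P0 dP dF F0b[OF \<tau>(1)] Fb[OF \<tau>(1)] F'b[OF \<tau>(1)]]) auto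
    also have "energy_const H * ((K0 * (\<tau> * W))\<^sup>2 * L powr (2 - 2*H) +
        (K0 * (\<tau> * W' + \<tau>\<^sup>2 * d1) + K1 * (\<tau> * W + \<tau>\<^sup>2 * d0) + norm (\<tau> *\<^sub>R q))\<^sup>2 * L powr (4 - 2*H)) =
        \<tau>\<^sup>2 * (energy_const H * ((K0 * W)\<^sup>2 * L powr (2 - 2*H) + (\<Lambda> + \<tau> * D1)\<^sup>2 * L powr (4 - 2*H)))"
    proof -
      have e: "K0 * (\<tau> * W' + \<tau>\<^sup>2 * d1) + K1 * (\<tau> * W + \<tau>\<^sup>2 * d0) + norm (\<tau> *\<^sub>R q) = \<tau> * (\<Lambda> + \<tau> * D1)"
        using \<tau> by (simp add: \<Lambda>_def D1_def algebra_simps power2_eq_square)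
      show ?thesis unfolding e power_mult_distrib[of \<tau> "\<Lambda> + \<tau> * D1"]
        by (simp add: power_mult_distrib distrib_left mult_ac)
    qed
    finally show ?thesis .
  qed
  have \<tau>2: "\<tau>\<^sup>2 \<le> \<tau>" if "0 \<le> \<tau>" "\<tau> \<le> 1" for \<tau> :: real
    using mult_left_mono[OF that(2,1)] by (simp add: power2_eq_square)
  have second: "(LINT t|lebesgue_on {0..L}. (norm (K_sigma_inv H \<sigma> L (\<lambda>r. \<tau> *\<^sub>R h r) t))\<^sup>2) \<le> \<tau>\<^sup>2 * D2 \<and> (\<lambda>r. \<tau> *\<^sub>R h r) \<in> CM_space H \<sigma> L"
    if \<tau>: "0 \<le> \<tau>" "\<tau> \<le> 1" for \<tau>
  proof -
    let ?G = "\<lambda>t. ?F \<tau> t + (b (X t + \<tau> *\<^sub>R h t) - b (X t))"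
    let ?G' = "\<lambda>t. F' \<tau> t + (\<phi>d \<tau> t - ?D (X t) (b (X t)))"
    have dP: "((\<lambda>r. \<tau> *\<^sub>R h r) has_vector_derivative (?G t + t *\<^sub>R (\<sigma> t *v (\<tau> *\<^sub>R q)))) (at t within {0..L})" if t: "t \<in> {0..L}" for t
    proof -
      have t0: "0 \<le> t" using t by simp
      have "?G t + t *\<^sub>R (\<sigma> t *v (\<tau> *\<^sub>R q)) = \<tau> *\<^sub>R h' t"
        using defect_identity[OF t0, of \<tau>] by (simp add: algebra_simps)
      then show ?thesis using sub[OF scaled_h_has_vector_derivative[OF t0]] by simp
    qed
    have dG: "(?G has_vector_derivative ?G' t) (at t within {0..})" if "t \<in> {0..L}" for t
      using that by (intro has_vector_derivative_add has_vector_derivative_diff dF db\<phi> dbX) auto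
    have G0: "norm (?G 0) \<le> \<tau> * W" using F0b[OF \<tau>(1)] by (simp add: h_def)
    have Gb: "norm (?G t) \<le> \<tau> * e0" if t: "t \<in> {0..L}" for t
    proof -
      have "norm (b (X t + \<tau> *\<^sub>R h t) - b (X t)) \<le> C * (\<tau> * h0)"
        by (rule order_trans[OF C(2) mult_left_mono[OF nh(1)[OF \<tau>(1) t] C(1)]])
      moreover have "\<tau>\<^sup>2 * d0 \<le> \<tau> * d0" using \<tau>2[OF \<tau>] d01 by (intro mult_right_mono)
      ultimately show ?thesis
        using norm_triangle_ineq[of "?F \<tau> t" "b (X t + \<tau> *\<^sub>R h t) - b (X t)"] Fb[OF \<tau>(1) t]
        by (simp add: e0_def algebra_simps)
    qed
    have G'b: "norm (?G' t) \<le> \<tau> * e1" if t: "t \<in> {0..L}" for t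
    proof -
      let ?s1 = "?D (X t + \<tau> *\<^sub>R h t) (b (X t)) - ?D (X t) (b (X t))" and ?s2 = "?D (X t + \<tau> *\<^sub>R h t) (\<tau> *\<^sub>R h' t)"
      have e: "\<phi>d \<tau> t - ?D (X t) (b (X t)) = ?s1 + ?s2" unfolding \<phi>d_def linear_add[OF lin] by simp
      have "norm (?G' t) \<le> norm (F' \<tau> t) + (norm ?s1 + norm ?s2)"
        unfolding e using norm_triangle_ineq[of "F' \<tau> t" "?s1 + ?s2"] norm_triangle_ineq[of ?s1 ?s2] by linarith
      moreover have "norm ?s1 \<le> C * (\<tau> * h0) * XB"
        by (rule order_trans[OF C(5)]) (use C(1) h01 \<tau> nh(1)[OF \<tau>(1) t] XB in \<open>auto intro!: mult_mono\<close>)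
      moreover have "norm ?s2 \<le> C * (\<tau> * h1)"
        by (rule order_trans[OF C(4) mult_left_mono[OF nh(2)[OF \<tau>(1) t] C(1)]])
      moreover have "\<tau>\<^sup>2 * d1 \<le> \<tau> * d1" using \<tau>2[OF \<tau>] d01 by (intro mult_right_mono)
      ultimately show ?thesis using F'b[OF \<tau>(1) t] by (simp add: e1_def algebra_simps)
    qed
    have P0: "\<tau> *\<^sub>R h 0 = 0" by (simp add: h_def)
    note E = path_energy[where P = "\<lambda>r. \<tau> *\<^sub>R h r" and F = ?G and F' = ?G' and c = "\<tau> *\<^sub>R q" and A = "\<tau> * W"
        and Bf = "\<tau> * e0" and Bd = "\<tau> * e1" and L = L, OF L P0 dP dG G0 Gb G'b]
    have "energy_const H * ((K0 * (\<tau> * W))\<^sup>2 * L powr (2 - 2*H) +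
        (K0 * (\<tau> * e1) + K1 * (\<tau> * e0) + norm (\<tau> *\<^sub>R q))\<^sup>2 * L powr (4 - 2*H)) = \<tau>\<^sup>2 * D2"
    proof -
      have e: "K0 * (\<tau> * e1) + K1 * (\<tau> * e0) + norm (\<tau> *\<^sub>R q) = \<tau> * (K0 * e1 + K1 * e0 + norm q)"
        using \<tau> by (simp add: algebra_simps)
      show ?thesis unfolding e D2_def power_mult_distrib[of \<tau> "K0 * e1 + K1 * e0 + norm q"]
        by (simp add: power_mult_distrib distrib_left mult_ac)
    qed
    then show ?thesis using E by (metis (no_types, lifting))
  qed
  \<comment> \<open>The derivative of the competitor is its defect plus b along it, and b is
    bounded. Only membership in \<open>CM_space\<close> is at stake, so the constants are
    crude.\<close>
  have third: "(\<lambda>r. X r + \<tau> *\<^sub>R h r - X 0) \<in> CM_space H \<sigma> L" if \<tau>: "0 \<le> \<tau>" "\<tau> \<le> 1" for \<tau>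
  proof (rule path_energy(1)[where F = "\<lambda>t. ?F \<tau> t + b (X t + \<tau> *\<^sub>R h t)" and F' = "\<lambda>t. F' \<tau> t + \<phi>d \<tau> t" and c = "\<tau> *\<^sub>R q"
      and A = "norm (?F \<tau> 0 + b (X 0 + \<tau> *\<^sub>R h 0))" and Bf = "\<tau> * W + \<tau>\<^sup>2 * d0 + XB"
      and Bd = "\<tau> * W' + \<tau>\<^sup>2 * d1 + C * (XB + \<tau> * h1)", OF L])
    fix t assume t: "t \<in> {0..L}"
    then have t0: "0 \<le> t" by simp
    have "((\<lambda>r. X r + \<tau> *\<^sub>R h r - X 0) has_vector_derivative (b (X t) + \<tau> *\<^sub>R h' t - 0)) (at t within {0..L})"
      by (intro has_vector_derivative_diff sub[OF perturbed_has_vector_derivative[OF t0]] has_vector_derivative_const)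
    moreover have "b (X t) + \<tau> *\<^sub>R h' t - 0 = ?F \<tau> t + b (X t + \<tau> *\<^sub>R h t) + t *\<^sub>R (\<sigma> t *v (\<tau> *\<^sub>R q))"
      using defect_identity[OF t0, of \<tau>] by (simp add: algebra_simps)
    ultimately show "((\<lambda>r. X r + \<tau> *\<^sub>R h r - X 0) has_vector_derivative (?F \<tau> t + b (X t + \<tau> *\<^sub>R h t) + t *\<^sub>R (\<sigma> t *v (\<tau> *\<^sub>R q)))) (at t within {0..L})"
      by simp
    show "((\<lambda>t. ?F \<tau> t + b (X t + \<tau> *\<^sub>R h t)) has_vector_derivative F' \<tau> t + \<phi>d \<tau> t) (at t within {0..})"
      by (intro has_vector_derivative_add dF db\<phi> t0)
    show "norm (?F \<tau> t + b (X t + \<tau> *\<^sub>R h t)) \<le> \<tau> * W + \<tau>\<^sup>2 * d0 + XB"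
      by (rule norm_triangle_mono[OF Fb[OF \<tau>(1) t] XB])
    have "norm (b (X t) + \<tau> *\<^sub>R h' t) \<le> XB + \<tau> * h1" by (rule norm_triangle_mono[OF XB nh(2)[OF \<tau>(1) t]])
    then have "norm (\<phi>d \<tau> t) \<le> C * (XB + \<tau> * h1)" unfolding \<phi>d_def by (rule order_trans[OF C(4) mult_left_mono[OF _ C(1)]])
    then show "norm (F' \<tau> t + \<phi>d \<tau> t) \<le> \<tau> * W' + \<tau>\<^sup>2 * d1 + C * (XB + \<tau> * h1)"
      by (rule norm_triangle_mono[OF F'b[OF \<tau>(1) t]])
  qed (simp_all add: h_def)
  show thesis
    by (rule that[OF D1 first]) (use second third in blast)+
qed

end

section \<open>The second variation of the potential\<close>

lemma continuous_on_hessian_form: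
  fixes g :: "real^'n \<Rightarrow> real" and X w :: "real \<Rightarrow> real^'n"
  assumes g: "Cb (Suc (Suc k)) g" and X: "continuous_on S X" and w: "continuous_on S w"
  shows "continuous_on S (\<lambda>t. w t \<bullet> (hessian g (X t) *v w t))"
proof -
  have "(hessian g x *v u) $ i = frechet_derivative (\<lambda>z. frechet_derivative g (at z) (axis i 1)) (at x) u" for x u i
    using inner_hessian[OF g, of "axis i 1" x u] by (simp add: inner_axis')
  then have e: "hessian g x *v u = (\<chi> i. frechet_derivative (\<lambda>z. frechet_derivative g (at z) (axis i 1)) (at x) u)" for x u
    by (simp add: vec_eq_iff)
  show ?thesis unfolding e
    by (intro continuous_on_inner w continuous_on_vec_lambda continuous_on_frechet_derivative[OF Cb_directional[OF g] X w])
qed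

lemma d_H_pos: "1/2 < H \<Longrightarrow> H < 1 \<Longrightarrow> 0 < d_H H"
  by (simp add: d_H_def Gamma_real_pos)

context forced_mode
begin

text \<open>Dominated convergence, which is why the variation runs over the sequence 1/(n+1). As the
  first derivative vanishes on the orbit, Taylor's estimate gives the constant majorant C (L W)^2
  for the scaled increments.\<close>

lemma potential_second_variation:
  assumes crit: "\<And>t v. 0 \<le> t \<Longrightarrow> frechet_derivative (divergence b) (at (X t)) v = 0"
  shows "(\<lambda>n. (real (Suc n))\<^sup>2 * ((LINT t|lebesgue_on {0..L}. divergence b (X t + (1 / real (Suc n)) *\<^sub>R h t)) -
      (LINT t|lebesgue_on {0..L}. divergence b (X t)))) \<longlonglongrightarrow>
      (LINT t|lebesgue_on {0..L}. t\<^sup>2 * (w t \<bullet> (hessian (divergence b) (X t) *v w t))) / 2"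
proof -
  let ?g = "divergence b"
  have g: "Cb (Suc (Suc 0)) ?g" by (rule Cb_divergence[OF b_Suc])
  have gc: "continuous_on UNIV ?g" using g by simp
  let ?s = "\<lambda>n t. (real (Suc n))\<^sup>2 * (?g (X t + (1 / real (Suc n)) *\<^sub>R h t) - ?g (X t))"
  let ?f = "\<lambda>t. t\<^sup>2 * (w t \<bullet> (hessian ?g (X t) *v w t)) / 2"
  obtain C where C: "0 \<le> C" "\<And>x v. norm (?g (x + v) - ?g x - frechet_derivative ?g (at x) v) \<le> C * (norm v)\<^sup>2"
    using Cb_Taylor[OF g] by metis
  have cX: "continuous_on {0..L} X" by (rule continuous_on_subset[OF continuous_X]) auto
  have cw: "continuous_on {0..L} w"
  proof (rule continuous_on_subset)
    show "continuous_on {0..} w" using w by (meson atLeast_iff continuous_on_eq_continuous_within has_vector_derivative_continuous)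
  qed auto
  have c1: "continuous_on {0..L} (\<lambda>t. ?g (X t))" by (rule continuous_on_compose2[OF gc cX]) simp
  have c2: "continuous_on {0..L} (\<lambda>t. ?g (X t + \<tau> *\<^sub>R h t))" for \<tau>
    by (rule continuous_on_compose2[OF gc continuous_on_subset[OF continuous_perturbed]]) auto
  have sc: "continuous_on {0..L} (?s n)" for n by (intro continuous_intros c1 c2)
  have fc: "continuous_on {0..L} ?f" by (intro continuous_intros continuous_on_hessian_form[OF g cX cw]) auto
  have meas: "f \<in> borel_measurable (lebesgue_on {0..L})" if "continuous_on {0..L} f" for f :: "real \<Rightarrow> real"
    by (intro borel_measurable_integrable continuous_imp_integrable_real that)
  have "(\<lambda>n. LINT t|lebesgue_on {0..L}. ?s n t) \<longlonglongrightarrow> (LINT t|lebesgue_on {0..L}. ?f t)"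
  proof (rule integral_dominated_convergence[where w = "\<lambda>t. C * (L * W)\<^sup>2"])
    show "integrable (lebesgue_on {0..L}) (\<lambda>t. C * (L * W)\<^sup>2)" by (intro continuous_imp_integrable_real continuous_intros)
    show "AE t in lebesgue_on {0..L}. (\<lambda>n. ?s n t) \<longlonglongrightarrow> ?f t"
    proof (rule AE_I2)
      fix t assume "t \<in> space (lebesgue_on {0..L})"
      then have t: "0 \<le> t" by (simp add: space_restrict_space)
      have "frechet_derivative (\<lambda>z. frechet_derivative ?g (at z) (h t)) (at (X t)) (h t) = h t \<bullet> (hessian ?g (X t) *v h t)"
        by (rule inner_hessian[OF g, symmetric])
      also have "\<dots> = t\<^sup>2 * (w t \<bullet> (hessian ?g (X t) *v w t))"
        by (simp add: h_def matrix_vector_mult_scaleR power2_eq_square)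
      finally show "(\<lambda>n. ?s n t) \<longlonglongrightarrow> ?f t"
        using Cb_second_order_limit[OF g crit[OF t], of "h t"] by simp
    qed
    show "AE t in lebesgue_on {0..L}. norm (?s n t) \<le> C * (L * W)\<^sup>2" for n
    proof (rule AE_I2)
      fix t assume "t \<in> space (lebesgue_on {0..L})"
      then have t: "t \<in> {0..L}" by (simp add: space_restrict_space)
      then have t0: "0 \<le> t" by simp
      define k where "k = real (Suc n)"
      have k: "0 < k" by (simp add: k_def)
      have "\<bar>?g (X t + (1 / k) *\<^sub>R h t) - ?g (X t)\<bar> \<le> C * (norm ((1 / k) *\<^sub>R h t))\<^sup>2"
        using C(2)[of "X t" "(1 / k) *\<^sub>R h t"] crit[OF t0] by simp
      also have "\<dots> = C * (norm (h t))\<^sup>2 / k\<^sup>2" using k by (simp add: power_divide)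
      also have "\<dots> \<le> C * (L * W)\<^sup>2 / k\<^sup>2"
        using C(1) h_bound[OF t] by (intro divide_right_mono mult_left_mono power_mono) auto
      finally have "k\<^sup>2 * \<bar>?g (X t + (1 / k) *\<^sub>R h t) - ?g (X t)\<bar> \<le> k\<^sup>2 * (C * (L * W)\<^sup>2 / k\<^sup>2)"
        by (rule mult_left_mono) simp
      then show "norm (?s n t) \<le> C * (L * W)\<^sup>2"
        unfolding k_def[symmetric] using k by (simp add: abs_mult)
    qed
  qed (intro meas sc fc)+
  moreover have "(LINT t|lebesgue_on {0..L}. ?s n t) = (real (Suc n))\<^sup>2 * ((LINT t|lebesgue_on {0..L}. ?g (X t + (1 / real (Suc n)) *\<^sub>R h t)) -
      (LINT t|lebesgue_on {0..L}. ?g (X t)))" for n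
    unfolding integral_mult_right_zero
    by (subst Bochner_Integration.integral_diff) (intro continuous_imp_integrable_real c1 c2 refl)+
  ultimately show ?thesis by simp
qed

text \<open>\<open>Q\<close> says that an upper bound for the \<tau>^2-coefficient of the functional
  along h is negative. Minimality forces the corresponding bounds at \<tau> = 1/(n+1) to be
  non-negative for large n, and their limit contradicts \<open>Q\<close>.\<close>

lemma not_local_minimizer:
  assumes crit: "\<And>t v. 0 \<le> t \<Longrightarrow> frechet_derivative (divergence b) (at (X t)) v = 0"
    and L: "0 < L" and \<epsilon>: "0 < \<epsilon>"
    and Q: "energy_const H / (2 * \<epsilon>) * ((K0 * W)\<^sup>2 * L powr (2 - 2*H) + \<Lambda>\<^sup>2 * L powr (4 - 2*H)) +
      d_H H / 4 * (LINT t|lebesgue_on {0..L}. t\<^sup>2 * (w t \<bullet> (hessian (divergence b) (X t) *v w t))) < 0"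
  shows "\<not> local_minimizer H \<sigma> L (X 0) (OM_functional H b \<sigma> (X 0) \<epsilon> L) X"
proof
  assume "local_minimizer H \<sigma> L (X 0) (OM_functional H b \<sigma> (X 0) \<epsilon> L) X"
  then obtain \<delta> where \<delta>: "\<delta> > 0" and min: "\<And>\<phi>. \<phi> \<in> affine_CM H \<sigma> L (X 0) \<Longrightarrow> (\<lambda>t. \<phi> t - X t) \<in> CM_space H \<sigma> L \<Longrightarrow>
      CM_norm H \<sigma> L (\<lambda>t. \<phi> t - X t) < \<delta> \<Longrightarrow> OM_functional H b \<sigma> (X 0) \<epsilon> L X \<le> OM_functional H b \<sigma> (X 0) \<epsilon> L \<phi>"
    unfolding local_minimizer_def by blast
  let ?En = "\<lambda>\<tau>. LINT t|lebesgue_on {0..L}. (norm (K_sigma_inv H \<sigma> L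
        (\<lambda>r. X r + \<tau> *\<^sub>R h r - X 0 - (LINT s|lebesgue_on {0..r}. b (X s + \<tau> *\<^sub>R h s))) t))\<^sup>2"
  let ?G = "\<lambda>\<tau>. LINT t|lebesgue_on {0..L}. divergence b (X t + \<tau> *\<^sub>R h t)"
  obtain D1 D2 where D1: "0 \<le> D1"
    and en: "\<And>\<tau>. 0 \<le> \<tau> \<Longrightarrow> \<tau> \<le> 1 \<Longrightarrow> ?En \<tau> \<le>
        \<tau>\<^sup>2 * (energy_const H * ((K0 * W)\<^sup>2 * L powr (2 - 2*H) + (\<Lambda> + \<tau> * D1)\<^sup>2 * L powr (4 - 2*H)))"
    and nm: "\<And>\<tau>. 0 \<le> \<tau> \<Longrightarrow> \<tau> \<le> 1 \<Longrightarrow> (LINT t|lebesgue_on {0..L}. (norm (K_sigma_inv H \<sigma> L (\<lambda>r. \<tau> *\<^sub>R h r) t))\<^sup>2) \<le> \<tau>\<^sup>2 * D2"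
    and CM: "\<And>\<tau>. 0 \<le> \<tau> \<Longrightarrow> \<tau> \<le> 1 \<Longrightarrow> (\<lambda>r. \<tau> *\<^sub>R h r) \<in> CM_space H \<sigma> L"
      "\<And>\<tau>. 0 \<le> \<tau> \<Longrightarrow> \<tau> \<le> 1 \<Longrightarrow> (\<lambda>r. X r + \<tau> *\<^sub>R h r - X 0) \<in> CM_space H \<sigma> L"
    by (rule variation_energy[OF L]) (rule that)
  let ?\<tau> = "\<lambda>n. 1 / real (Suc n)"
  have \<tau>0: "?\<tau> \<longlonglongrightarrow> 0" using LIMSEQ_inverse_real_of_nat by (simp add: inverse_eq_divide)
  have \<tau>: "0 \<le> ?\<tau> n" "?\<tau> n \<le> 1" for n by simp_all
  define B where "B = (\<lambda>\<tau>. energy_const H / (2 * \<epsilon>) * ((K0 * W)\<^sup>2 * L powr (2 - 2*H) + (\<Lambda> + \<tau> * D1)\<^sup>2 * L powr (4 - 2*H)))"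
  \<comment> \<open>The squared Cameron-Martin norm of \<tau> h is at most \<tau>^2
    \<open>D2\<close>, so the competitors enter the ball of radius \<delta>.\<close>
  have "(\<lambda>n. (?\<tau> n)\<^sup>2 * D2) \<longlonglongrightarrow> 0\<^sup>2 * D2" by (intro tendsto_intros \<tau>0)
  then have "eventually (\<lambda>n. (?\<tau> n)\<^sup>2 * D2 < \<delta>\<^sup>2) sequentially" using \<delta> by (intro order_tendstoD(2)) auto
  then have "eventually (\<lambda>n. 0 \<le> B (?\<tau> n) + d_H H / 2 * ((real (Suc n))\<^sup>2 * (?G (?\<tau> n) - (LINT t|lebesgue_on {0..L}. divergence b (X t))))) sequentially"
  proof eventually_elim
    case (elim n)
    let ?\<phi> = "\<lambda>t. X t + ?\<tau> n *\<^sub>R h t"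
    let ?g0 = "LINT t|lebesgue_on {0..L}. divergence b (X t)"
    have d: "(\<lambda>t. ?\<phi> t - X t) = (\<lambda>t. ?\<tau> n *\<^sub>R h t)" by simp
    have "CM_norm H \<sigma> L (\<lambda>t. ?\<tau> n *\<^sub>R h t) < sqrt (\<delta>\<^sup>2)"
      unfolding CM_norm_def by (rule real_sqrt_less_mono[OF le_less_trans[OF nm[OF \<tau>] elim]])
    then have "CM_norm H \<sigma> L (\<lambda>t. ?\<tau> n *\<^sub>R h t) < \<delta>" using \<delta> by simp
    then have le: "OM_functional H b \<sigma> (X 0) \<epsilon> L X \<le> OM_functional H b \<sigma> (X 0) \<epsilon> L ?\<phi>"
      using min[of ?\<phi>] CM[OF \<tau>, of n] unfolding d by (simp add: affine_CM_def)
    \<comment> \<open>The energy of the orbit enters through a lower bound, for which non-negativity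
      of the integral is enough.\<close>
    have "d_H H / 2 * ?g0 \<le> OM_functional H b \<sigma> (X 0) \<epsilon> L X"
    proof -
      have "0 \<le> (LINT t|lebesgue_on {0..L}. (norm (K_sigma_inv H \<sigma> L (\<lambda>r. X r - X 0 - (LINT s|lebesgue_on {0..r}. b (X s))) t))\<^sup>2)"
        by (intro integral_nonneg_AE) auto
      then show ?thesis using \<epsilon> by (simp add: OM_functional_def)
    qed
    moreover have "OM_functional H b \<sigma> (X 0) \<epsilon> L ?\<phi> = 1 / (2 * \<epsilon>) * ?En (?\<tau> n) + d_H H / 2 * ?G (?\<tau> n)"
      by (simp add: OM_functional_def)
    moreover have "1 / (2 * \<epsilon>) * ?En (?\<tau> n) \<le> (?\<tau> n)\<^sup>2 * B (?\<tau> n)"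
    proof -
      have "1 / (2 * \<epsilon>) * ?En (?\<tau> n) \<le> 1 / (2 * \<epsilon>) * ((?\<tau> n)\<^sup>2 * (energy_const H * ((K0 * W)\<^sup>2 * L powr (2 - 2*H) + (\<Lambda> + ?\<tau> n * D1)\<^sup>2 * L powr (4 - 2*H))))"
        using \<epsilon> by (intro mult_left_mono en \<tau>) auto
      then show ?thesis by (simp add: B_def)
    qed
    ultimately have "0 \<le> (?\<tau> n)\<^sup>2 * B (?\<tau> n) + d_H H / 2 * (?G (?\<tau> n) - ?g0)"
      using le unfolding right_diff_distrib by linarith
    then have "0 \<le> (real (Suc n))\<^sup>2 * ((?\<tau> n)\<^sup>2 * B (?\<tau> n) + d_H H / 2 * (?G (?\<tau> n) - ?g0))"
      by (intro mult_nonneg_nonneg) auto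
    moreover have "(real (Suc n))\<^sup>2 * (?\<tau> n)\<^sup>2 = 1" by (simp add: power_divide del: of_nat_Suc)
    have "(real (Suc n))\<^sup>2 * ((?\<tau> n)\<^sup>2 * B (?\<tau> n) + d_H H / 2 * (?G (?\<tau> n) - ?g0)) =
        B (?\<tau> n) + d_H H / 2 * ((real (Suc n))\<^sup>2 * (?G (?\<tau> n) - ?g0))"
    proof -
      have "K * (s * x + e * y) = (K * s) * x + e * (K * y)" for K s x e y :: real by (simp add: algebra_simps)
      then show ?thesis by (simp only: \<open>(real (Suc n))\<^sup>2 * (?\<tau> n)\<^sup>2 = 1\<close> mult_1)
    qed
    ultimately show ?case by simp
  qed
  moreover have "(\<lambda>n. B (?\<tau> n) + d_H H / 2 * ((real (Suc n))\<^sup>2 * (?G (?\<tau> n) - (LINT t|lebesgue_on {0..L}. divergence b (X t))))) \<longlonglongrightarrow>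
      B 0 + d_H H / 2 * ((LINT t|lebesgue_on {0..L}. t\<^sup>2 * (w t \<bullet> (hessian (divergence b) (X t) *v w t))) / 2)"
    unfolding B_def by (intro tendsto_intros potential_second_variation[OF crit] \<tau>0)
  ultimately have "0 \<le> B 0 + d_H H / 2 * ((LINT t|lebesgue_on {0..L}. t\<^sup>2 * (w t \<bullet> (hessian (divergence b) (X t) *v w t))) / 2)"
    by (intro tendsto_lowerbound[OF _ _ trivial_limit_sequentially])
  then show False using Q by (simp add: B_def)
qed

end

text \<open>Shifted to [0,T], the period starting at j T carries the weight (t + j T)^2. Its leading
  part contributes j^2 T^2 times the integral of \<open>v\<close> over a period, and the squares j^2
  for j < N sum to (N-1) N (2N-1)/6; the rest is at most (2j + 1) C, and these odd numbers sum to
  N^2.\<close>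

lemma integral_square_times_periodic:
  fixes v :: "real \<Rightarrow> real"
  assumes T: "0 < T" and v: "continuous_on {0..} v" and p: "\<And>t. 0 \<le> t \<Longrightarrow> v (t + T) = v t"
  obtains C where "\<And>N::nat. integral {0..real N * T} (\<lambda>t. t\<^sup>2 * v t) \<le>
    T\<^sup>2 * integral {0..T} v * ((real N - 1) * real N * (2 * real N - 1) / 6) + C * (real N)\<^sup>2"
proof -
  let ?f = "\<lambda>t. t\<^sup>2 * v t"
  have ci: "f integrable_on {a..c}" if "continuous_on {0..} f" "0 \<le> a" for f :: "real \<Rightarrow> real" and a c
    by (rule integrable_continuous_real[OF continuous_on_subset[OF that(1)]]) (use that in auto)
  have fc: "continuous_on {0..} ?f" "continuous_on {0..} (\<lambda>t. t * v t)" by (intro continuous_intros v)+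
  define a1 a2 where "a1 = integral {0..T} (\<lambda>t. t * v t)" and "a2 = integral {0..T} ?f"
  define C where "C = T * \<bar>a1\<bar> + \<bar>a2\<bar>"
  have pN: "v (t + real N * T) = v t" if "0 \<le> t" for t N
  proof (induction N)
    case (Suc N)
    have "v (t + real (Suc N) * T) = v ((t + real N * T) + T)" by (simp add: algebra_simps)
    also have "\<dots> = v (t + real N * T)" using that T by (intro p) simp
    finally show ?case using Suc by simp
  qed simp
  have "integral {0..real N * T} ?f \<le>
    T\<^sup>2 * integral {0..T} v * ((real N - 1) * real N * (2 * real N - 1) / 6) + C * (real N)\<^sup>2" for N
  proof (induction N)
    case (Suc N)
    let ?L = "real N * T"
    have L: "0 \<le> ?L" using T by simp
    have "integral {0..?L} ?f + integral {?L..?L + T} ?f = integral {0..?L + T} ?f"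
      using T L by (intro Henstock_Kurzweil_Integration.integral_combine ci fc) auto
    moreover have "integral {?L..?L + T} ?f = integral {0..T} (\<lambda>t. (t + ?L)\<^sup>2 * v t)"
    proof -
      have "integral {0 + ?L..T + ?L} ?f = integral {0..T} (?f \<circ> (\<lambda>t. t + ?L))"
        by (rule integral_shift[symmetric, OF continuous_on_subset[OF fc(1)]]) (use L in auto)
      also have "\<dots> = integral {0..T} (\<lambda>t. (t + ?L)\<^sup>2 * v t)"
        by (rule Henstock_Kurzweil_Integration.integral_cong) (simp add: pN)
      finally show ?thesis by (simp add: add.commute)
    qed
    moreover have "integral {0..T} (\<lambda>t. (t + ?L)\<^sup>2 * v t) = a2 + 2 * ?L * a1 + ?L\<^sup>2 * integral {0..T} v"
    proof -
      have "integral {0..T} (\<lambda>t. (t + ?L)\<^sup>2 * v t) = integral {0..T} (\<lambda>t. (?f t + 2 * ?L * (t * v t)) + ?L\<^sup>2 * v t)"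
        by (rule Henstock_Kurzweil_Integration.integral_cong) (simp add: power2_eq_square algebra_simps)
      also have "\<dots> = a2 + 2 * ?L * a1 + ?L\<^sup>2 * integral {0..T} v"
        by (subst Henstock_Kurzweil_Integration.integral_add Henstock_Kurzweil_Integration.integral_mult_right,
            (intro integrable_add integrable_on_mult_right ci fc v order_refl)+)+ (simp add: a1_def a2_def)
      finally show ?thesis .
    qed
    moreover have "a2 + 2 * ?L * a1 \<le> (2 * real N + 1) * C"
    proof -
      have "2 * ?L * a1 \<le> 2 * ?L * \<bar>a1\<bar>" using L by (intro mult_left_mono) auto
      moreover have "a2 \<le> \<bar>a2\<bar>" by simp
      moreover have "0 \<le> T * \<bar>a1\<bar>" "0 \<le> real N * \<bar>a2\<bar>" using T by auto
      moreover have "(2 * real N + 1) * C = 2 * ?L * \<bar>a1\<bar> + 2 * (real N * \<bar>a2\<bar>) + T * \<bar>a1\<bar> + \<bar>a2\<bar>"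
        by (simp add: C_def algebra_simps)
      ultimately show ?thesis by linarith
    qed
    ultimately have "integral {0..?L + T} ?f \<le> T\<^sup>2 * integral {0..T} v * ((real N - 1) * real N * (2 * real N - 1) / 6) + C * (real N)\<^sup>2
       + (2 * real N + 1) * C + ?L\<^sup>2 * integral {0..T} v" using Suc by linarith
    also have "\<dots> = T\<^sup>2 * integral {0..T} v * ((real (Suc N) - 1) * real (Suc N) * (2 * real (Suc N) - 1) / 6) + C * (real (Suc N))\<^sup>2"
      by (simp add: field_simps power2_eq_square)
    finally show ?case by (simp add: algebra_simps)
  qed simp
  then show thesis by (rule that)
qed

text \<open>The energy grows like \<open>N\<close> to the power \<open>4 - 2H < 3\<close>, the potential like \<open>N\<^sup>3\<close>.\<close>
lemma eventually_potential_dominates: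
  fixes a c C d H T V :: real
  assumes H: "1/2 < H" and T: "0 < T" and d: "0 < d" and V: "V < 0"
  shows "eventually (\<lambda>N. a * (real N * T) powr (2 - 2*H) + c * (real N * T) powr (4 - 2*H) +
      d * (T\<^sup>2 * V * ((real N - 1) * real N * (2 * real N - 1) / 6) + C * (real N)\<^sup>2) < 0) sequentially"
proof -
  have fl: "filterlim (\<lambda>N. real N) at_top sequentially" by (rule filterlim_real_sequentially)
  \<comment> \<open>After division by N^3 the whole expression tends to d T^2 V / 3, which is
    negative.\<close>
  have l1: "(\<lambda>N. (real N - 1) * real N * (2 * real N - 1) / 6 / real N ^ 3) \<longlonglongrightarrow> 1/3" by real_asymp
  have l2: "(\<lambda>N. (real N)\<^sup>2 / real N ^ 3) \<longlonglongrightarrow> 0" by real_asymp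
  \<comment> \<open>The exponents 2 - 2H and 4 - 2H lowered by 3; the second is negative because H >
    1/2.\<close>
  have l3: "(\<lambda>N. real N powr (-1 - 2*H)) \<longlonglongrightarrow> 0" "(\<lambda>N. real N powr (1 - 2*H)) \<longlonglongrightarrow> 0"
    using H by (auto intro!: tendsto_neg_powr fl)
  have "(\<lambda>N. a * (T powr (2 - 2*H) * real N powr (-1 - 2*H)) + c * (T powr (4 - 2*H) * real N powr (1 - 2*H)) +
      d * (T\<^sup>2 * V * ((real N - 1) * real N * (2 * real N - 1) / 6 / real N ^ 3) + C * ((real N)\<^sup>2 / real N ^ 3))) \<longlonglongrightarrow>
      a * (T powr (2 - 2*H) * 0) + c * (T powr (4 - 2*H) * 0) + d * (T\<^sup>2 * V * (1/3) + C * 0)"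
    by (intro tendsto_add tendsto_mult_left l1 l2 l3)
  moreover have "a * (T powr (2 - 2*H) * 0) + c * (T powr (4 - 2*H) * 0) + d * (T\<^sup>2 * V * (1/3) + C * 0) < 0"
    using T d V by (simp add: mult_pos_neg)
  ultimately have "eventually (\<lambda>N. a * (T powr (2 - 2*H) * real N powr (-1 - 2*H)) + c * (T powr (4 - 2*H) * real N powr (1 - 2*H)) +
      d * (T\<^sup>2 * V * ((real N - 1) * real N * (2 * real N - 1) / 6 / real N ^ 3) + C * ((real N)\<^sup>2 / real N ^ 3)) < 0) sequentially"
    by (rule order_tendstoD(2))
  then show ?thesis using eventually_gt_at_top[of 0]
  proof eventually_elim
    case (elim N)
    have N: "0 < real N" using elim(2) by simp
    have e: "real N powr s = real N powr (s - 3) * real N ^ 3" for s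
      using N powr_add[of "real N" "s - 3" 3] by (simp add: powr_numeral)
    have "(real N * T) powr s = T powr s * real N powr (s - 3) * real N ^ 3" for s
      using N T e[of s] by (simp add: powr_mult)
    note this[of "2 - 2*H"] this[of "4 - 2*H"]
    then have p: "(real N * T) powr (2 - 2*H) = T powr (2 - 2*H) * real N powr (-1 - 2*H) * real N ^ 3"
      "(real N * T) powr (4 - 2*H) = T powr (4 - 2*H) * real N powr (1 - 2*H) * real N ^ 3" by simp_all
    have "a * (real N * T) powr (2 - 2*H) + c * (real N * T) powr (4 - 2*H) +
      d * (T\<^sup>2 * V * ((real N - 1) * real N * (2 * real N - 1) / 6) + C * (real N)\<^sup>2) =
      (a * (T powr (2 - 2*H) * real N powr (-1 - 2*H)) + c * (T powr (4 - 2*H) * real N powr (1 - 2*H)) +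
      d * (T\<^sup>2 * V * ((real N - 1) * real N * (2 * real N - 1) / 6 / real N ^ 3) + C * ((real N)\<^sup>2 / real N ^ 3))) * real N ^ 3"
    proof -
      define M where "M = real N ^ 3"
      have "M \<noteq> 0" using N by (simp add: M_def)
      then show ?thesis unfolding p M_def[symmetric] by (simp add: distrib_right distrib_left mult.assoc)
    qed
    also have "\<dots> < 0" using elim(1) N by (intro mult_neg_pos) auto
    finally show ?case .
  qed
qed

text \<open>Continuity on the half-line alone would not bound a derivative; periodicity does. The
  derivative produced is the periodic extension of the given one from [0,T], which gluing allows
  once its end values agree.\<close>

lemma C1_periodic_derivative:
  assumes T: "0 < T" and C1: "C1_half_line f" and p: "\<And>t. 0 \<le> t \<Longrightarrow> f (t + T) = f t"
  obtains f' S where "\<And>t. 0 \<le> t \<Longrightarrow> (f has_real_derivative f' t) (at t within {0..})" "\<And>t. 0 \<le> t \<Longrightarrow> \<bar>f' t\<bar> \<le> S"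
proof -
  obtain g where g: "continuous_on {0..} g" "\<And>t. 0 \<le> t \<Longrightarrow> (f has_vector_derivative g t) (at t within {0..})"
    using C1 by (auto simp: C1_half_line_def has_real_derivative_iff_has_vector_derivative)
  \<comment> \<open>Both sides are right derivatives at 0, of f(t + T) and of f(t), and these
    functions agree.\<close>
  have gT: "g T = g 0"
  proof -
    have im: "(\<lambda>t. t + T) ` {0..} = {T..}" using T by (auto simp: image_iff intro!: bexI[of _ "_ - T"])
    have "((\<lambda>t. t + T) has_vector_derivative 1) (at 0 within {0..})"
      by (rule has_vector_derivative_eq_rhs[OF has_vector_derivative_add[OF has_vector_derivative_id has_vector_derivative_const]]) simp
    moreover have "(f has_vector_derivative g T) (at (0 + T) within {T..})"
      using has_vector_derivative_within_subset[OF g(2)[of T], of "{T..}"] T by auto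
    ultimately have "((\<lambda>t. f (t + T)) has_vector_derivative (1 *\<^sub>R g T)) (at 0 within {0..})"
      using vector_diff_chain_within[of "\<lambda>t. t + T" 1 0 "{0..}" f "g T"] unfolding im by (simp add: o_def)
    then have "(f has_vector_derivative g T) (at 0 within {0..})"
      by (intro has_vector_derivative_transform[of 0 "{0..}" f "\<lambda>t. f (t + T)"]) (simp_all add: p)
    moreover have "at (0::real) within {0..} \<noteq> bot"
      by (metis at_within_Ici_at_right trivial_limit_at_right_real)
    ultimately show ?thesis using g(2)[of 0] by (metis order_refl vector_derivative_unique_within)
  qed
  have gc: "continuous_on {0..T} g" by (rule continuous_on_subset[OF g(1)]) auto
  obtain S where S: "\<And>t. norm (per_ext T g t) \<le> S" by (rule per_ext_bounded[OF T gc]) (rule that)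
  have "(f has_real_derivative per_ext T g t) (at t within {0..})" if t: "0 \<le> t" for t
  proof -
    have "(per_ext T f has_vector_derivative per_ext T g t) (at t within {0..})"
    proof (rule per_ext_has_vector_derivative[OF T _ _ gT t])
      show "(f has_vector_derivative g s) (at s within {0..T})" if "s \<in> {0..T}" for s
        using that by (intro has_vector_derivative_within_subset[OF g(2)]) auto
      show "f T = f 0" using p[of 0] by simp
    qed
    then have "(f has_vector_derivative per_ext T g t) (at t within {0..})"
      by (rule has_vector_derivative_transform[rotated 2]) (use t periodic_eq_per_ext[OF T, of f] p in auto)
    then show ?thesis by (simp add: has_real_derivative_iff_has_vector_derivative)
  qed
  moreover have "\<bar>per_ext T g t\<bar> \<le> S" for t using S[of t] by simp
  ultimately show thesis by (rule that)
qed

theorem theorem5p3: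
  fixes H T :: real
    and b :: "real^'n \<Rightarrow> real^'n"
    and m M :: "'n \<Rightarrow> real"
    and \<sigma>d :: "'n \<Rightarrow> real \<Rightarrow> real"
    and \<sigma> :: "real \<Rightarrow> real^'n^'n"
    and X y :: "real \<Rightarrow> real^'n"
    and x\<^sub>0 :: "real^'n"
  assumes H: "1/2 < H" "H < 1"
    and dim: "CARD('n) \<ge> 2"
    and b_Cb3: "Cb 3 b"
    and T_pos: "0 < T"
    and sigma_diag: "\<And>t. t \<ge> 0 \<Longrightarrow> \<sigma> t = diag_matrix (\<lambda>i. \<sigma>d i t)"
    and sigma_C1: "\<And>i. C1_half_line (\<sigma>d i)"
    and sigma_periodic: "\<And>i t. t \<ge> 0 \<Longrightarrow> \<sigma>d i (t + T) = \<sigma>d i t"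
    and sigma_bounds: "\<And>i. 0 < m i" "\<And>i t. t \<ge> 0 \<Longrightarrow> m i \<le> \<sigma>d i t \<and> \<sigma>d i t \<le> M i"
    and orbit: "periodic_solution (\<lambda>_. b) T X" "X 0 = x\<^sub>0" "X T = x\<^sub>0"
    and nonconstant: "\<not> X constant_on {0..}"
    and hyperbolic: "transversally_hyperbolic b T X"
    and adjoint: "periodic_solution (\<lambda>t v. - (transpose (jacobian b (at (X t))) *v v)) T y"
    and adjoint_nonzero: "\<exists>t\<ge>0. y t \<noteq> 0"
    and grad_div_zero: "\<And>t. t \<ge> 0 \<Longrightarrow> gradient (divergence b) (X t) = 0"
    and positive_direction: "\<exists>C\<in>W_CR b \<sigma> T X y. V_eff b T X C > 0"
  shows "\<forall>\<epsilon>>0. \<exists>N_crit::nat. N_crit > 0 \<and>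
    (\<forall>N>N_crit. \<not> local_minimizer H \<sigma> (real N * T) x\<^sub>0
        (OM_functional H b \<sigma> x\<^sub>0 \<epsilon> (real N * T)) X)"
proof -
  have X: "\<And>t. 0 \<le> t \<Longrightarrow> (X has_vector_derivative b (X t)) (at t within {0..})" and Xp: "\<And>t. 0 \<le> t \<Longrightarrow> X (t + T) = X t"
    using orbit(1) by (auto simp: periodic_solution_def)
  have b1: "Cb (Suc (Suc (Suc 0))) b" using b_Cb3 by (simp add: numeral_3_eq_3)
  have g: "Cb (Suc (Suc 0)) (divergence b)" by (rule Cb_divergence[OF b1])
  have "\<exists>f' S. (\<forall>t\<ge>0. (\<sigma>d i has_real_derivative f' t) (at t within {0..})) \<and> (\<forall>t\<ge>0. \<bar>f' t\<bar> \<le> S)" for i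
    by (rule C1_periodic_derivative[OF T_pos sigma_C1[of i] sigma_periodic[of _ i]]) auto
  then obtain \<sigma>d' S where \<sigma>d': "\<And>i t. 0 \<le> t \<Longrightarrow> (\<sigma>d i has_real_derivative \<sigma>d' i t) (at t within {0..})"
    "\<And>i t. 0 \<le> t \<Longrightarrow> \<bar>\<sigma>d' i t\<bar> \<le> S i" by metis
  \<comment> \<open>One bound serves all components, since the index type is finite.\<close>
  have S: "\<bar>\<sigma>d' i t\<bar> \<le> (MAX i. S i)" if "0 \<le> t" for i t
    by (rule order_trans[OF \<sigma>d'(2)[OF that]]) simp
  interpret diagonal_noise H \<sigma> \<sigma>d \<sigma>d' m "MAX i. S i"
    by unfold_locales (use H sigma_diag \<sigma>d'(1) sigma_bounds S in auto)
  obtain \<omega> q where \<omega>: "\<omega> \<in> H1_per T" "linearization_eq b T X \<omega> (\<lambda>s. \<sigma> s *v q)"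
    and pos: "0 < V_eff b T X (mod_velocity T X `` {\<omega>})"
    using positive_direction by (auto simp: W_CR_def)
  have V: "0 < V_form b T X \<omega>"
    using pos V_eff_eq_V_form[OF b_Cb3 T_pos X grad_div_zero \<omega>(1)] by simp
  have cX: "continuous_on {0..} X"
    using X by (meson atLeast_iff continuous_on_eq_continuous_within has_vector_derivative_continuous)
  have cXT: "continuous_on {0..T} X" by (rule continuous_on_subset[OF cX]) auto
  have c\<sigma>T: "continuous_on {0..T} \<sigma>" by (rule continuous_on_subset[OF \<sigma>_continuous]) auto
  define F where "F = (\<lambda>t. frechet_derivative b (at (X t)) (\<omega> t) + \<sigma> t *v q)"
  have d\<omega>: "(\<omega> has_vector_derivative F t) (at t within {0..T})" if "t \<in> {0..T}" for t
    unfolding F_def by (rule linearization_eq_imp_ode[OF b1 T_pos cXT c\<sigma>T \<omega>(2) that])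
  have c\<omega>: "continuous_on {0..T} \<omega>"
    using d\<omega> by (meson continuous_on_eq_continuous_within has_vector_derivative_continuous)
  have cF: "continuous_on {0..T} F" unfolding F_def
    by (intro continuous_on_add continuous_on_frechet_derivative[OF b1 cXT c\<omega>] continuous_on_matrix_vector_mult c\<sigma>T continuous_on_const)
  have \<omega>T: "\<omega> T = \<omega> 0" using \<omega>(1) by (simp add: H1_per_def)
  have \<sigma>p: "\<sigma> (t + T) = \<sigma> t" if "0 \<le> t" for t
    using that T_pos sigma_diag sigma_periodic by simp
  \<comment> \<open>Matching derivatives at the junctions come from the equation itself: X, \<sigma>
    and \<omega> take equal values at 0 and T.\<close>
  have FT: "F T = F 0" using \<omega>T orbit(2,3) \<sigma>p[of 0] by (simp add: F_def)
  define w w' where "w = per_ext T \<omega>" and "w' = per_ext T F"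
  obtain W where W: "\<And>t. norm (w t) \<le> W" using per_ext_bounded[OF T_pos c\<omega>] unfolding w_def by blast
  obtain W' where W': "\<And>t. norm (w' t) \<le> W'" using per_ext_bounded[OF T_pos cF] unfolding w'_def by blast
  have dw: "(w has_vector_derivative w' t) (at t within {0..})" if "0 \<le> t" for t
    unfolding w_def w'_def by (rule per_ext_has_vector_derivative[OF T_pos d\<omega> \<omega>T FT that])
  \<comment> \<open>The forced equation extends to the half-line because X and \<sigma> are periodic
    while q is constant.\<close>
  have w'_eq: "w' t = frechet_derivative b (at (X t)) (w t) + \<sigma> t *v q" if t: "0 \<le> t" for t
    using periodic_eq_per_ext[OF T_pos, of X, OF Xp t] periodic_eq_per_ext[OF T_pos, of \<sigma>, OF \<sigma>p t]
    by (simp add: w_def w'_def F_def per_ext_def)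
  interpret forced_mode H \<sigma> \<sigma>d \<sigma>d' m "MAX i. S i" b X w w' q W W'
    by unfold_locales (rule b_Cb3 W W' | erule X dw w'_eq)+
  have crit: "frechet_derivative (divergence b) (at (X t)) v = 0" if "0 \<le> t" for t v
    using inner_gradient[OF g, of v "X t"] grad_div_zero[OF that] by simp
  let ?v = "\<lambda>t. w t \<bullet> (hessian (divergence b) (X t) *v w t)"
  have cw: "continuous_on {0..} w"
    using dw by (meson atLeast_iff continuous_on_eq_continuous_within has_vector_derivative_continuous)
  have cv: "continuous_on {0..} ?v" by (rule continuous_on_hessian_form[OF g cX cw])
  have pv: "?v (t + T) = ?v t" if "0 \<le> t" for t
    using that by (simp add: Xp w_def per_ext_plus[OF T_pos])
  \<comment> \<open>Because of the minus sign in \<open>V_form\<close>, a positive direction makes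
    this integral negative, as the cubic term requires.\<close>
  have iv: "integral {0..T} ?v = - V_form b T X \<omega>"
  proof -
    have "integral {0..T} ?v = (LINT t|lebesgue_on {0..T}. ?v t)"
      by (intro lebesgue_integral_eq_integral[symmetric] continuous_imp_integrable_real continuous_on_subset[OF cv]) auto
    also have "\<dots> = (LINT t|lebesgue_on {0..T}. \<omega> t \<bullet> (hessian (divergence b) (X t) *v \<omega> t))"
    proof (rule Bochner_Integration.integral_cong[OF refl])
      fix t assume "t \<in> space (lebesgue_on {0..T})"
      then have t: "t \<in> {0..T}" by (simp add: space_restrict_space)
      \<comment> \<open>At t = T the extension restarts with \<omega>(0), which equals
        \<omega>(T).\<close>
      have "w t = \<omega> t"
      proof (cases "t = T")
        case True
        then have "w t = w 0" using per_ext_plus[OF T_pos, of \<omega> 0] by (simp add: w_def)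
        also have "w 0 = \<omega> 0" by (simp add: w_def per_ext_def)
        finally show ?thesis using True \<omega>T by simp
      next
        case False
        then show ?thesis using per_ext_eq[OF T_pos, of t 0 \<omega>] t by (simp add: w_def)
      qed
      then show "?v t = \<omega> t \<bullet> (hessian (divergence b) (X t) *v \<omega> t)" by simp
    qed
    finally show ?thesis by (simp add: V_form_def)
  qed
  obtain C where C: "\<And>N::nat. integral {0..real N * T} (\<lambda>t. t\<^sup>2 * ?v t) \<le>
    T\<^sup>2 * integral {0..T} ?v * ((real N - 1) * real N * (2 * real N - 1) / 6) + C * (real N)\<^sup>2"
    using integral_square_times_periodic[where v = ?v, OF T_pos cv pv] by blast
  show ?thesis
  proof (intro allI impI)
    fix \<epsilon> :: real assume \<epsilon>: "0 < \<epsilon>"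
    let ?e = "energy_const H / (2 * \<epsilon>)"
    have "eventually (\<lambda>N. ?e * (K0 * W)\<^sup>2 * (real N * T) powr (2 - 2*H) + ?e * \<Lambda>\<^sup>2 * (real N * T) powr (4 - 2*H) +
      d_H H / 4 * (T\<^sup>2 * integral {0..T} ?v * ((real N - 1) * real N * (2 * real N - 1) / 6) + C * (real N)\<^sup>2) < 0) sequentially"
      by (rule eventually_potential_dominates[OF H(1) T_pos]) (use d_H_pos[OF H] iv V in auto)
    then obtain N0 where N0: "\<And>N. N0 \<le> N \<Longrightarrow> ?e * (K0 * W)\<^sup>2 * (real N * T) powr (2 - 2*H) + ?e * \<Lambda>\<^sup>2 * (real N * T) powr (4 - 2*H) +
      d_H H / 4 * (T\<^sup>2 * integral {0..T} ?v * ((real N - 1) * real N * (2 * real N - 1) / 6) + C * (real N)\<^sup>2) < 0"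
      unfolding eventually_sequentially by blast
    \<comment> \<open>The maximum with 1 makes the threshold a positive integer.\<close>
    have "\<not> local_minimizer H \<sigma> (real N * T) x\<^sub>0 (OM_functional H b \<sigma> x\<^sub>0 \<epsilon> (real N * T)) X" if N: "max N0 1 < N" for N
    proof -
      let ?L = "real N * T"
      have L: "0 < ?L" using N T_pos by simp
      have "continuous_on {0..?L} (\<lambda>t. t\<^sup>2 * ?v t)"
        by (intro continuous_intros continuous_on_subset[OF cv]) auto
      then have "(LINT t|lebesgue_on {0..?L}. t\<^sup>2 * ?v t) = integral {0..?L} (\<lambda>t. t\<^sup>2 * ?v t)"
        by (intro lebesgue_integral_eq_integral continuous_imp_integrable_real) auto
      then have I: "d_H H / 4 * (LINT t|lebesgue_on {0..?L}. t\<^sup>2 * ?v t) \<le>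
         d_H H / 4 * (T\<^sup>2 * integral {0..T} ?v * ((real N - 1) * real N * (2 * real N - 1) / 6) + C * (real N)\<^sup>2)"
        using C[of N] d_H_pos[OF H] by (intro mult_left_mono) auto
      have "\<not> local_minimizer H \<sigma> ?L (X 0) (OM_functional H b \<sigma> (X 0) \<epsilon> ?L) X"
      proof (rule not_local_minimizer[OF crit L \<epsilon>])
        show "?e * ((K0 * W)\<^sup>2 * ?L powr (2 - 2*H) + \<Lambda>\<^sup>2 * ?L powr (4 - 2*H)) + d_H H / 4 * (LINT t|lebesgue_on {0..?L}. t\<^sup>2 * ?v t) < 0"
          unfolding distrib_left mult.assoc[symmetric] using I N0[of N] N by linarith
      qed
      then show ?thesis unfolding orbit(2) .
    qed
    then show "\<exists>N_crit::nat. N_crit > 0 \<and> (\<forall>N>N_crit. \<not> local_minimizer H \<sigma> (real N * T) x\<^sub>0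
        (OM_functional H b \<sigma> x\<^sub>0 \<epsilon> (real N * T)) X)"
      by (intro exI[of _ "max N0 1"]) auto
  qed
qed

end
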